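(* Let $\mathcal{G}=(\mathcal{V},\mathcal{F},\mathcal{E}\subseteq\mathcal{V}\times\mathcal{F})$ with Hilbert spaces $\{\mathcal{H}_i\}_{i\in\mathcal{V}}$ and local operators $\{\rho_a\}_{a\in\mathcal{F}}$ be an acyclic quantum factor graph. Then there exists a sequence of closing-the-box operations, tracing out one Hilbert space $\mathcal{H}_i$ ($i\in\mathcal{V}$) at each step, that shrinks the quantum factor graph to a constant $\hat Z$. Moreover, if all local operators are proportionally close to the identity, i.e., for each $a\in\mathcal{F}$, $\rho_a=c_a(I+tH_a)$ with a constant $c_a>0$, a Hermitian operator $H_a$ on $\bigotimes_{i\in\partial a}\mathcal{H}_i$ (both independent of $t$) and a small real number $t$, then $$\hat Z=Z(\mathcal{G})+O(t^4)\qquad(t\to0).$$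
   Context: All Hilbert spaces are finite-dimensional. For positive definite operators $\rho,\sigma$ on the same space, $\rho\star\sigma=\exp(\log\rho+\log\sigma)$; for positive semidefinite operators $\rho\star\sigma=\lim_{n\to\infty}(\rho^{1/n}\sigma^{1/n})^n$. The $\star$-product is commutative and associative. Operators acting on different tensor products of spaces are first embedded into the smallest common tensor product by tensoring with identities; $\bigstar_a\rho_a$ denotes the iterated $\star$-product. A quantum factor graph (QFG) is a finite bipartite graph $\mathcal{G}=(\mathcal{V},\mathcal{F},\mathcal{E}\subseteq\mathcal{V}\times\mathcal{F})$ with a Hilbert space $\mathcal{H}_i$ for each $i\in\mathcal{V}$ and a positive semidefinite operator $\rho_a$ on $\bigotimes_{i\in\partial a}\mathcal{H}_i$ for each $a\in\mathcal{F}$, where $\partial a$ is the set of neighbors of $a$. Its global operator is $\rho=\bigstar_{a\in\mathcal{F}}\rho_a$ on $\bigotimes_{i\in\mathcal{V}}\mathcal{H}_i$, and its partition sum is $Z(\mathcal{G})=\operatorname{tr}(\rho)$. A box of $\mathcal{G}$ is a subgraph with variable vertices $\mathcal{V}'\subseteq\mathcal{V}$ and factor vertices $\mathcal{F}'\subseteq\mathcal{F}$ such that $\mathcal{F}'$ contains all neighbors of every $i\in\mathcal{V}'$. Closing the box replaces this subgraph by one factor vertex (connected to all vertices of $\bigcup_{a\in\mathcal{F}'}\partial a\setminus\mathcal{V}'$) whose local operator is the partial trace $\operatorname{tr}_{\mathcal{V}'}\big(\bigstar_{a\in\mathcal{F}'}\rho_a\big)$ over $\bigotimes_{i\in\mathcal{V}'}\mathcal{H}_i$.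 A "constant" is a trivial QFG whose only operator is a scalar on a one-dimensional Hilbert space (identified with that scalar). *)

theory Defs
  imports "HOL-Analysis.Analysis" "HOL-Library.Landau_Symbols"
begin

section \<open>Operators on a finite-dimensional Hilbert space\<close>

text \<open>
  An operator on the Hilbert space with orthonormal basis indexed by a finite set \<open>X\<close> is given by
  its matrix, a function that vanishes outside \<open>X \<times> X\<close>. Explicit index sets are used because
  the tensor products below are indexed by varying sets of vertices.
\<close>

type_synonym 'x opr = "'x \<Rightarrow> 'x \<Rightarrow> complex"

definition oprs :: "'x set \<Rightarrow> 'x opr set" where
  "oprs X = {A. \<forall>x y. x \<notin> X \<or> y \<notin> X \<longrightarrow> A x y = 0}"

definition op_id :: "'x set \<Rightarrow> 'x opr" where
  "op_id X = (\<lambda>x y. of_bool (x \<in> X \<and> x = y))"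

definition op_add :: "'x opr \<Rightarrow> 'x opr \<Rightarrow> 'x opr" where
  "op_add A B = (\<lambda>x y. A x y + B x y)"

definition op_scale :: "complex \<Rightarrow> 'x opr \<Rightarrow> 'x opr" where
  "op_scale c A = (\<lambda>x y. c * A x y)"

definition op_mult :: "'x set \<Rightarrow> 'x opr \<Rightarrow> 'x opr \<Rightarrow> 'x opr" where
  "op_mult X A B = (\<lambda>x y. \<Sum>z\<in>X. A x z * B z y)"

primrec op_pow :: "'x set \<Rightarrow> 'x opr \<Rightarrow> nat \<Rightarrow> 'x opr" where
  "op_pow X A 0 = op_id X"
| "op_pow X A (Suc n) = op_mult X A (op_pow X A n)"

definition op_trace :: "'x set \<Rightarrow> 'x opr \<Rightarrow> complex" where
  "op_trace X A = (\<Sum>x\<in>X. A x x)"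

definition op_hermitian :: "'x set \<Rightarrow> 'x opr \<Rightarrow> bool" where
  "op_hermitian X A \<longleftrightarrow> A \<in> oprs X \<and> (\<forall>x y. A y x = cnj (A x y))"

definition quad_form :: "'x set \<Rightarrow> 'x opr \<Rightarrow> ('x \<Rightarrow> complex) \<Rightarrow> complex" where
  "quad_form X A v = (\<Sum>x\<in>X. \<Sum>y\<in>X. cnj (v x) * A x y * v y)"

text \<open>The quadratic form of a Hermitian operator is real, so that taking the real part below
  only serves to compare real numbers.\<close>

definition op_psd :: "'x set \<Rightarrow> 'x opr \<Rightarrow> bool" where
  "op_psd X A \<longleftrightarrow> op_hermitian X A \<and> (\<forall>v. 0 \<le> Re (quad_form X A v))"

definition op_pd :: "'x set \<Rightarrow> 'x opr \<Rightarrow> bool" where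
  "op_pd X A \<longleftrightarrow> op_hermitian X A \<and> (\<forall>v. (\<exists>x\<in>X. v x \<noteq> 0) \<longrightarrow> 0 < Re (quad_form X A v))"

definition op_exp :: "'x set \<Rightarrow> 'x opr \<Rightarrow> 'x opr" where
  "op_exp X A = (\<lambda>x y. \<Sum>k. op_pow X A k x y / fact k)"

text \<open>The Hermitian logarithm of a positive definite operator, and the positive semidefinite
  \<open>n\<close>-th root (\<open>n \<ge> 1\<close>) of a positive semidefinite operator.\<close>

definition op_log :: "'x set \<Rightarrow> 'x opr \<Rightarrow> 'x opr" where
  "op_log X A = (THE L. op_hermitian X L \<and> op_exp X L = A)"

definition op_root :: "'x set \<Rightarrow> nat \<Rightarrow> 'x opr \<Rightarrow> 'x opr" where
  "op_root X n A = (THE R. op_psd X R \<and> op_pow X R n = A)"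

definition star :: "'x set \<Rightarrow> 'x opr \<Rightarrow> 'x opr \<Rightarrow> 'x opr" where
  "star X A B =
     (if op_pd X A \<and> op_pd X B
      then op_exp X (op_add (op_log X A) (op_log X B))
      else (\<lambda>x y. lim (\<lambda>n. op_pow X (op_mult X (op_root X n A) (op_root X n B)) n x y)))"

text \<open>The star product is associative and commutative on positive semidefinite operators, with
  unit the identity, so the enumeration of the index set chosen here does not matter.\<close>

definition star_prod :: "'x set \<Rightarrow> ('f \<Rightarrow> 'x opr) \<Rightarrow> 'f set \<Rightarrow> 'x opr" where
  "star_prod X \<rho> F =
     foldr (\<lambda>a. star X (\<rho> a)) (SOME as. distinct as \<and> set as = F) (op_id X)"


section \<open>Tensor products\<close>

text \<open>
  The Hilbert space of vertex \<open>i\<close> is \<open>\<complex>\<close> to the power \<open>d i\<close>, and the tensor product over a finite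
  set \<open>S\<close> of vertices has the product basis indexed by the configurations on \<open>S\<close>. The tensor
  product over the empty set is one-dimensional.
\<close>

definition configs :: "('v \<Rightarrow> nat) \<Rightarrow> 'v set \<Rightarrow> ('v \<Rightarrow> nat) set" where
  "configs d S = (\<Pi>\<^sub>E i\<in>S. {..<d i})"

text \<open>For \<open>S \<subseteq> T\<close>: tensoring an operator over \<open>S\<close> with the identity over \<open>T - S\<close>.\<close>

definition embed_op ::
  "('v \<Rightarrow> nat) \<Rightarrow> 'v set \<Rightarrow> 'v set \<Rightarrow> ('v \<Rightarrow> nat) opr \<Rightarrow> ('v \<Rightarrow> nat) opr" where
  "embed_op d S T A = (\<lambda>x y.
     if x \<in> configs d T \<and> y \<in> configs d T \<and> (\<forall>i\<in>T - S. x i = y i)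
     then A (restrict x S) (restrict y S) else 0)"

text \<open>For \<open>W \<subseteq> S\<close>: the partial trace over \<open>W\<close> of an operator over \<open>S\<close>, an operator over \<open>S - W\<close>.\<close>

definition partial_trace ::
  "('v \<Rightarrow> nat) \<Rightarrow> 'v set \<Rightarrow> 'v set \<Rightarrow> ('v \<Rightarrow> nat) opr \<Rightarrow> ('v \<Rightarrow> nat) opr" where
  "partial_trace d S W A = (\<lambda>x y.
     if x \<in> configs d (S - W) \<and> y \<in> configs d (S - W)
     then (\<Sum>w\<in>configs d W. A (override_on x w W) (override_on y w W)) else 0)"


section \<open>Quantum factor graphs\<close>

record ('v, 'f) qfg =
  variables :: "'v set"
  factors :: "'f set"
  edges :: "('v \<times> 'f) set"
  hdim :: "'v \<Rightarrow> nat"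
  local_op :: "'f \<Rightarrow> ('v \<Rightarrow> nat) opr"

definition var_nbrs :: "('v, 'f) qfg \<Rightarrow> 'v \<Rightarrow> 'f set" where
  "var_nbrs G i = {a. (i, a) \<in> edges G}"

definition fac_nbrs :: "('v, 'f) qfg \<Rightarrow> 'f \<Rightarrow> 'v set" where
  "fac_nbrs G a = {i. (i, a) \<in> edges G}"

definition space_of :: "('v, 'f) qfg \<Rightarrow> 'v set \<Rightarrow> ('v \<Rightarrow> nat) set" where
  "space_of G S = configs (hdim G) S"

definition quantum_factor_graph :: "('v, 'f) qfg \<Rightarrow> bool" where
  "quantum_factor_graph G \<longleftrightarrow>
     finite (variables G) \<and> finite (factors G) \<and>
     edges G \<subseteq> variables G \<times> factors G \<and>
     (\<forall>i\<in>variables G. 0 < hdim G i) \<and>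
     (\<forall>a\<in>factors G. op_psd (space_of G (fac_nbrs G a)) (local_op G a))"

text \<open>A cycle of a bipartite graph alternates between \<open>k \<ge> 2\<close> distinct variable vertices and \<open>k\<close>
  distinct factor vertices: \<open>v\<^sub>0 - f\<^sub>0 - v\<^sub>1 - f\<^sub>1 - \<dots> - f\<^bsub>k-1\<^esub> - v\<^sub>0\<close>.\<close>

definition acyclic_qfg :: "('v, 'f) qfg \<Rightarrow> bool" where
  "acyclic_qfg G \<longleftrightarrow>
     \<not> (\<exists>vs fs. length fs = length vs \<and> 2 \<le> length vs \<and> distinct vs \<and> distinct fs \<and>
          (\<forall>j<length vs. (vs ! j, fs ! j) \<in> edges G \<and>
                         (vs ! (Suc j mod length vs), fs ! j) \<in> edges G))"

text \<open>The star product of the local operators of \<open>F'\<close>, all embedded into the tensor product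
  over \<open>S\<close>.\<close>

definition joint_op :: "('v, 'f) qfg \<Rightarrow> 'v set \<Rightarrow> 'f set \<Rightarrow> ('v \<Rightarrow> nat) opr" where
  "joint_op G S F' =
     star_prod (space_of G S) (\<lambda>a. embed_op (hdim G) (fac_nbrs G a) S (local_op G a)) F'"

definition global_op :: "('v, 'f) qfg \<Rightarrow> ('v \<Rightarrow> nat) opr" where
  "global_op G = joint_op G (variables G) (factors G)"

definition partition_sum :: "('v, 'f) qfg \<Rightarrow> complex" where
  "partition_sum G = op_trace (space_of G (variables G)) (global_op G)"


section \<open>Closing the box\<close>

definition is_box :: "('v, 'f) qfg \<Rightarrow> 'v set \<Rightarrow> 'f set \<Rightarrow> bool" where
  "is_box G V' F' \<longleftrightarrow>
     V' \<subseteq> variables G \<and> F' \<subseteq> factors G \<and> (\<forall>i\<in>V'. var_nbrs G i \<subseteq> F')"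

text \<open>\<open>V'\<close> is included so that the partial trace over \<open>V'\<close> also makes sense (and contributes the
  dimension) for a vertex of \<open>V'\<close> without neighbours.\<close>

definition box_scope :: "('v, 'f) qfg \<Rightarrow> 'v set \<Rightarrow> 'f set \<Rightarrow> 'v set" where
  "box_scope G V' F' = V' \<union> (\<Union>a\<in>F'. fac_nbrs G a)"

text \<open>\<open>b\<close> names the new factor vertex. It must not be one of the remaining factor vertices,
  but may be reused from \<open>F'\<close>.\<close>

definition close_box ::
  "('v, 'f) qfg \<Rightarrow> 'v set \<Rightarrow> 'f set \<Rightarrow> 'f \<Rightarrow> ('v, 'f) qfg" where
  "close_box G V' F' b =
     \<lparr> variables = variables G - V',
       factors = insert b (factors G - F'),
       edges = {(i, a) \<in> edges G. i \<notin> V' \<and> a \<notin> F'} \<union> (box_scope G V' F' - V') \<times> {b},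
       hdim = hdim G,
       local_op = (local_op G)
         (b := partial_trace (hdim G) (box_scope G V' F') V' (joint_op G (box_scope G V' F') F')) \<rparr>"

definition is_constant :: "('v, 'f) qfg \<Rightarrow> complex \<Rightarrow> bool" where
  "is_constant G z \<longleftrightarrow>
     quantum_factor_graph G \<and> variables G = {} \<and>
     (\<exists>a. factors G = {a} \<and> local_op G a = op_scale z (op_id (space_of G {})))"

text \<open>\<open>shrinks_to G s z\<close>: the list \<open>s\<close> prescribes closing-the-box operations, each tracing out a
  single vertex \<open>i\<close> in a box with factor vertices \<open>F'\<close> that becomes the factor vertex \<open>b\<close>, and
  performing them one after the other turns \<open>G\<close> into the constant \<open>z\<close>. The prescription does
  not mention the local operators, so it can be applied to all members of a family of
  quantum factor graphs on the same bipartite graph.\<close>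

inductive shrinks_to :: "('v, 'f) qfg \<Rightarrow> ('v \<times> 'f set \<times> 'f) list \<Rightarrow> complex \<Rightarrow> bool" where
  shrinks_done: "is_constant G z \<Longrightarrow> shrinks_to G [] z"
| shrinks_close: "quantum_factor_graph G \<Longrightarrow> is_box G {i} F' \<Longrightarrow> b \<notin> factors G - F' \<Longrightarrow>
    shrinks_to (close_box G {i} F' b) s z \<Longrightarrow> shrinks_to G ((i, F', b) # s) z"

definition near_identity_qfg ::
  "('v, 'f) qfg \<Rightarrow> ('f \<Rightarrow> real) \<Rightarrow> ('f \<Rightarrow> ('v \<Rightarrow> nat) opr) \<Rightarrow> real \<Rightarrow> ('v, 'f) qfg" where
  "near_identity_qfg G c H t = G\<lparr> local_op := (\<lambda>a.
     op_scale (of_real (c a))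
       (op_add (op_id (space_of G (fac_nbrs G a))) (op_scale (of_real t) (H a)))) \<rparr>"

end

theory Submission
  imports Defs "HOL-Library.Function_Algebras" "HOL-Computational_Algebra.Fundamental_Theorem_Algebra"
begin

text \<open>
  The operators of the graph stay multiples of the identity up to \<open>O(t)\<close> throughout, so closing
  a single box is all there is to estimate. For two families \<open>A\<close> and \<open>B\<close> of this kind, the
  cyclicity of the trace gives \<open>tr exp (log A + log B) = tr (A B) + O(t\<^sup>4)\<close>. If \<open>R\<close> and \<open>S\<close> are
  the star products of the operators inside and outside of a box with variable vertices \<open>W\<close>,
  then the partition sum is \<open>tr (R S) + O(t\<^sup>4)\<close> before and \<open>tr (tr\<^sub>W R S) + O(t\<^sup>4)\<close> after closing
  the box, and \<open>tr (R S) = tr (tr\<^sub>W R S)\<close>, since \<open>S\<close> acts trivially on \<open>W\<close>.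

  That boxes can be closed in the presence of singular operators rests on the existence of the
  limit defining their star product. With \<open>P\<close>, \<open>Q\<close>, \<open>E\<close> the projections onto the ranges of
  \<open>A\<close> and \<open>B\<close> and onto the intersection of the ranges, and with logarithms taken on the
  ranges, \<open>(A\<^bsup>1/n\<^esup> B\<^bsup>1/n\<^esup>)\<^sup>n\<close> tends to \<open>E exp (E (log A + log B) E)\<close>: the factors
  \<open>P Q\<close> contract the complement of the intersection by the cosine of the Friedrichs angle.
\<close>

section \<open>Matrix algebra\<close>

text \<open>The linear form \<open>c (I + t H)\<close> is lost as soon as one box is closed, so the
  induction over the closing steps runs over all families within O(t) of a positive multiple of the
  identity. Such families are positive definite only for small t, hence the pervasive
  \<open>eventually\<close>. \<open>star\<close> is an exponential of logarithms only when both
  arguments are positive definite. Otherwise it is a \<open>lim\<close>, which says nothing until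
  convergence and positivity of the limit are proved; without them a closed graph would not be known
  to be a quantum factor graph. Logarithms and roots are definite descriptions, so existence and
  uniqueness both come from a spectral theorem, stated for matrices as a resolution of the identity.
  Sizes are measured in the Hilbert-Schmidt norm: its square is a trace, so orthogonality of
  projections becomes a Pythagorean identity. The price is that \<open>one\<close> has the square
  root of the dimension as its norm; contraction properties are therefore stated as bounds on left
  multiplication.\<close>

lemma sum_opr_apply: "(\<Sum>i\<in>I. f i) x y = (\<Sum>i\<in>I. f i x y)"
  for f :: "'i \<Rightarrow> 'x opr"
  by (induction I rule: infinite_finite_induct) auto

lemmas fun_apply_simps = plus_fun_apply zero_fun_apply minus_apply uminus_apply

text \<open>As simplification rules these would rewrite sums of operators into pointwise lambda terms.\<close>
declare fun_apply_simps [simp del]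

definition op_adj :: "'x opr \<Rightarrow> 'x opr" where
  "op_adj A = (\<lambda>x y. cnj (A y x))"

lemma op_add_eq_plus: "op_add A B = A + B"
  by (simp add: op_add_def plus_fun_def)

lemma op_adj_adj [simp]: "op_adj (op_adj A) = A"
  by (simp add: op_adj_def)

lemma op_adj_add: "op_adj (A + B) = op_adj A + op_adj B"
  by (simp add: op_adj_def plus_fun_def)

lemma op_adj_diff: "op_adj (A - B) = op_adj A - op_adj B"
  by (simp add: op_adj_def fun_diff_def)

lemma op_adj_zero [simp]: "op_adj 0 = 0"
  by (simp add: op_adj_def zero_fun_def)

lemma op_adj_scale: "op_adj (op_scale c A) = op_scale (cnj c) (op_adj A)"
  by (simp add: op_adj_def op_scale_def)

lemma op_adj_sum: "op_adj (sum f I) = (\<Sum>i\<in>I. op_adj (f i))"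
  by (intro ext) (simp add: op_adj_def sum_opr_apply)

lemma op_adj_id [simp]: "op_adj (op_id X) = op_id X"
  by (auto simp: op_adj_def op_id_def fun_eq_iff)

lemma op_adj_in_oprs [simp]: "op_adj A \<in> oprs X \<longleftrightarrow> A \<in> oprs X"
  by (auto simp: op_adj_def oprs_def)

lemma op_hermitian_iff: "op_hermitian X A \<longleftrightarrow> A \<in> oprs X \<and> op_adj A = A"
  unfolding op_hermitian_def op_adj_def fun_eq_iff by metis

lemma op_scale_add: "op_scale c (A + B) = op_scale c A + op_scale c B"
  by (simp add: op_scale_def plus_fun_def algebra_simps)

lemma op_scale_diff: "op_scale c (A - B) = op_scale c A - op_scale c B"
  by (simp add: op_scale_def fun_diff_def algebra_simps)

lemma op_scale_add_scalar: "op_scale (c + d) A = op_scale c A + op_scale d A"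
  by (simp add: op_scale_def plus_fun_def algebra_simps)

lemma op_scale_diff_scalar: "op_scale (c - d) A = op_scale c A - op_scale d A"
  by (simp add: op_scale_def fun_diff_def algebra_simps)

lemma op_scale_scale [simp]: "op_scale c (op_scale d A) = op_scale (c * d) A"
  by (simp add: op_scale_def algebra_simps)

lemma op_scale_one [simp]: "op_scale 1 A = A"
  by (simp add: op_scale_def)

lemma op_scale_zero [simp]: "op_scale 0 A = 0" "op_scale c 0 = 0"
  by (simp_all add: op_scale_def zero_fun_def)

lemma op_scale_minus_one: "op_scale (- c) A = - op_scale c A"
  by (simp add: op_scale_def fun_Compl_def)

lemma op_scale_sum: "op_scale c (sum f I) = (\<Sum>i\<in>I. op_scale c (f i))"
  by (intro ext) (simp add: op_scale_def sum_opr_apply sum_distrib_left)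

lemma op_scale_eq_0_iff: "op_scale c A = 0 \<longleftrightarrow> c = 0 \<or> A = 0"
  by (auto simp: op_scale_def fun_eq_iff zero_fun_apply)

lemma oprs_add [intro]: "A \<in> oprs X \<Longrightarrow> B \<in> oprs X \<Longrightarrow> A + B \<in> oprs X"
  by (auto simp: oprs_def fun_apply_simps)

lemma oprs_diff [intro]: "A \<in> oprs X \<Longrightarrow> B \<in> oprs X \<Longrightarrow> A - B \<in> oprs X"
  by (auto simp: oprs_def fun_apply_simps)

lemma oprs_zero [simp, intro]: "0 \<in> oprs X"
  by (auto simp: oprs_def fun_apply_simps)

lemma oprs_scale [intro]: "A \<in> oprs X \<Longrightarrow> op_scale c A \<in> oprs X"
  by (auto simp: oprs_def op_scale_def)

lemma oprs_sum [intro]: "(\<And>i. i \<in> I \<Longrightarrow> f i \<in> oprs X) \<Longrightarrow> sum f I \<in> oprs X"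
  by (induction I rule: infinite_finite_induct) auto

lemma oprs_id [simp, intro]: "op_id X \<in> oprs X"
  by (auto simp: oprs_def op_id_def)

lemma oprs_mult [intro]: "A \<in> oprs X \<Longrightarrow> B \<in> oprs X \<Longrightarrow> op_mult X A B \<in> oprs X"
  by (auto simp: oprs_def op_mult_def)

lemma oprs_pow [intro]: "A \<in> oprs X \<Longrightarrow> op_pow X A n \<in> oprs X"
  by (induction n) auto

text \<open>The Hilbert-Schmidt norm; unlike the operator norm it has a closed formula and comes
  from the inner product given by the trace.\<close>

definition op_norm :: "'x set \<Rightarrow> 'x opr \<Rightarrow> real" where
  "op_norm X A = L2_set (\<lambda>(x, y). cmod (A x y)) (X \<times> X)"

text \<open>The same type carries operators on many spaces, so product, unit and trace take the
  index set as a parameter, and \<open>one\<close> is a unit only on \<open>oprs X\<close>. Fixing a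
  finite \<open>X\<close> recovers the usual algebra.\<close>

locale index_set =
  fixes X :: "'x set"
  assumes finite_X [simp]: "finite X"
begin

abbreviation mult :: "'x opr \<Rightarrow> 'x opr \<Rightarrow> 'x opr"  (infixl "\<odot>" 70) where
  "A \<odot> B \<equiv> op_mult X A B"

abbreviation one :: "'x opr" where
  "one \<equiv> op_id X"

lemma mult_assoc: "A \<odot> B \<odot> C = A \<odot> (B \<odot> C)"
proof (intro ext)
  fix x y
  have "(A \<odot> B \<odot> C) x y = (\<Sum>z\<in>X. \<Sum>w\<in>X. A x w * B w z * C z y)"
    by (simp add: op_mult_def sum_distrib_right)
  also have "\<dots> = (\<Sum>w\<in>X. \<Sum>z\<in>X. A x w * B w z * C z y)"
    by (rule sum.swap)
  also have "\<dots> = (A \<odot> (B \<odot> C)) x y"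
    by (simp add: op_mult_def sum_distrib_left mult.assoc)
  finally show "(A \<odot> B \<odot> C) x y = (A \<odot> (B \<odot> C)) x y" .
qed

lemma mult_add_left: "(A + B) \<odot> C = A \<odot> C + B \<odot> C"
  by (simp add: op_mult_def plus_fun_def algebra_simps sum.distrib)

lemma mult_add_right: "A \<odot> (B + C) = A \<odot> B + A \<odot> C"
  by (simp add: op_mult_def plus_fun_def algebra_simps sum.distrib)

lemma mult_diff_left: "(A - B) \<odot> C = A \<odot> C - B \<odot> C"
  by (simp add: op_mult_def fun_diff_def algebra_simps sum_subtractf)

lemma mult_diff_right: "A \<odot> (B - C) = A \<odot> B - A \<odot> C"
  by (simp add: op_mult_def fun_diff_def algebra_simps sum_subtractf)

lemma mult_zero [simp]: "0 \<odot> A = 0" "A \<odot> 0 = 0"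
  by (simp_all add: op_mult_def zero_fun_def)

lemma mult_scale_left: "op_scale c A \<odot> B = op_scale c (A \<odot> B)"
  by (simp add: op_mult_def op_scale_def sum_distrib_left algebra_simps)

lemma mult_scale_right: "A \<odot> op_scale c B = op_scale c (A \<odot> B)"
  by (simp add: op_mult_def op_scale_def sum_distrib_left algebra_simps)

lemma mult_sum_left: "sum f I \<odot> A = (\<Sum>i\<in>I. f i \<odot> A)"
  by (induction I rule: infinite_finite_induct) (simp_all add: mult_add_left)

lemma mult_sum_right: "A \<odot> sum f I = (\<Sum>i\<in>I. A \<odot> f i)"
  by (induction I rule: infinite_finite_induct) (simp_all add: mult_add_right)

lemma mult_one_left [simp]: "A \<in> oprs X \<Longrightarrow> one \<odot> A = A"
proof (intro ext)
  fix x y assume "A \<in> oprs X"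
  have "(one \<odot> A) x y = (\<Sum>z\<in>X. if z = x then A x y else 0)"
    unfolding op_mult_def op_id_def by (intro sum.cong) auto
  with \<open>A \<in> oprs X\<close> show "(one \<odot> A) x y = A x y"
    by (auto simp: oprs_def fun_apply_simps)
qed

lemma mult_one_right [simp]: "A \<in> oprs X \<Longrightarrow> A \<odot> one = A"
proof (intro ext)
  fix x y assume "A \<in> oprs X"
  have "(A \<odot> one) x y = (\<Sum>z\<in>X. if z = y then A x y else 0)"
    unfolding op_mult_def op_id_def by (intro sum.cong) auto
  with \<open>A \<in> oprs X\<close> show "(A \<odot> one) x y = A x y"
    by (auto simp: oprs_def fun_apply_simps)
qed

lemmas mult_simps = mult_add_left mult_add_right mult_diff_left mult_diff_right
  mult_scale_left mult_scale_right mult_assoc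

lemma adj_mult: "op_adj (A \<odot> B) = op_adj B \<odot> op_adj A"
  by (simp add: op_adj_def op_mult_def mult.commute)

lemma pow_add: "A \<in> oprs X \<Longrightarrow> op_pow X A (m + n) = op_pow X A m \<odot> op_pow X A n"
  by (induction m) (auto simp: mult_assoc oprs_pow)

lemma pow_Suc2: "A \<in> oprs X \<Longrightarrow> op_pow X A (Suc n) = op_pow X A n \<odot> A"
  using pow_add[of A n 1] by simp

lemma trace_add: "op_trace X (A + B) = op_trace X A + op_trace X B"
  by (simp add: op_trace_def sum.distrib fun_apply_simps)

lemma trace_diff: "op_trace X (A - B) = op_trace X A - op_trace X B"
  by (simp add: op_trace_def sum_subtractf fun_apply_simps)

lemma trace_scale: "op_trace X (op_scale c A) = c * op_trace X A"
  by (simp add: op_trace_def op_scale_def sum_distrib_left)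

lemma trace_sum: "op_trace X (sum f I) = (\<Sum>i\<in>I. op_trace X (f i))"
  unfolding op_trace_def sum_opr_apply by (rule sum.swap)

lemma trace_mult_commute: "op_trace X (A \<odot> B) = op_trace X (B \<odot> A)"
  unfolding op_trace_def op_mult_def by (subst sum.swap) (simp add: mult.commute)

lemma norm_nonneg [simp]: "op_norm X A \<ge> 0"
  by (simp add: op_norm_def)

lemma norm_square: "(op_norm X A)\<^sup>2 = (\<Sum>x\<in>X. \<Sum>y\<in>X. (cmod (A x y))\<^sup>2)"
  unfolding op_norm_def L2_set_def
  by (subst real_sqrt_pow2) (auto intro!: sum_nonneg simp: sum.cartesian_product case_prod_unfold)

lemma norm_square_trace: "complex_of_real ((op_norm X A)\<^sup>2) = op_trace X (op_adj A \<odot> A)"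
  unfolding norm_square op_trace_def op_mult_def op_adj_def
  by (subst sum.swap) (simp add: mult.commute flip: complex_norm_square)

lemma norm_square_Re: "(op_norm X A)\<^sup>2 = Re (op_trace X (op_adj A \<odot> A))"
  by (metis norm_square_trace Re_complex_of_real)

lemma norm_triangle: "op_norm X (A + B) \<le> op_norm X A + op_norm X B"
proof -
  have "op_norm X (A + B) \<le> L2_set (\<lambda>p. cmod (A (fst p) (snd p)) + cmod (B (fst p) (snd p))) (X \<times> X)"
    unfolding op_norm_def by (rule L2_set_mono) (auto simp: norm_triangle_ineq fun_apply_simps)
  also have "\<dots> \<le> op_norm X A + op_norm X B"
    unfolding op_norm_def case_prod_unfold by (rule L2_set_triangle_ineq)
  finally show ?thesis .
qed

lemma norm_scale: "op_norm X (op_scale c A) = cmod c * op_norm X A"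
  unfolding op_norm_def op_scale_def case_prod_unfold norm_mult
  by (rule L2_set_right_distrib[symmetric]) simp

lemma norm_zero [simp]: "op_norm X 0 = 0"
  by (simp add: op_norm_def L2_set_def fun_apply_simps)

lemma norm_sum: "op_norm X (sum f I) \<le> (\<Sum>i\<in>I. op_norm X (f i))"
proof (induction I rule: infinite_finite_induct)
  case (insert i I)
  then show ?case
    using norm_triangle[of "f i" "sum f I"] by simp
qed simp_all

lemma norm_triangle_diff: "op_norm X (A - B) \<le> op_norm X A + op_norm X B"
  using norm_triangle[of A "op_scale (-1) B"] norm_scale[of "-1" B] by (simp add: op_scale_minus_one)

lemma entry_le_norm: "x \<in> X \<Longrightarrow> y \<in> X \<Longrightarrow> cmod (A x y) \<le> op_norm X A"
  unfolding op_norm_def using member_le_L2_set[of "X \<times> X" "(x, y)" "\<lambda>(x, y). cmod (A x y)"] by auto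

lemma norm_le_sum: "op_norm X A \<le> (\<Sum>x\<in>X. \<Sum>y\<in>X. cmod (A x y))"
  unfolding op_norm_def
  by (rule order_trans[OF L2_set_le_sum_abs]) (auto simp: sum.cartesian_product case_prod_unfold)

lemma norm_eq_0: "A \<in> oprs X \<Longrightarrow> op_norm X A = 0 \<longleftrightarrow> A = 0"
  by (auto simp: op_norm_def L2_set_eq_0_iff oprs_def fun_eq_iff fun_apply_simps)

text \<open>Cauchy-Schwarz for every entry of the product; the resulting sums separate into the two
  squared norms.\<close>

lemma norm_mult_le: "op_norm X (A \<odot> B) \<le> op_norm X A * op_norm X B"
proof (rule power2_le_imp_le)
  have *: "(cmod ((A \<odot> B) x y))\<^sup>2 \<le> (\<Sum>z\<in>X. (cmod (A x z))\<^sup>2) * (\<Sum>z\<in>X. (cmod (B z y))\<^sup>2)" for x y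
  proof -
    have "cmod ((A \<odot> B) x y) \<le> (\<Sum>z\<in>X. \<bar>cmod (A x z)\<bar> * \<bar>cmod (B z y)\<bar>)"
      unfolding op_mult_def by (rule order_trans[OF Real_Vector_Spaces.norm_sum]) (simp add: norm_mult)
    also have "\<dots> \<le> L2_set (\<lambda>z. cmod (A x z)) X * L2_set (\<lambda>z. cmod (B z y)) X"
      by (rule L2_set_mult_ineq)
    finally have "(cmod ((A \<odot> B) x y))\<^sup>2 \<le> (L2_set (\<lambda>z. cmod (A x z)) X * L2_set (\<lambda>z. cmod (B z y)) X)\<^sup>2"
      by (rule power_mono) simp
    then show ?thesis
      by (simp add: power_mult_distrib L2_set_def sum_nonneg)
  qed
  have "(op_norm X (A \<odot> B))\<^sup>2 \<le> (\<Sum>x\<in>X. \<Sum>y\<in>X. (\<Sum>z\<in>X. (cmod (A x z))\<^sup>2) * (\<Sum>z\<in>X. (cmod (B z y))\<^sup>2))"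
    unfolding norm_square by (intro sum_mono *)
  also have "\<dots> = (\<Sum>x\<in>X. \<Sum>z\<in>X. (cmod (A x z))\<^sup>2) * (\<Sum>y\<in>X. \<Sum>z\<in>X. (cmod (B z y))\<^sup>2)"
    by (simp add: sum_product)
  also have "(\<Sum>y\<in>X. \<Sum>z\<in>X. (cmod (B z y))\<^sup>2) = (\<Sum>z\<in>X. \<Sum>y\<in>X. (cmod (B z y))\<^sup>2)"
    by (rule sum.swap)
  finally show "(op_norm X (A \<odot> B))\<^sup>2 \<le> (op_norm X A * op_norm X B)\<^sup>2"
    by (simp add: power_mult_distrib norm_square)
qed simp

text \<open>Definiteness of the trace inner product. The spectral theorem works with whole matrices
  instead of vectors, and this is its criterion for a component to vanish.\<close>

lemma adj_mult_self_eq_0: "A \<in> oprs X \<Longrightarrow> op_adj A \<odot> A = 0 \<Longrightarrow> A = 0"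
  using norm_square_Re[of A] by (simp add: norm_eq_0 op_trace_def fun_apply_simps)

section \<open>Spectral theorem\<close>

text \<open>Horner's scheme, which makes the recursion over \<open>pCons\<close> hold for every
  matrix.\<close>

definition poly_apply :: "'x opr \<Rightarrow> complex poly \<Rightarrow> 'x opr" where
  "poly_apply A p = fold_coeffs (\<lambda>c B. op_scale c one + A \<odot> B) p 0"

lemma poly_apply_0 [simp]: "poly_apply A 0 = 0"
  by (simp add: poly_apply_def)

lemma poly_apply_pCons: "poly_apply A (pCons c p) = op_scale c one + A \<odot> poly_apply A p"
  by (cases "c = 0 \<and> p = 0") (auto simp: poly_apply_def)

lemma poly_apply_1 [simp]: "poly_apply A 1 = one"
  by (simp add: poly_apply_def one_pCons del: pCons_one)

lemma poly_apply_add: "poly_apply A (p + q) = poly_apply A p + poly_apply A q"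
  by (induction p q rule: poly_induct2)
     (simp_all add: poly_apply_pCons mult_simps op_scale_add_scalar)

lemma poly_apply_smult: "poly_apply A (smult c p) = op_scale c (poly_apply A p)"
  by (induction p) (simp_all add: poly_apply_pCons mult_simps op_scale_add)

lemma poly_apply_sum: "poly_apply A (sum f I) = (\<Sum>i\<in>I. poly_apply A (f i))"
  by (induction I rule: infinite_finite_induct) (simp_all add: poly_apply_add)

lemma poly_apply_monom: "A \<in> oprs X \<Longrightarrow> poly_apply A (monom c n) = op_scale c (op_pow X A n)"
  by (induction n) (simp_all add: monom_0 monom_Suc poly_apply_pCons mult_simps)

lemma poly_apply_linear_mult:
  "poly_apply A ([:- z, 1:] * p) = A \<odot> poly_apply A p - op_scale z (poly_apply A p)"
proof -
  have "[:- z, 1:] * p = smult (- z) p + pCons 0 p"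
    by simp
  then show ?thesis
    by (simp only: poly_apply_add poly_apply_smult poly_apply_pCons) (simp add: op_scale_minus_one)
qed

end

text \<open>The vector space structure brings the bound on the size of independent sets, which makes
  the powers of a matrix linearly dependent.\<close>

interpretation opr: vector_space "op_scale :: complex \<Rightarrow> 'x opr \<Rightarrow> 'x opr"
  by unfold_locales (auto simp: op_scale_add op_scale_add_scalar)

context index_set
begin

lemma finite_dimensional: "\<exists>B. finite B \<and> oprs X \<subseteq> opr.span B"
proof (intro exI conjI)
  define E :: "'x \<Rightarrow> 'x \<Rightarrow> 'x opr" where "E a b = (\<lambda>x y. of_bool (x = a \<and> y = b))" for a b
  define B where "B = (\<lambda>(a, b). E a b) ` (X \<times> X)"
  show "finite B"
    by (simp add: B_def)
  show "oprs X \<subseteq> opr.span B"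
  proof
    fix A :: "'x opr" assume A: "A \<in> oprs X"
    have "A = (\<Sum>a\<in>X. \<Sum>b\<in>X. op_scale (A a b) (E a b))"
    proof (intro ext)
      fix x y
      have "(\<Sum>a\<in>X. \<Sum>b\<in>X. op_scale (A a b) (E a b)) x y
          = (\<Sum>a\<in>X. \<Sum>b\<in>X. if x = a then if y = b then A a b else 0 else 0)"
        unfolding sum_opr_apply by (intro sum.cong refl) (auto simp: op_scale_def E_def)
      also have "\<dots> = (\<Sum>a\<in>X. if x = a then (\<Sum>b\<in>X. if y = b then A a b else 0) else 0)"
        by (intro sum.cong refl) auto
      also have "\<dots> = A x y"
        using A by (auto simp: oprs_def)
      finally show "A x y = (\<Sum>a\<in>X. \<Sum>b\<in>X. op_scale (A a b) (E a b)) x y" by simp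
    qed
    moreover have "\<dots> \<in> opr.span B"
      by (intro opr.span_sum opr.span_scale opr.span_base) (auto simp: B_def)
    ultimately show "A \<in> opr.span B" by simp
  qed
qed

text \<open>With \<open>n = card B\<close> the \<open>n + 1\<close> powers
  \<open>A^0, ..., A^n\<close> lie in a span of \<open>n\<close> matrices. Dependence is a property
  of sets, so coinciding powers form a separate case, annihilated by a difference of two
  monomials.\<close>

lemma annihilating_poly:
  assumes A: "A \<in> oprs X"
  shows "\<exists>p. p \<noteq> 0 \<and> poly_apply A p = 0"
proof -
  obtain B :: "'x opr set" where B: "finite B" "oprs X \<subseteq> opr.span B"
    using finite_dimensional by blast
  define f where "f = op_pow X A"
  define n where "n = card B"
  have f: "f ` {..n} \<subseteq> opr.span B"
    using A B(2) by (auto simp: f_def)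
  show ?thesis
  proof (cases "inj_on f {..n}")
    case True
    then have "opr.dependent (f ` {..n})"
      using opr.independent_span_bound[OF B(1) _ f] by (auto simp: card_image n_def)
    then obtain u where u: "\<exists>v\<in>f ` {..n}. u v \<noteq> 0" "(\<Sum>v\<in>f ` {..n}. op_scale (u v) v) = 0"
      by (auto simp: opr.dependent_finite)
    define p where "p = (\<Sum>i\<le>n. monom (u (f i)) i)"
    have "poly_apply A p = (\<Sum>i\<le>n. op_scale (u (f i)) (f i))"
      using A by (simp add: p_def poly_apply_sum poly_apply_monom f_def)
    also have "\<dots> = 0"
      using u(2) by (simp add: sum.reindex[OF True])
    finally have "poly_apply A p = 0" .
    moreover obtain i where i: "i \<le> n" "u (f i) \<noteq> 0"
      using u(1) by auto
    then have "coeff p i \<noteq> 0"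
      by (auto simp: p_def coeff_sum)
    then have "p \<noteq> 0" by auto
    ultimately show ?thesis by blast
  next
    case False
    then obtain i j where ij: "i \<noteq> j" "f i = f j"
      by (auto simp: inj_on_def)
    define p :: "complex poly" where "p = monom 1 i + monom (-1) j"
    have "coeff p i \<noteq> 0"
      using ij by (simp add: p_def)
    then have "p \<noteq> 0" by auto
    moreover have "poly_apply A p = 0"
      using A ij by (simp add: p_def poly_apply_add poly_apply_monom f_def op_scale_minus_one)
    ultimately show ?thesis by blast
  qed
qed

text \<open>The fundamental theorem of algebra splits the polynomial. The roots are kept as a list,
  with multiplicities, because eigencomponents are later produced by peeling off one factor at a
  time.\<close>

lemma annihilating_linear_factors:
  assumes A: "A \<in> oprs X"
  shows "\<exists>zs. foldr (\<lambda>z M. A \<odot> M - op_scale z M) zs one = 0"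
proof -
  obtain p where p: "p \<noteq> 0" "poly_apply A p = 0"
    using annihilating_poly[OF A] by blast
  obtain R where R: "p = smult (lead_coeff p) (\<Prod>x\<in>#R. [:-x, 1:])"
    using alg_closed_imp_factorization[OF p(1)] by blast
  obtain zs where zs: "mset zs = R"
    using ex_mset by blast
  have "(\<Prod>x\<in>#R. [:-x, 1:]) = prod_list (map (\<lambda>x. [:-x, 1:]) zs)"
    unfolding zs[symmetric] by (induction zs) simp_all
  moreover have "poly_apply A (prod_list (map (\<lambda>x. [:-x, 1:]) zs))
      = foldr (\<lambda>z M. A \<odot> M - op_scale z M) zs one"
    by (induction zs) (simp_all add: poly_apply_linear_mult del: mult_pCons_left)
  ultimately have "poly_apply A p = op_scale (lead_coeff p) (foldr (\<lambda>z M. A \<odot> M - op_scale z M) zs one)"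
    by (metis R poly_apply_smult)
  then show ?thesis
    using p by (auto simp: op_scale_eq_0_iff)
qed

end

section \<open>Quadratic forms and the decomposition into eigenprojections\<close>

definition op_apply :: "'x set \<Rightarrow> 'x opr \<Rightarrow> ('x \<Rightarrow> complex) \<Rightarrow> 'x \<Rightarrow> complex" where
  "op_apply X A v = (\<lambda>x. \<Sum>y\<in>X. A x y * v y)"

text \<open>Functional calculus. Keeping \<open>f\<close> apart from the eigenvalues makes
  exponentials, logarithms and roots of one operator instances of the same sum.\<close>

definition fcalc :: "real set \<Rightarrow> (real \<Rightarrow> 'x opr) \<Rightarrow> (real \<Rightarrow> real) \<Rightarrow> 'x opr" where
  "fcalc \<Lambda> P f = (\<Sum>l\<in>\<Lambda>. op_scale (of_real (f l)) (P l))"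

text \<open>A spectral resolution, with projections indexed by the eigenvalues themselves. As they
  are nonzero, every \<open>l \<in> \<Lambda>\<close> has an eigenvector, so positivity of an
  operator can be read off \<open>\<Lambda>\<close>.\<close>

locale resolution = index_set X for X :: "'x set" +
  fixes \<Lambda> :: "real set" and P :: "real \<Rightarrow> 'x opr"
  assumes finite_spec [simp]: "finite \<Lambda>"
    and proj_oprs [simp, intro]: "l \<in> \<Lambda> \<Longrightarrow> P l \<in> oprs X"
    and proj_adj: "l \<in> \<Lambda> \<Longrightarrow> op_adj (P l) = P l"
    and proj_nonzero: "l \<in> \<Lambda> \<Longrightarrow> P l \<noteq> 0"
    and proj_mult: "l \<in> \<Lambda> \<Longrightarrow> m \<in> \<Lambda> \<Longrightarrow> op_mult X (P l) (P m) = (if l = m then P l else 0)"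
    and proj_sum: "sum P \<Lambda> = op_id X"

context index_set
begin

lemma quad_form_eq: "quad_form X A v = (\<Sum>x\<in>X. cnj (v x) * op_apply X A v x)"
  by (simp add: quad_form_def op_apply_def sum_distrib_left mult.assoc)

lemma op_apply_mult: "op_apply X (A \<odot> B) v = op_apply X A (op_apply X B v)"
proof
  fix x
  have "op_apply X (A \<odot> B) v x = (\<Sum>y\<in>X. \<Sum>z\<in>X. A x z * B z y * v y)"
    by (simp add: op_apply_def op_mult_def sum_distrib_right)
  also have "\<dots> = (\<Sum>z\<in>X. \<Sum>y\<in>X. A x z * B z y * v y)"
    by (rule sum.swap)
  also have "\<dots> = op_apply X A (op_apply X B v) x"
    by (simp add: op_apply_def sum_distrib_left mult.assoc)
  finally show "op_apply X (A \<odot> B) v x = op_apply X A (op_apply X B v) x" .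
qed

lemma op_apply_one: "x \<in> X \<Longrightarrow> op_apply X one v x = v x"
proof -
  assume "x \<in> X"
  have "op_apply X one v x = (\<Sum>y\<in>X. if x = y then v y else 0)"
    unfolding op_apply_def op_id_def using \<open>x \<in> X\<close> by (intro sum.cong) auto
  with \<open>x \<in> X\<close> show ?thesis by simp
qed

lemma quad_form_gram:
  "quad_form X (op_adj B \<odot> B) v = of_real (\<Sum>x\<in>X. (cmod (op_apply X B v x))\<^sup>2)"
proof -
  have "quad_form X (op_adj B \<odot> B) v
      = (\<Sum>x\<in>X. \<Sum>z\<in>X. cnj (v x) * (cnj (B z x) * op_apply X B v z))"
    unfolding quad_form_eq op_apply_mult
    by (subst op_apply_def[of X "op_adj B"]) (simp add: op_adj_def sum_distrib_left)
  also have "\<dots> = (\<Sum>z\<in>X. (\<Sum>x\<in>X. cnj (v x) * cnj (B z x)) * op_apply X B v z)"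
    by (subst sum.swap) (simp add: sum_distrib_right mult.assoc)
  also have "\<dots> = (\<Sum>z\<in>X. cnj (op_apply X B v z) * op_apply X B v z)"
    by (simp add: op_apply_def mult.commute)
  also have "\<dots> = of_real (\<Sum>x\<in>X. (cmod (op_apply X B v x))\<^sup>2)"
    by (simp add: mult.commute flip: complex_norm_square)
  finally show ?thesis .
qed

lemma quad_form_column: "quad_form X A (\<lambda>x. B x y) = (op_adj B \<odot> A \<odot> B) y y"
  unfolding mult_assoc
  by (simp add: quad_form_def op_mult_def op_adj_def sum_distrib_left mult.assoc)

lemma psd_gram: "B \<in> oprs X \<Longrightarrow> op_psd X (op_adj B \<odot> B)"
  unfolding op_psd_def op_hermitian_iff quad_form_gram
  by (auto simp: adj_mult sum_nonneg)

text \<open>The columns of \<open>N l\<close> are eigenvectors, so this is the eigenspace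
  decomposition in matrix form. The induction removes the factor that acts first on
  \<open>M\<close>, the last of the list: the hypothesis decomposes \<open>D M\<close>, and each
  component with an eigenvalue other than \<open>z\<close> is lifted back through
  \<open>D\<close>.\<close>

lemma hermitian_eigenvector_sum:
  assumes A: "A \<in> oprs X" "op_adj A = A"
  shows "M \<in> oprs X \<Longrightarrow> foldr (\<lambda>z M. A \<odot> M - op_scale z M) zs M = 0 \<Longrightarrow>
    \<exists>\<Lambda> N. finite \<Lambda> \<and> (\<forall>l\<in>\<Lambda>. N l \<in> oprs X \<and> A \<odot> N l = op_scale (of_real l) (N l)) \<and> M = sum N \<Lambda>"
proof (induction zs arbitrary: M rule: rev_induct)
  case Nil
  then have "finite {} \<and> (\<forall>l\<in>{}. 0 \<in> oprs X \<and> A \<odot> 0 = op_scale (of_real l) 0) \<and> M = (\<Sum>l\<in>({}::real set). 0)"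
    by simp
  then show ?case by blast
next
  case (snoc z zs)
  define D where "D M = A \<odot> M - op_scale z M" for M
  have D_diff: "D (M - N) = D M - D N" for M N
    by (simp add: D_def mult_diff_right op_scale_diff algebra_simps)
  have D_sum: "D (sum f I) = (\<Sum>i\<in>I. D (f i))" for f and I :: "real set"
    by (simp add: D_def mult_sum_right op_scale_sum sum_subtractf)
  have D_oprs: "D M \<in> oprs X" if "M \<in> oprs X" for M
    unfolding D_def using A that by (intro oprs_diff oprs_mult oprs_scale)
  obtain \<Lambda> N where \<Lambda>: "finite \<Lambda>" and N: "\<And>l. l \<in> \<Lambda> \<Longrightarrow> N l \<in> oprs X"
    "\<And>l. l \<in> \<Lambda> \<Longrightarrow> A \<odot> N l = op_scale (of_real l) (N l)" and DM: "D M = sum N \<Lambda>"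
    using snoc.IH[OF D_oprs[OF snoc.prems(1)]] snoc.prems(2) by (auto simp: D_def)
  define \<Lambda>0 where "\<Lambda>0 = {l\<in>\<Lambda>. complex_of_real l \<noteq> z}"
  \<comment> \<open>On an eigencomponent for \<open>l\<close>, \<open>D\<close> multiplies by
    \<open>l - z\<close>; dividing by it gives a preimage. \<open>K\<close> is what then remains of
    \<open>M\<close>.\<close>
  define N0 where "N0 l = op_scale (1 / (of_real l - z)) (N l)" for l
  define K where "K = M - sum N0 \<Lambda>0"
  have \<Lambda>0: "finite \<Lambda>0" "\<Lambda>0 \<subseteq> \<Lambda>"
    using \<Lambda> by (auto simp: \<Lambda>0_def)
  have N0: "N0 l \<in> oprs X" "A \<odot> N0 l = op_scale (of_real l) (N0 l)" if "l \<in> \<Lambda>0" for l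
    using N that \<Lambda>0 by (auto simp: N0_def mult_scale_right)
  have K_oprs: "K \<in> oprs X"
    unfolding K_def using snoc.prems N0 by (intro oprs_diff oprs_sum) auto
  have "D (N0 l) = N l" if "l \<in> \<Lambda>0" for l
  proof -
    have "D (N0 l) = op_scale (of_real l - z) (N0 l)"
      unfolding D_def N0(2)[OF that] by (simp add: op_scale_diff_scalar)
    also have "\<dots> = N l"
      using that by (simp add: N0_def \<Lambda>0_def)
    finally show ?thesis .
  qed
  then have "D K = sum N \<Lambda> - sum N \<Lambda>0"
    by (simp add: K_def D_diff D_sum DM)
  also have "\<dots> = sum N (\<Lambda> - \<Lambda>0)"
    using \<Lambda> \<Lambda>0 by (simp add: sum_diff)
  finally have DK: "D K = sum N (\<Lambda> - \<Lambda>0)" .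
  have M: "M = sum N0 \<Lambda>0 + K"
    by (simp add: K_def)
  show ?case
  proof (cases "z \<in> \<real>")
    case True
    then obtain r where z: "z = of_real r"
      by (auto elim: Reals_cases)
    have "D (N l) = 0" if "l \<in> \<Lambda> - \<Lambda>0" for l
      using that N by (auto simp: D_def \<Lambda>0_def)
    then have "D (D K) = 0"
      by (simp add: DK D_sum)
    \<comment> \<open>For real \<open>z\<close>, \<open>D\<close> is self-adjoint. With
      \<open>Y = D K\<close> the Gram matrix of \<open>D K\<close> becomes the pairing of
      \<open>K\<close> with \<open>D (D K) = 0\<close>, which excludes Jordan blocks.\<close>
    moreover have "op_adj (D K) \<odot> Y = op_adj K \<odot> D Y" for Y
      using A by (simp add: D_def op_adj_diff adj_mult op_adj_scale z mult_simps)
    ultimately have "D K = 0"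
      using adj_mult_self_eq_0[OF D_oprs[OF K_oprs]] by simp
    then have K: "A \<odot> K = op_scale (of_real r) K"
      by (simp add: D_def z)
    have r: "r \<notin> \<Lambda>0"
      by (simp add: \<Lambda>0_def z)
    define N1 where "N1 = N0(r := K)"
    have "sum N1 (insert r \<Lambda>0) = K + sum N0 \<Lambda>0"
      using \<Lambda>0 r by (simp add: N1_def sum.insert cong: sum.cong) (intro sum.cong, auto)
    then have "M = sum N1 (insert r \<Lambda>0)"
      by (simp add: M add.commute)
    moreover have "\<forall>l\<in>insert r \<Lambda>0. N1 l \<in> oprs X \<and> A \<odot> N1 l = op_scale (of_real l) (N1 l)"
      using N0 K K_oprs by (simp add: N1_def)
    ultimately show ?thesis
      using \<Lambda>0 by blast
  next
    case False
    then have "\<Lambda>0 = \<Lambda>"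
      by (auto simp: \<Lambda>0_def)
    then have AK: "A \<odot> K = op_scale z K"
      using DK by (simp add: D_def)
    \<comment> \<open>A Hermitian operator has no eigenvector for a non-real eigenvalue: moving
      \<open>A\<close> across the product turns \<open>z\<close> into its conjugate.\<close>
    have "op_scale z (op_adj K \<odot> K) = op_adj K \<odot> (A \<odot> K)"
      by (simp add: AK mult_scale_right)
    also have "\<dots> = op_adj (A \<odot> K) \<odot> K"
      using A by (simp add: adj_mult mult_assoc)
    also have "\<dots> = op_scale (cnj z) (op_adj K \<odot> K)"
      by (simp add: AK op_adj_scale mult_scale_left)
    finally have "op_scale (z - cnj z) (op_adj K \<odot> K) = 0"
      by (simp add: op_scale_diff_scalar)
    moreover have "z - cnj z \<noteq> 0"
      using False by (metis Reals_cnj_iff eq_iff_diff_eq_0)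
    ultimately have "K = 0"
      using adj_mult_self_eq_0[OF K_oprs] by (simp add: op_scale_eq_0_iff)
    then have "M = sum N0 \<Lambda>0"
      by (simp add: M)
    then show ?thesis
      using \<Lambda>0 N0 by blast
  qed
qed

text \<open>Decomposing \<open>one\<close> itself yields the eigenprojections: components for
  different eigenvalues are orthogonal, so multiplying the adjoint of \<open>P m\<close> by the sum
  of all \<open>P l\<close> leaves only the diagonal term. Thus \<open>P m\<close> is its own Gram
  matrix, hence self-adjoint and idempotent.\<close>

theorem spectral_theorem:
  assumes "op_hermitian X A"
  obtains \<Lambda> P where "resolution X \<Lambda> P" "A = fcalc \<Lambda> P (\<lambda>l. l)"
proof -
  have A: "A \<in> oprs X" "op_adj A = A"
    using assms by (auto simp: op_hermitian_iff)
  obtain zs where "foldr (\<lambda>z M. A \<odot> M - op_scale z M) zs one = 0"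
    using annihilating_linear_factors[OF A(1)] by blast
  from hermitian_eigenvector_sum[OF A oprs_id this]
  obtain \<Lambda> P where \<Lambda>: "finite \<Lambda>"
    and P: "\<And>l. l \<in> \<Lambda> \<Longrightarrow> P l \<in> oprs X" "\<And>l. l \<in> \<Lambda> \<Longrightarrow> A \<odot> P l = op_scale (of_real l) (P l)"
    and one: "one = sum P \<Lambda>" by blast
  have orth: "op_adj (P m) \<odot> P l = 0" if "l \<in> \<Lambda>" "m \<in> \<Lambda>" "l \<noteq> m" for l m
  proof -
    have "op_scale (of_real l) (op_adj (P m) \<odot> P l) = op_adj (P m) \<odot> (A \<odot> P l)"
      using that P by (simp add: mult_scale_right)
    also have "\<dots> = op_adj (A \<odot> P m) \<odot> P l"
      using A by (simp add: adj_mult mult_assoc)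
    also have "\<dots> = op_scale (of_real m) (op_adj (P m) \<odot> P l)"
      using that P by (simp add: mult_scale_left op_adj_scale)
    finally have "op_scale (of_real l - of_real m) (op_adj (P m) \<odot> P l) = 0"
      by (simp add: op_scale_diff_scalar)
    with that show ?thesis
      by (simp add: op_scale_eq_0_iff)
  qed
  have gram: "op_adj (P m) \<odot> P m = op_adj (P m)" if "m \<in> \<Lambda>" for m
  proof -
    have "op_adj (P m) = op_adj (P m) \<odot> one"
      using P(1) that by simp
    also have "\<dots> = (\<Sum>l\<in>\<Lambda>. op_adj (P m) \<odot> P l)"
      unfolding one by (rule mult_sum_right)
    also have "\<dots> = (\<Sum>l\<in>\<Lambda>. if l = m then op_adj (P m) \<odot> P m else 0)"
      using orth that by (intro sum.cong) auto
    also have "\<dots> = op_adj (P m) \<odot> P m"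
      using that \<Lambda> by simp
    finally show ?thesis by simp
  qed
  have adj: "op_adj (P m) = P m" if "m \<in> \<Lambda>" for m
    by (metis adj_mult op_adj_adj gram[OF that])
  \<comment> \<open>Values whose component vanishes are not eigenvalues and would violate
    \<open>proj_nonzero\<close>.\<close>
  define \<Lambda>' where "\<Lambda>' = {l\<in>\<Lambda>. P l \<noteq> 0}"
  have \<Lambda>': "\<Lambda>' \<subseteq> \<Lambda>" "finite \<Lambda>'"
    using \<Lambda> by (auto simp: \<Lambda>'_def)
  have "sum P \<Lambda>' = one"
    unfolding one using \<Lambda> by (intro sum.mono_neutral_left) (auto simp: \<Lambda>'_def)
  moreover have "resolution X \<Lambda>' P \<longleftrightarrow> sum P \<Lambda>' = one"
  proof
    assume *: "sum P \<Lambda>' = one"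
    show "resolution X \<Lambda>' P"
    proof
      show "P l \<odot> P m = (if l = m then P l else 0)" if "l \<in> \<Lambda>'" "m \<in> \<Lambda>'" for l m
        using that \<Lambda>' orth[of m l] gram[of m] adj[of l] by (auto simp: subset_iff)
    qed (use \<Lambda>' P adj * in \<open>auto simp: \<Lambda>'_def\<close>)
  qed (rule resolution.proj_sum)
  moreover have "A = fcalc \<Lambda>' P (\<lambda>l. l)"
  proof -
    have "A = A \<odot> sum P \<Lambda>'"
      using A \<open>sum P \<Lambda>' = one\<close> by simp
    also have "\<dots> = (\<Sum>l\<in>\<Lambda>'. A \<odot> P l)"
      by (rule mult_sum_right)
    also have "\<dots> = fcalc \<Lambda>' P (\<lambda>l. l)"
      unfolding fcalc_def using P(2) \<Lambda>' by (intro sum.cong) auto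
    finally show ?thesis .
  qed
  ultimately show ?thesis using that by blast
qed

end

section \<open>Functional calculus of a resolution of the identity\<close>

context resolution
begin

lemma fcalc_oprs [simp, intro]: "fcalc \<Lambda> P f \<in> oprs X"
  unfolding fcalc_def by (intro oprs_sum oprs_scale proj_oprs)

lemma fcalc_adj [simp]: "op_adj (fcalc \<Lambda> P f) = fcalc \<Lambda> P f"
  unfolding fcalc_def by (simp add: op_adj_sum op_adj_scale proj_adj)

lemma fcalc_hermitian: "op_hermitian X (fcalc \<Lambda> P f)"
  by (simp add: op_hermitian_iff)

lemma fcalc_cong: "(\<And>l. l \<in> \<Lambda> \<Longrightarrow> f l = g l) \<Longrightarrow> fcalc \<Lambda> P f = fcalc \<Lambda> P g"
  unfolding fcalc_def by (intro sum.cong) auto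

lemma fcalc_one: "fcalc \<Lambda> P (\<lambda>_. 1) = one"
  by (simp add: fcalc_def proj_sum)

lemma fcalc_add: "fcalc \<Lambda> P f + fcalc \<Lambda> P g = fcalc \<Lambda> P (\<lambda>l. f l + g l)"
  by (simp add: fcalc_def op_scale_add_scalar sum.distrib)

lemma fcalc_diff: "fcalc \<Lambda> P f - fcalc \<Lambda> P g = fcalc \<Lambda> P (\<lambda>l. f l - g l)"
  by (simp add: fcalc_def op_scale_diff_scalar sum_subtractf)

lemma fcalc_scale: "op_scale (of_real c) (fcalc \<Lambda> P f) = fcalc \<Lambda> P (\<lambda>l. c * f l)"
  by (simp add: fcalc_def op_scale_sum)

lemma fcalc_const: "fcalc \<Lambda> P (\<lambda>_. c) = op_scale (of_real c) one"
  using fcalc_scale[of c "\<lambda>_. 1"] by (simp add: fcalc_one)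

lemma fcalc_mult_proj: "m \<in> \<Lambda> \<Longrightarrow> fcalc \<Lambda> P f \<odot> P m = op_scale (of_real (f m)) (P m)"
proof -
  assume m: "m \<in> \<Lambda>"
  have "fcalc \<Lambda> P f \<odot> P m = (\<Sum>l\<in>\<Lambda>. if l = m then op_scale (of_real (f m)) (P m) else 0)"
    unfolding fcalc_def mult_sum_left using m
    by (intro sum.cong) (auto simp: mult_scale_left proj_mult)
  with m show ?thesis by simp
qed

lemma proj_mult_fcalc: "m \<in> \<Lambda> \<Longrightarrow> P m \<odot> fcalc \<Lambda> P f = op_scale (of_real (f m)) (P m)"
  using arg_cong[OF fcalc_mult_proj[of m f], of op_adj] by (simp add: adj_mult op_adj_scale proj_adj)

lemma fcalc_mult: "fcalc \<Lambda> P f \<odot> fcalc \<Lambda> P g = fcalc \<Lambda> P (\<lambda>l. f l * g l)"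
proof -
  have "fcalc \<Lambda> P f \<odot> fcalc \<Lambda> P g = (\<Sum>l\<in>\<Lambda>. fcalc \<Lambda> P f \<odot> op_scale (of_real (g l)) (P l))"
    unfolding fcalc_def[of _ _ g] by (rule mult_sum_right)
  also have "\<dots> = fcalc \<Lambda> P (\<lambda>l. f l * g l)"
    unfolding fcalc_def[of _ _ "\<lambda>l. f l * g l"]
    by (intro sum.cong refl) (simp add: mult_scale_right fcalc_mult_proj mult.commute)
  finally show ?thesis .
qed

lemma fcalc_pow: "op_pow X (fcalc \<Lambda> P f) n = fcalc \<Lambda> P (\<lambda>l. f l ^ n)"
  by (induction n) (simp_all add: fcalc_one fcalc_mult)

lemma fcalc_apply: "fcalc \<Lambda> P f x y = (\<Sum>l\<in>\<Lambda>. of_real (f l) * P l x y)"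
  by (simp add: fcalc_def sum_opr_apply op_scale_def)

lemma op_exp_fcalc: "op_exp X (fcalc \<Lambda> P f) = fcalc \<Lambda> P (\<lambda>l. exp (f l))"
proof (intro ext)
  fix x y
  have "(\<lambda>k. (\<Sum>l\<in>\<Lambda>. of_real (f l ^ k /\<^sub>R fact k) * P l x y)) sums (\<Sum>l\<in>\<Lambda>. of_real (exp (f l)) * P l x y)"
    by (intro sums_sum sums_mult2 sums_of_real exp_converges)
  moreover have "(\<lambda>k. (\<Sum>l\<in>\<Lambda>. of_real (f l ^ k /\<^sub>R fact k) * P l x y))
      = (\<lambda>k. op_pow X (fcalc \<Lambda> P f) k x y / fact k)"
    by (intro ext) (simp add: fcalc_pow fcalc_apply sum_divide_distrib divide_inverse mult_ac sum_distrib_left)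
  ultimately show "op_exp X (fcalc \<Lambda> P f) x y = fcalc \<Lambda> P (\<lambda>l. exp (f l)) x y"
    unfolding op_exp_def by (simp add: sums_unique[symmetric] fcalc_apply)
qed

lemma fcalc_gram:
  "(\<And>l. l \<in> \<Lambda> \<Longrightarrow> 0 \<le> f l) \<Longrightarrow>
    fcalc \<Lambda> P f = op_adj (fcalc \<Lambda> P (\<lambda>l. sqrt (f l))) \<odot> fcalc \<Lambda> P (\<lambda>l. sqrt (f l))"
  by (simp add: fcalc_mult) (rule fcalc_cong, simp)

lemma fcalc_psd: "(\<And>l. l \<in> \<Lambda> \<Longrightarrow> 0 \<le> f l) \<Longrightarrow> op_psd X (fcalc \<Lambda> P f)"
  by (metis fcalc_gram psd_gram fcalc_oprs)

lemma fcalc_pd: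
  assumes f: "\<And>l. l \<in> \<Lambda> \<Longrightarrow> 0 < f l"
  shows "op_pd X (fcalc \<Lambda> P f)"
  unfolding op_pd_def
proof (intro conjI allI impI fcalc_hermitian)
  fix v :: "'x \<Rightarrow> complex"
  assume "\<exists>x\<in>X. v x \<noteq> 0"
  then obtain x where x: "x \<in> X" "v x \<noteq> 0" by blast
  define B where "B = fcalc \<Lambda> P (\<lambda>l. sqrt (f l))"
  define C where "C = fcalc \<Lambda> P (\<lambda>l. 1 / sqrt (f l))"
  have "C \<odot> B = one"
    unfolding B_def C_def fcalc_mult fcalc_one[symmetric] using f by (intro fcalc_cong) force
  then have "op_apply X C (op_apply X B v) x = v x"
    using x by (simp add: op_apply_one flip: op_apply_mult)
  then obtain y where y: "y \<in> X" "op_apply X B v y \<noteq> 0"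
    using x unfolding op_apply_def[of X C] by (metis (no_types, lifting) mult_zero_right sum.neutral)
  have "0 < (\<Sum>x\<in>X. (cmod (op_apply X B v x))\<^sup>2)"
    using y by (intro sum_pos2[of X y]) auto
  moreover have "fcalc \<Lambda> P f = op_adj B \<odot> B"
    unfolding B_def using f by (intro fcalc_gram less_imp_le)
  then have "quad_form X (fcalc \<Lambda> P f) v = of_real (\<Sum>x\<in>X. (cmod (op_apply X B v x))\<^sup>2)"
    by (simp only: quad_form_gram)
  ultimately show "0 < Re (quad_form X (fcalc \<Lambda> P f) v)" by simp
qed

text \<open>A nonzero column of \<open>P m\<close> is an eigenvector; with \<open>c\<close> its
  squared length, the quadratic form there isolates the value \<open>f m\<close>.\<close>

lemma proj_test_vector:
  assumes m: "m \<in> \<Lambda>"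
  obtains v c where "0 < c" "\<And>f. quad_form X (fcalc \<Lambda> P f) v = of_real (c * f m)" "\<exists>x\<in>X. v x \<noteq> 0"
proof -
  obtain x y where xy: "P m x y \<noteq> 0"
    using proj_nonzero[OF m] by (auto simp: fun_eq_iff zero_fun_apply)
  with m have X: "x \<in> X" "y \<in> X"
    using proj_oprs[OF m] by (auto simp: oprs_def)
  define c where "c = (\<Sum>x\<in>X. (cmod (P m x y))\<^sup>2)"
  have "P m y y = (op_adj (P m) \<odot> P m) y y"
    using m by (simp add: proj_adj proj_mult)
  also have "\<dots> = of_real c"
    by (simp add: op_mult_def op_adj_def c_def mult.commute flip: complex_norm_square)
  finally have c: "P m y y = of_real c" .
  have "0 < c"
    unfolding c_def using X xy by (intro sum_pos2[of X x]) auto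
  moreover have "quad_form X (fcalc \<Lambda> P f) (\<lambda>x. P m x y) = of_real (c * f m)" for f
  proof -
    have "quad_form X (fcalc \<Lambda> P f) (\<lambda>x. P m x y) = (op_scale (of_real (f m)) (P m)) y y"
      using m by (simp add: quad_form_column proj_adj proj_mult_fcalc mult_scale_left proj_mult)
    then show ?thesis
      by (simp add: op_scale_def c)
  qed
  ultimately show ?thesis
    using that[of c "\<lambda>x. P m x y"] X xy by blast
qed

lemma psd_fcalc_nonneg: "op_psd X (fcalc \<Lambda> P f) \<Longrightarrow> m \<in> \<Lambda> \<Longrightarrow> 0 \<le> f m"
proof -
  assume A: "op_psd X (fcalc \<Lambda> P f)" and m: "m \<in> \<Lambda>"
  obtain v c where c: "0 < c" and q: "\<And>f. quad_form X (fcalc \<Lambda> P f) v = of_real (c * f m)"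
    by (rule proj_test_vector[OF m]) blast
  have "0 \<le> Re (quad_form X (fcalc \<Lambda> P f) v)"
    using A unfolding op_psd_def by blast
  then show ?thesis
    using c unfolding q by (simp add: zero_le_mult_iff)
qed

lemma pd_fcalc_pos: "op_pd X (fcalc \<Lambda> P f) \<Longrightarrow> m \<in> \<Lambda> \<Longrightarrow> 0 < f m"
proof -
  assume A: "op_pd X (fcalc \<Lambda> P f)" and m: "m \<in> \<Lambda>"
  obtain v c where c: "0 < c" and q: "\<And>f. quad_form X (fcalc \<Lambda> P f) v = of_real (c * f m)"
    and v: "\<exists>x\<in>X. v x \<noteq> 0"
    by (rule proj_test_vector[OF m]) blast
  have "0 < Re (quad_form X (fcalc \<Lambda> P f) v)"
    using A v unfolding op_pd_def by blast
  then show ?thesis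
    using c unfolding q by (simp add: zero_less_mult_iff)
qed

text \<open>Sandwiching the common operator between \<open>P l\<close> and \<open>Q m\<close> gives
  \<open>(f l - g m) P l Q m = 0\<close>. Only pairs with \<open>f l = g m\<close> contribute, and
  on these \<open>f'\<close> and \<open>g'\<close> agree. This is the source of uniqueness for
  logarithms and roots.\<close>

lemma fcalc_unique:
  assumes "resolution X M Q" and eq: "fcalc \<Lambda> P f = fcalc M Q g"
    and imp: "\<And>l m. l \<in> \<Lambda> \<Longrightarrow> m \<in> M \<Longrightarrow> f l = g m \<Longrightarrow> f' l = g' m"
  shows "fcalc \<Lambda> P f' = fcalc M Q g'"
proof -
  interpret Q: resolution X M Q by fact
  have *: "op_scale (of_real (f' l)) (P l \<odot> Q m) = op_scale (of_real (g' m)) (P l \<odot> Q m)"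
    if l: "l \<in> \<Lambda>" and m: "m \<in> M" for l m
  proof (cases "f l = g m")
    case True
    then show ?thesis using imp[OF l m] by simp
  next
    case False
    have "op_scale (of_real (f l)) (P l \<odot> Q m) = P l \<odot> fcalc \<Lambda> P f \<odot> Q m"
      using l by (simp add: proj_mult_fcalc mult_scale_left)
    also have "\<dots> = op_scale (of_real (g m)) (P l \<odot> Q m)"
      unfolding eq using m by (simp add: mult_assoc Q.fcalc_mult_proj mult_scale_right)
    finally have "op_scale (of_real (f l) - of_real (g m)) (P l \<odot> Q m) = 0"
      by (simp add: op_scale_diff_scalar)
    with False have "P l \<odot> Q m = 0"
      by (simp add: op_scale_eq_0_iff)
    then show ?thesis by simp
  qed
  have "fcalc \<Lambda> P f' = fcalc \<Lambda> P f' \<odot> sum Q M"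
    by (simp add: Q.proj_sum)
  also have "\<dots> = (\<Sum>m\<in>M. \<Sum>l\<in>\<Lambda>. op_scale (of_real (f' l)) (P l \<odot> Q m))"
    by (simp add: fcalc_def mult_sum_right mult_sum_left mult_scale_left)
  also have "\<dots> = (\<Sum>m\<in>M. \<Sum>l\<in>\<Lambda>. op_scale (of_real (g' m)) (P l \<odot> Q m))"
    using * by (intro sum.cong refl) auto
  also have "\<dots> = sum P \<Lambda> \<odot> fcalc M Q g'"
    by (simp add: fcalc_def mult_sum_right mult_sum_left mult_scale_right op_scale_sum)
  also have "\<dots> = fcalc M Q g'"
    by (simp add: proj_sum)
  finally show ?thesis .
qed

text \<open>For uniqueness a competing logarithm is diagonalised by a resolution of its own,
  unrelated to the given one, and compared through \<open>fcalc_unique\<close>, with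
  \<open>ln\<close> undoing \<open>exp\<close>.\<close>

lemma op_log_fcalc:
  assumes f: "\<And>l. l \<in> \<Lambda> \<Longrightarrow> 0 < f l"
  shows "op_log X (fcalc \<Lambda> P f) = fcalc \<Lambda> P (\<lambda>l. ln (f l))"
  unfolding op_log_def
proof (rule the_equality)
  show "op_hermitian X (fcalc \<Lambda> P (\<lambda>l. ln (f l))) \<and> op_exp X (fcalc \<Lambda> P (\<lambda>l. ln (f l))) = fcalc \<Lambda> P f"
    using f by (auto simp: fcalc_hermitian op_exp_fcalc intro: fcalc_cong)
  fix L assume L: "op_hermitian X L \<and> op_exp X L = fcalc \<Lambda> P f"
  then obtain M Q where Q: "resolution X M Q" and L_eq: "L = fcalc M Q (\<lambda>l. l)"
    using spectral_theorem[of L] by blast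
  have "fcalc \<Lambda> P f = fcalc M Q exp"
    using L resolution.op_exp_fcalc[OF Q, of "\<lambda>l. l"] by (simp add: L_eq)
  from fcalc_unique[OF Q this, of "\<lambda>l. ln (f l)" "\<lambda>l. l"]
  show "L = fcalc \<Lambda> P (\<lambda>l. ln (f l))"
    by (simp add: L_eq)
qed

lemma op_root_fcalc:
  assumes f: "\<And>l. l \<in> \<Lambda> \<Longrightarrow> 0 \<le> f l" and n: "0 < n"
  shows "op_root X n (fcalc \<Lambda> P f) = fcalc \<Lambda> P (\<lambda>l. root n (f l))"
  unfolding op_root_def
proof (rule the_equality)
  show "op_psd X (fcalc \<Lambda> P (\<lambda>l. root n (f l))) \<and> op_pow X (fcalc \<Lambda> P (\<lambda>l. root n (f l))) n = fcalc \<Lambda> P f"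
    using f n by (auto simp: fcalc_pow intro: fcalc_cong fcalc_psd)
  fix R assume R: "op_psd X R \<and> op_pow X R n = fcalc \<Lambda> P f"
  then obtain M Q where Q: "resolution X M Q" and R_eq: "R = fcalc M Q (\<lambda>l. l)"
    using spectral_theorem[of R] unfolding op_psd_def by blast
  \<comment> \<open>Positivity of the competitor is what lets \<open>root n\<close> undo the
    \<open>n\<close>-th power on its spectrum for even \<open>n\<close>.\<close>
  have nonneg: "0 \<le> m" if "m \<in> M" for m
    using resolution.psd_fcalc_nonneg[OF Q _ that, of "\<lambda>l. l"] R by (simp add: R_eq)
  have "fcalc \<Lambda> P f = fcalc M Q (\<lambda>l. l ^ n)"
    using R resolution.fcalc_pow[OF Q, of "\<lambda>l. l"] by (simp add: R_eq)
  from fcalc_unique[OF Q this, of "\<lambda>l. root n (f l)" "\<lambda>l. l"]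
  show "R = fcalc \<Lambda> P (\<lambda>l. root n (f l))"
    using n nonneg by (simp add: R_eq real_root_power_cancel)
qed

end

section \<open>Exponential and logarithm of Hermitian operators\<close>

context index_set
begin

lemma pd_imp_psd: "op_pd X A \<Longrightarrow> op_psd X A"
proof -
  assume A: "op_pd X A"
  then obtain \<Lambda> P where P: "resolution X \<Lambda> P" and A_eq: "A = fcalc \<Lambda> P (\<lambda>l. l)"
    using spectral_theorem[of A] unfolding op_pd_def by blast
  interpret resolution X \<Lambda> P by fact
  show ?thesis
    using A pd_fcalc_pos[of "\<lambda>l. l"] unfolding A_eq by (intro fcalc_psd less_imp_le) auto
qed

lemma exp_pd: "op_hermitian X L \<Longrightarrow> op_pd X (op_exp X L)"
  by (erule spectral_theorem) (auto simp: resolution.op_exp_fcalc intro!: resolution.fcalc_pd)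

lemma log_exp: "op_hermitian X L \<Longrightarrow> op_log X (op_exp X L) = L"
  by (erule spectral_theorem) (auto simp: resolution.op_exp_fcalc resolution.op_log_fcalc)

lemma pd_log:
  assumes A: "op_pd X A"
  shows "op_hermitian X (op_log X A)" "op_exp X (op_log X A) = A"
proof -
  obtain \<Lambda> P where P: "resolution X \<Lambda> P" and A_eq: "A = fcalc \<Lambda> P (\<lambda>l. l)"
    using spectral_theorem[of A] A unfolding op_pd_def by blast
  interpret resolution X \<Lambda> P by fact
  have pos: "0 < l" if "l \<in> \<Lambda>" for l
    using A pd_fcalc_pos[of "\<lambda>l. l"] that unfolding A_eq by auto
  have "op_log X A = fcalc \<Lambda> P ln"
    using op_log_fcalc[of "\<lambda>l. l"] pos by (simp add: A_eq)
  then show "op_hermitian X (op_log X A)" "op_exp X (op_log X A) = A"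
    using pos by (auto simp: fcalc_hermitian op_exp_fcalc A_eq intro: fcalc_cong)
qed

lemma hermitian_add: "op_hermitian X A \<Longrightarrow> op_hermitian X B \<Longrightarrow> op_hermitian X (A + B)"
  by (auto simp: op_hermitian_iff op_adj_add)

lemma hermitian_zero: "op_hermitian X 0"
  by (auto simp: op_hermitian_iff)

lemma hermitian_scale: "op_hermitian X A \<Longrightarrow> op_hermitian X (op_scale (of_real c) A)"
  by (auto simp: op_hermitian_iff op_adj_scale)

lemma hermitian_sum: "(\<And>i. i \<in> I \<Longrightarrow> op_hermitian X (f i)) \<Longrightarrow> op_hermitian X (sum f I)"
  by (induction I rule: infinite_finite_induct) (simp_all add: hermitian_zero hermitian_add)

lemma exp_zero: "op_exp X 0 = one"
proof -
  obtain \<Lambda> P where P: "resolution X \<Lambda> P"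
    by (rule spectral_theorem[OF hermitian_zero]) blast
  interpret resolution X \<Lambda> P by fact
  have "fcalc \<Lambda> P (\<lambda>_. 0) = 0"
    by (simp add: fcalc_const)
  then show ?thesis
    using op_exp_fcalc[of "\<lambda>_. 0"] by (simp add: fcalc_one)
qed

text \<open>Lets a positive factor of an operator be moved in and out of its logarithm as a multiple
  of the identity.\<close>

lemma exp_add_scalar:
  assumes "op_hermitian X L"
  shows "op_exp X (op_scale (of_real c) one + L) = op_scale (of_real (exp c)) (op_exp X L)"
proof -
  obtain \<Lambda> P where P: "resolution X \<Lambda> P" and L: "L = fcalc \<Lambda> P (\<lambda>l. l)"
    by (rule spectral_theorem[OF assms]) blast
  interpret resolution X \<Lambda> P by fact
  show ?thesis
    unfolding L fcalc_const[symmetric] fcalc_add op_exp_fcalc fcalc_scale exp_add by simp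
qed

lemma star_exp:
  "op_hermitian X K \<Longrightarrow> op_hermitian X L \<Longrightarrow> star X (op_exp X K) (op_exp X L) = op_exp X (K + L)"
  by (simp add: star_def exp_pd log_exp op_add_eq_plus)

end

section \<open>The star product of positive semidefinite operators\<close>

context resolution
begin

text \<open>Pythagoras: the pieces \<open>P l \<odot> M\<close> are mutually orthogonal for the
  trace inner product.\<close>

lemma norm_fcalc_mult_square:
  "(op_norm X (fcalc \<Lambda> P f \<odot> M))\<^sup>2 = (\<Sum>l\<in>\<Lambda>. (f l)\<^sup>2 * (op_norm X (P l \<odot> M))\<^sup>2)"
proof -
  have "(op_norm X (fcalc \<Lambda> P f \<odot> M))\<^sup>2 = Re (op_trace X (op_adj M \<odot> (fcalc \<Lambda> P f \<odot> fcalc \<Lambda> P f \<odot> M)))"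
    by (simp add: norm_square_Re adj_mult mult_assoc)
  also have "\<dots> = Re (op_trace X (\<Sum>l\<in>\<Lambda>. op_scale (of_real ((f l)\<^sup>2)) (op_adj M \<odot> (P l \<odot> M))))"
    unfolding fcalc_mult
    by (simp add: fcalc_def mult_sum_left mult_sum_right mult_scale_left mult_scale_right power2_eq_square)
  also have "\<dots> = (\<Sum>l\<in>\<Lambda>. (f l)\<^sup>2 * Re (op_trace X (op_adj M \<odot> (P l \<odot> M))))"
    by (simp add: trace_sum trace_scale flip: of_real_power)
  also have "\<dots> = (\<Sum>l\<in>\<Lambda>. (f l)\<^sup>2 * (op_norm X (P l \<odot> M))\<^sup>2)"
  proof (intro sum.cong refl)
    fix l assume l: "l \<in> \<Lambda>"
    have "op_adj (P l \<odot> M) \<odot> (P l \<odot> M) = op_adj M \<odot> (P l \<odot> P l \<odot> M)"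
      using l by (simp only: adj_mult proj_adj mult_assoc)
    also have "\<dots> = op_adj M \<odot> (P l \<odot> M)"
      using l by (simp add: proj_mult)
    finally show "(f l)\<^sup>2 * Re (op_trace X (op_adj M \<odot> (P l \<odot> M))) = (f l)\<^sup>2 * (op_norm X (P l \<odot> M))\<^sup>2"
      by (simp add: norm_square_Re)
  qed
  finally show ?thesis .
qed

text \<open>In effect an operator-norm estimate; submultiplicativity of \<open>op_norm\<close> would
  in general cost a factor that depends on the dimension.\<close>

lemma norm_fcalc_mult_le:
  assumes "M \<in> oprs X" "0 \<le> q" "\<And>l. l \<in> \<Lambda> \<Longrightarrow> \<bar>f l\<bar> \<le> q"
  shows "op_norm X (fcalc \<Lambda> P f \<odot> M) \<le> q * op_norm X M"
proof (rule power2_le_imp_le)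
  have "(op_norm X (fcalc \<Lambda> P f \<odot> M))\<^sup>2 \<le> (\<Sum>l\<in>\<Lambda>. q\<^sup>2 * (op_norm X (P l \<odot> M))\<^sup>2)"
    unfolding norm_fcalc_mult_square
    using assms by (intro sum_mono mult_right_mono) (auto simp: abs_le_square_iff[symmetric])
  also have "\<dots> = q\<^sup>2 * (op_norm X (fcalc \<Lambda> P (\<lambda>_. 1) \<odot> M))\<^sup>2"
    unfolding norm_fcalc_mult_square by (simp add: sum_distrib_left)
  also have "\<dots> = (q * op_norm X M)\<^sup>2"
    using assms(1) by (simp add: fcalc_one power_mult_distrib)
  finally show "(op_norm X (fcalc \<Lambda> P f \<odot> M))\<^sup>2 \<le> (q * op_norm X M)\<^sup>2" .
qed (use assms in simp)

lemma norm_fcalc_tendsto: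
  assumes "\<And>l. l \<in> \<Lambda> \<Longrightarrow> (\<lambda>n. f n l) \<longlonglongrightarrow> g l"
  shows "(\<lambda>n. op_norm X (fcalc \<Lambda> P (f n) - fcalc \<Lambda> P g)) \<longlonglongrightarrow> 0"
proof (rule Lim_null_comparison)
  have "op_norm X (fcalc \<Lambda> P (f n) - fcalc \<Lambda> P g) \<le> (\<Sum>l\<in>\<Lambda>. \<bar>f n l - g l\<bar> * op_norm X (P l))" for n
    unfolding fcalc_diff unfolding fcalc_def
    by (rule order_trans[OF norm_sum]) (simp add: norm_scale del: of_real_diff)
  then show "\<forall>\<^sub>F n in sequentially. norm (op_norm X (fcalc \<Lambda> P (f n) - fcalc \<Lambda> P g))
      \<le> (\<Sum>l\<in>\<Lambda>. \<bar>f n l - g l\<bar> * op_norm X (P l))"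
    by simp
  have "(\<lambda>n. \<Sum>l\<in>\<Lambda>. \<bar>f n l - g l\<bar> * op_norm X (P l)) \<longlonglongrightarrow> (\<Sum>l\<in>\<Lambda>. \<bar>g l - g l\<bar> * op_norm X (P l))"
    using assms by (intro tendsto_intros)
  then show "(\<lambda>n. \<Sum>l\<in>\<Lambda>. \<bar>f n l - g l\<bar> * op_norm X (P l)) \<longlonglongrightarrow> 0"
    by simp
qed

end

section \<open>Projections onto ranges and the angle between them\<close>

definition projection :: "'x set \<Rightarrow> 'x opr \<Rightarrow> bool" where
  "projection X P \<longleftrightarrow> op_hermitian X P \<and> op_mult X P P = P"

text \<open>The difference quotient at 0 of the function sending \<open>h\<close> to
  \<open>l\<close> to the power \<open>h\<close>, sampled at \<open>h = 1 / n\<close>.\<close>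

lemma root_expansion_limit:
  fixes l :: real
  assumes "0 < l"
  shows "(\<lambda>n. real n * (root n l - 1)) \<longlonglongrightarrow> ln l"
proof -
  have "((\<lambda>h. exp (ln l * h)) has_real_derivative ln l) (at 0)"
    by (auto intro!: derivative_eq_intros)
  then have "((\<lambda>h. (exp (ln l * h) - 1) / h) \<longlongrightarrow> ln l) (at 0)"
    by (simp add: DERIV_def)
  moreover have "filterlim (\<lambda>n. 1 / real n) (at 0) sequentially"
    unfolding filterlim_at using lim_1_over_n
    by (auto simp: eventually_at_top_linorder intro!: exI[of _ 1])
  ultimately have "(\<lambda>n. (exp (ln l * (1 / real n)) - 1) / (1 / real n)) \<longlonglongrightarrow> ln l"
    by (rule filterlim_compose)
  moreover have "\<forall>\<^sub>F n in sequentially. (exp (ln l * (1 / real n)) - 1) / (1 / real n) = real n * (root n l - 1)"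
    using eventually_gt_at_top[of 0]
  proof eventually_elim
    case (elim n)
    then have "root n l = exp (ln l * (1 / real n))"
      using assms by (simp add: root_powr_inverse powr_def mult.commute)
    then show ?case by simp
  qed
  ultimately show ?thesis
    by (rule Lim_transform_eventually)
qed

context index_set
begin

text \<open>The eigenvalue 0 contributes 0 to every root, while the roots of positive eigenvalues
  tend to 1. So the roots tend to the range projection \<open>P\<close>, with the logarithm on the
  range as first-order term.\<close>

lemma root_expansion:
  assumes A: "op_psd X A"
  obtains P h hn where "projection X P" "op_hermitian X h" "\<And>n. hn n \<in> oprs X"
    "\<And>n. 0 < n \<Longrightarrow> op_root X n A = P + op_scale (of_real (1 / real n)) (hn n)"
    "(\<lambda>n. op_norm X (hn n - h)) \<longlonglongrightarrow> 0"
proof -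
  obtain \<Lambda> R where R: "resolution X \<Lambda> R" and A_eq: "A = fcalc \<Lambda> R (\<lambda>l. l)"
    using spectral_theorem[of A] A unfolding op_psd_def by blast
  interpret resolution X \<Lambda> R by fact
  have nonneg: "0 \<le> l" if "l \<in> \<Lambda>" for l
    using psd_fcalc_nonneg[of "\<lambda>l. l"] A that by (simp add: A_eq)
  define P where "P = fcalc \<Lambda> R (\<lambda>l. of_bool (0 < l))"
  define h where "h = fcalc \<Lambda> R (\<lambda>l. if 0 < l then ln l else 0)"
  define hn where "hn n = fcalc \<Lambda> R (\<lambda>l. if 0 < l then real n * (root n l - 1) else 0)" for n :: nat
  show thesis
  proof (rule that)
    show "projection X P"
      by (auto simp: projection_def P_def fcalc_hermitian fcalc_mult intro: fcalc_cong)
    show "op_hermitian X h" "hn n \<in> oprs X" for n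
      by (auto simp: h_def hn_def fcalc_hermitian)
    show "op_root X n A = P + op_scale (of_real (1 / real n)) (hn n)" if n: "0 < n" for n
      unfolding A_eq P_def hn_def fcalc_scale fcalc_add using n
      using nonneg by (subst op_root_fcalc) (auto intro!: fcalc_cong dest!: nonneg)
    show "(\<lambda>n. op_norm X (hn n - h)) \<longlonglongrightarrow> 0"
      unfolding hn_def h_def by (rule norm_fcalc_tendsto) (simp add: root_expansion_limit)
  qed
qed

lemma projection_oprs: "projection X P \<Longrightarrow> P \<in> oprs X"
  and projection_adj: "projection X P \<Longrightarrow> op_adj P = P"
  and projection_mult: "projection X P \<Longrightarrow> P \<odot> P = P"
  by (auto simp: projection_def op_hermitian_iff)

lemma projection_pythagoras:
  assumes P: "projection X P"
  shows "(op_norm X (M - P \<odot> M))\<^sup>2 = (op_norm X M)\<^sup>2 - (op_norm X (P \<odot> M))\<^sup>2"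
proof -
  have PP: "P \<odot> (P \<odot> M) = P \<odot> M"
    by (simp add: projection_mult[OF P] flip: mult_assoc)
  have "op_adj (M - P \<odot> M) \<odot> (M - P \<odot> M) = op_adj M \<odot> M - op_adj (P \<odot> M) \<odot> (P \<odot> M)"
    by (simp add: op_adj_diff adj_mult projection_adj[OF P] mult_simps PP)
  then show ?thesis
    by (simp add: norm_square_Re trace_diff)
qed

lemma projection_contracts: "projection X P \<Longrightarrow> op_norm X (P \<odot> M) \<le> op_norm X M"
  by (rule power2_le_imp_le) (use projection_pythagoras[of P M] zero_le_power2 in \<open>smt\<close>, simp)

text \<open>The range of \<open>E\<close> is the intersection of the ranges of \<open>P\<close> and \<open>Q\<close>, and \<open>q\<close> is the cosine of
  the Friedrichs angle between them.\<close>

lemma friedrichs_angle: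
  assumes P: "projection X P" and Q: "projection X Q"
  obtains E q where "projection X E" "P \<odot> E = E" "Q \<odot> E = E" "0 \<le> q" "q < 1"
    "\<And>M. M \<in> oprs X \<Longrightarrow> op_norm X ((P \<odot> Q - E) \<odot> M) \<le> q * op_norm X M"
proof -
  note Ps = projection_oprs[OF P] projection_adj[OF P] projection_mult[OF P]
  note Qs = projection_oprs[OF Q] projection_adj[OF Q] projection_mult[OF Q]
  \<comment> \<open>On the range of \<open>Q\<close> the eigenvalues of \<open>G\<close> are squared
    cosines of the angles between the two ranges; the eigenvalue 1 marks the intersection.\<close>
  define G where "G = Q \<odot> (P \<odot> Q)"
  have PPx: "P \<odot> (P \<odot> M) = P \<odot> M" and QQx: "Q \<odot> (Q \<odot> M) = Q \<odot> M" for M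
    by (simp_all add: Ps Qs flip: mult_assoc)
  have G_gram: "G = op_adj (P \<odot> Q) \<odot> (P \<odot> Q)"
    by (simp add: G_def adj_mult Ps Qs mult_assoc PPx)
  then have G: "op_psd X G"
    using Ps Qs by (auto intro!: psd_gram)
  then obtain \<Gamma> R where R: "resolution X \<Gamma> R" and G_eq: "G = fcalc \<Gamma> R (\<lambda>l. l)"
    using spectral_theorem[of G] unfolding op_psd_def by blast
  interpret resolution X \<Gamma> R by fact
  have nonneg: "0 \<le> l" if "l \<in> \<Gamma>" for l
    using psd_fcalc_nonneg[of "\<lambda>l. l"] G that by (simp add: G_eq)
  have le_1: "l \<le> 1" if l: "l \<in> \<Gamma>" for l
  proof -
    have "op_norm X (Q \<odot> (P \<odot> (Q \<odot> R l))) \<le> op_norm X (R l)"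
      using projection_contracts[OF P] projection_contracts[OF Q] by (meson order_trans)
    moreover have "Q \<odot> (P \<odot> (Q \<odot> R l)) = op_scale (of_real l) (R l)"
      using fcalc_mult_proj[OF l, of "\<lambda>l. l"] by (simp add: G_eq[symmetric] G_def mult_assoc)
    ultimately have "l * op_norm X (R l) \<le> 1 * op_norm X (R l)"
      using nonneg[OF l] by (simp add: norm_scale)
    moreover have "op_norm X (R l) \<noteq> 0"
      using l by (simp add: norm_eq_0 proj_nonzero)
    then have "op_norm X (R l) > 0"
      using norm_nonneg[of "R l"] by linarith
    ultimately show ?thesis
      by (simp add: mult_le_cancel_right)
  qed
  define E where "E = fcalc \<Gamma> R (\<lambda>l. of_bool (l = 1))"
  have E: "projection X E"
    by (auto simp: projection_def E_def fcalc_hermitian fcalc_mult intro: fcalc_cong)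
  note Es = projection_oprs[OF E] projection_adj[OF E] projection_mult[OF E]
  have GE: "Q \<odot> (P \<odot> (Q \<odot> E)) = E"
  proof -
    have "G \<odot> E = E"
      unfolding G_eq E_def fcalc_mult by (intro fcalc_cong) auto
    then show ?thesis by (simp add: G_def mult_assoc)
  qed
  have QE: "Q \<odot> E = E"
    by (metis GE QQx)
  have EQ: "E \<odot> Q = E"
    using arg_cong[OF QE, of op_adj] by (simp add: adj_mult Qs Es)
  have QPE: "Q \<odot> (P \<odot> E) = E"
    using GE by (simp add: QE)
  \<comment> \<open>From \<open>Q P E = E\<close> the norm of \<open>E\<close> does not shrink under
    \<open>P\<close>; equality in Pythagoras forces \<open>P E = E\<close>.\<close>
  have PE: "P \<odot> E = E"
  proof -
    have "(op_norm X (P \<odot> E))\<^sup>2 = Re (op_trace X (op_adj E \<odot> (P \<odot> E)))"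
      by (simp add: norm_square_Re adj_mult Ps mult_assoc PPx)
    also have "op_adj E \<odot> (P \<odot> E) = E \<odot> (Q \<odot> (P \<odot> E))"
      by (simp add: Es EQ flip: mult_assoc)
    also have "\<dots> = op_adj E \<odot> E"
      by (simp add: QPE Es)
    finally have "(op_norm X (P \<odot> E))\<^sup>2 = (op_norm X E)\<^sup>2"
      by (simp only: norm_square_Re)
    then have "(op_norm X (E - P \<odot> E))\<^sup>2 = 0"
      by (simp add: projection_pythagoras[OF P])
    then have "E - P \<odot> E = 0"
      using Ps(1) Es(1) by (subst (asm) zero_eq_power2) (subst (asm) norm_eq_0, auto)
    then show ?thesis by simp
  qed
  have EP: "E \<odot> P = E"
    using arg_cong[OF PE, of op_adj] by (simp add: adj_mult Ps Es)
  define f where "f l = (if l = 1 then 0 else l)" for l :: real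
  \<comment> \<open>The largest eigenvalue of \<open>G\<close> below 1, under a square root because
    \<open>G\<close> is quadratic in \<open>P \<odot> Q\<close>. Inserting 0 covers an empty
    spectrum.\<close>
  define q where "q = sqrt (Max (insert 0 (f ` \<Gamma>)))"
  have f: "0 \<le> f l" "f l \<le> q\<^sup>2" if "l \<in> \<Gamma>" for l
    using that nonneg by (auto simp: f_def q_def Max_ge_iff)
  have "Max (insert 0 (f ` \<Gamma>)) \<in> insert 0 (f ` \<Gamma>)"
    by (rule Max_in) auto
  then have "Max (insert 0 (f ` \<Gamma>)) < 1"
    using le_1 by (fastforce simp: f_def order_le_less)
  then have q: "0 \<le> q" "q < 1"
    by (auto simp: q_def)
  have "op_norm X ((P \<odot> Q - E) \<odot> M) \<le> q * op_norm X M" if M: "M \<in> oprs X" for M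
  proof -
    define N where "N = P \<odot> Q - E"
    define S where "S = fcalc \<Gamma> R (\<lambda>l. sqrt (f l))"
    \<comment> \<open>\<open>E\<close> absorbs \<open>P\<close> and \<open>Q\<close> on both sides,
      so the mixed terms collapse to \<open>E\<close>. Hence \<open>N\<close> acts on norms like the
      square root of \<open>G\<close> without its eigenvalue 1.\<close>
    have "op_adj N \<odot> N = G - E"
      by (simp add: N_def G_def op_adj_diff adj_mult mult_simps Ps Qs Es PPx PE QE EP EQ
          mult_assoc[symmetric, of E P Q])
    also have "\<dots> = fcalc \<Gamma> R f"
      unfolding G_eq E_def fcalc_diff by (intro fcalc_cong) (auto simp: f_def)
    also have "\<dots> = op_adj S \<odot> S"
      unfolding S_def by (rule fcalc_gram) (rule f)
    finally have "op_adj (N \<odot> M) \<odot> (N \<odot> M) = op_adj (S \<odot> M) \<odot> (S \<odot> M)"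
      by (metis adj_mult mult_assoc)
    then have "(op_norm X (N \<odot> M))\<^sup>2 = (op_norm X (S \<odot> M))\<^sup>2"
      by (simp add: norm_square_Re)
    then have "op_norm X (N \<odot> M) = op_norm X (S \<odot> M)"
      by (simp add: power2_eq_iff_nonneg)
    also have "\<dots> \<le> q * op_norm X M"
      unfolding S_def using f q M by (intro norm_fcalc_mult_le) (auto intro!: real_le_lsqrt)
    finally show ?thesis by (simp add: N_def)
  qed
  then show thesis
    using that[of E q] E PE QE q by blast
qed

lemma norm_scale_inverse: "op_norm X (op_scale (of_real (1 / real n)) A) = op_norm X A / n"
  by (simp add: norm_scale norm_divide)

section \<open>Powers of perturbed contractions\<close>

lemma norm_pow_mult_le:
  assumes "A \<in> oprs X" "0 \<le> r" "\<And>M. M \<in> oprs X \<Longrightarrow> op_norm X (A \<odot> M) \<le> r * op_norm X M"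
    and M: "M \<in> oprs X"
  shows "op_norm X (op_pow X A m \<odot> M) \<le> r ^ m * op_norm X M"
proof (induction m)
  case 0
  then show ?case using M by simp
next
  case (Suc m)
  have "op_norm X (op_pow X A (Suc m) \<odot> M) \<le> r * op_norm X (op_pow X A m \<odot> M)"
    using assms by (simp add: mult_assoc oprs_mult oprs_pow)
  also have "\<dots> \<le> r * (r ^ m * op_norm X M)"
    using Suc assms by (intro mult_left_mono) auto
  finally show ?case by (simp add: mult.assoc)
qed

text \<open>If \<open>T\<close> is within \<open>1 / n\<close> of a contraction \<open>E + N\<close> that fixes the range of \<open>E\<close> and strictly
  contracts its complement, then \<open>n\<close> steps of \<open>T\<close> are close to \<open>n\<close> steps of the compression
  \<open>S\<close> to the range of \<open>E\<close>: the components that leave the range of \<open>E\<close> at one of the steps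
  form a geometric series.\<close>

lemma compressed_power_bound:
  fixes n :: nat and K q \<epsilon> :: real
  defines "B \<equiv> exp K"
  assumes E: "projection X E" and N: "N \<in> oprs X" "E \<odot> N = 0" "N \<odot> E = 0"
    and contr: "\<And>M. M \<in> oprs X \<Longrightarrow> op_norm X ((E + N) \<odot> M) \<le> op_norm X M"
    and q: "\<And>M. M \<in> oprs X \<Longrightarrow> op_norm X (N \<odot> M) \<le> q * op_norm X M" "0 \<le> q" "q < 1"
    and C: "C \<in> oprs X" "C0 \<in> oprs X" "op_norm X C \<le> K" "op_norm X C0 \<le> K" "op_norm X (C - C0) \<le> \<epsilon>"
    and n: "0 < n"
    and T: "T = E + N + op_scale (of_real (1 / real n)) C"
    and S: "S = E + op_scale (of_real (1 / real n)) (E \<odot> C0 \<odot> E)"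
  shows "op_norm X (op_pow X T n - op_pow X S n)
    \<le> (2 * q ^ n + 2 * B * K / n / (1 - q)
        + B * (2 * K / n / (1 - q) + (2 * B * K\<^sup>2 / n / (1 - q) + B * \<epsilon>))) * op_norm X one"
proof -
  note Es = projection_oprs[OF E] projection_adj[OF E] projection_mult[OF E]
  have EEx: "E \<odot> (E \<odot> M) = E \<odot> M" and NEx: "N \<odot> (E \<odot> M) = 0" and ENx: "E \<odot> (N \<odot> M) = 0" for M
    by (simp_all add: Es N flip: mult_assoc)
  have K: "0 \<le> K"
    using C(3) norm_nonneg[of C] by linarith
  have \<epsilon>: "0 \<le> \<epsilon>"
    using C(5) norm_nonneg[of "C - C0"] by linarith
  have B: "1 \<le> B"
    using K by (simp add: B_def)
  have E_contr: "op_norm X (E \<odot> M) \<le> op_norm X M" for M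
    using E by (rule projection_contracts)
  have C_mult: "op_norm X (C \<odot> M) \<le> K * op_norm X M"
    and C0_mult: "op_norm X (C0 \<odot> M) \<le> K * op_norm X M"
    and CC0_mult: "op_norm X ((C - C0) \<odot> M) \<le> \<epsilon> * op_norm X M" for M
    using C by (auto intro!: order_trans[OF norm_mult_le] mult_right_mono)
  \<comment> \<open>One step of \<open>T\<close> or of \<open>S\<close> expands by at most
    \<open>s\<close>, and \<open>n\<close> steps by at most \<open>exp K\<close>, uniformly in
    \<open>n\<close>.\<close>
  define s where "s = 1 + K / n"
  have s: "1 \<le> s"
    using K by (simp add: s_def)
  have sB: "s ^ m \<le> B" if "m \<le> n" for m
  proof -
    have "s ^ m \<le> s ^ n"
      using s that by (rule power_increasing[rotated])
    also have "\<dots> \<le> B"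
      unfolding s_def B_def using K n exp_ge_one_plus_x_over_n_power_n[of "n" K] by simp
    finally show ?thesis .
  qed
  have T_oprs: "T \<in> oprs X" and S_oprs: "S \<in> oprs X"
    unfolding T S using Es N C by auto
  have T_contr: "op_norm X (T \<odot> M) \<le> s * op_norm X M" if "M \<in> oprs X" for M
  proof -
    have "op_norm X (T \<odot> M) \<le> op_norm X ((E + N) \<odot> M) + op_norm X (op_scale (of_real (1 / real n)) (C \<odot> M))"
      unfolding T mult_add_left[of "E + N"] mult_scale_left by (rule norm_triangle)
    also have "\<dots> \<le> op_norm X M + K * op_norm X M / n"
      using C_mult[of M] contr[OF that] n
      by (intro add_mono) (simp_all add: norm_scale divide_right_mono norm_divide)
    finally show ?thesis by (simp add: s_def algebra_simps)
  qed
  have S_contr: "op_norm X (S \<odot> M) \<le> s * op_norm X M" if "M \<in> oprs X" for M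
  proof -
    have "op_norm X (S \<odot> M) \<le> op_norm X (E \<odot> M) + op_norm X (op_scale (of_real (1 / real n)) (E \<odot> (C0 \<odot> (E \<odot> M))))"
      unfolding S mult_add_left mult_scale_left mult_assoc by (rule norm_triangle)
    also have "\<dots> \<le> op_norm X M + K * op_norm X M / n"
    proof -
      have "op_norm X (E \<odot> (C0 \<odot> (E \<odot> M))) \<le> K * op_norm X (E \<odot> M)"
        using E_contr C0_mult by (meson order_trans)
      also have "\<dots> \<le> K * op_norm X M"
        using E_contr K by (intro mult_left_mono) auto
      finally show ?thesis
        using E_contr[of M] n by (simp add: norm_scale divide_right_mono add_mono norm_divide)
    qed
    finally show ?thesis by (simp add: s_def algebra_simps)
  qed
  have T_pow: "op_norm X (op_pow X T m \<odot> M) \<le> B * op_norm X M" if "M \<in> oprs X" "m \<le> n" for m M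
    using norm_pow_mult_le[OF T_oprs _ T_contr that(1), of m] s sB[OF that(2)]
    by (smt (verit) mult_right_mono norm_nonneg)
  \<comment> \<open>Cost of one perturbation acting off the range of \<open>E\<close>:
    \<open>2\<close> comes from the triangle inequality for \<open>M - E \<odot> M\<close>,
    \<open>K / n\<close> from the perturbation, \<open>B\<close> from the remaining powers.\<close>
  define d where "d = 2 * B * K / n"
  have d: "0 \<le> d"
    using K B by (simp add: d_def)
  have geo: "(\<Sum>i<m. q ^ i) \<le> 1 / (1 - q)" for m
    using q(2,3) by (simp add: sum_gp_strict divide_right_mono)
  \<comment> \<open>The factor acting first is split off. Since \<open>E \<odot> N = 0\<close>, the
    matrix \<open>N \<odot> M\<close> equals \<open>N \<odot> M - E \<odot> (N \<odot> M)\<close>,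
    so the induction hypothesis applies to it and gains a factor \<open>q\<close>.\<close>
  have decay: "op_norm X (op_pow X T m \<odot> (M - E \<odot> M)) \<le> (2 * q ^ m + d * (\<Sum>i<m. q ^ i)) * op_norm X M"
    if "m \<le> n" "M \<in> oprs X" for m M
    using that
  proof (induction m arbitrary: M)
    case 0
    have "M - E \<odot> M \<in> oprs X"
      using 0 Es by auto
    then show ?case
      using norm_triangle_diff[of M "E \<odot> M"] E_contr[of M] by simp
  next
    case (Suc m)
    define W where "W = M - E \<odot> M"
    have W: "W \<in> oprs X" "op_norm X W \<le> 2 * op_norm X M"
      using Suc.prems Es norm_triangle_diff[of M "E \<odot> M"] E_contr[of M] by (auto simp: W_def)
    have NM: "N \<odot> M \<in> oprs X"
      using Suc.prems N by auto
    have TW: "T \<odot> W = (N \<odot> M - E \<odot> (N \<odot> M)) + op_scale (of_real (1 / real n)) (C \<odot> W)"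
      unfolding T by (simp add: W_def mult_simps EEx NEx ENx op_scale_diff)
    have "op_pow X T (Suc m) \<odot> W = op_pow X T m \<odot> (N \<odot> M - E \<odot> (N \<odot> M))
        + op_scale (of_real (1 / real n)) (op_pow X T m \<odot> (C \<odot> W))"
      unfolding pow_Suc2[OF T_oprs] mult_assoc TW mult_add_right mult_scale_right ..
    then have "op_norm X (op_pow X T (Suc m) \<odot> W) \<le> op_norm X (op_pow X T m \<odot> (N \<odot> M - E \<odot> (N \<odot> M)))
        + op_norm X (op_pow X T m \<odot> (C \<odot> W)) / n"
      by (metis norm_triangle norm_scale_inverse)
    also have "\<dots> \<le> (2 * q ^ m + d * (\<Sum>i<m. q ^ i)) * (q * op_norm X M) + d * op_norm X M"
    proof (rule add_mono)
      have "op_norm X (op_pow X T m \<odot> (N \<odot> M - E \<odot> (N \<odot> M)))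
          \<le> (2 * q ^ m + d * (\<Sum>i<m. q ^ i)) * op_norm X (N \<odot> M)"
        using Suc.IH[OF _ NM] Suc.prems by simp
      also have "\<dots> \<le> (2 * q ^ m + d * (\<Sum>i<m. q ^ i)) * (q * op_norm X M)"
        using q Suc.prems d by (intro mult_left_mono add_nonneg_nonneg mult_nonneg_nonneg sum_nonneg) auto
      finally show "op_norm X (op_pow X T m \<odot> (N \<odot> M - E \<odot> (N \<odot> M)))
          \<le> (2 * q ^ m + d * (\<Sum>i<m. q ^ i)) * (q * op_norm X M)" .
      have "op_norm X (op_pow X T m \<odot> (C \<odot> W)) \<le> B * op_norm X (C \<odot> W)"
        using W C Suc.prems by (intro T_pow) auto
      also have "\<dots> \<le> B * (K * (2 * op_norm X M))"
        using C_mult[of W] W B K by (intro mult_left_mono order_trans[OF C_mult]) auto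
      finally show "op_norm X (op_pow X T m \<odot> (C \<odot> W)) / n \<le> d * op_norm X M"
        using n by (simp add: d_def divide_right_mono field_simps)
    qed
    also have "\<dots> = (2 * q ^ Suc m + d * (\<Sum>i<Suc m. q ^ i)) * op_norm X M"
      unfolding sum.lessThan_Suc_shift by (simp add: algebra_simps sum_distrib_left sum_distrib_right)
    finally show ?case by (simp add: W_def)
  qed
  have decay': "op_norm X (op_pow X T m \<odot> (M - E \<odot> M)) \<le> (2 * q ^ m + d / (1 - q)) * op_norm X M"
    if "m \<le> n" "M \<in> oprs X" for m M
  proof (rule order_trans[OF decay[OF that]])
    show "(2 * q ^ m + d * (\<Sum>i<m. q ^ i)) * op_norm X M \<le> (2 * q ^ m + d / (1 - q)) * op_norm X M"
      using mult_left_mono[OF geo[of m] d] by (intro mult_right_mono) auto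
  qed
  \<comment> \<open>The part of a step's error that does not decay with the number of remaining
    steps: the tail \<open>d / (1 - q)\<close> of \<open>decay'\<close> for a matrix of norm at most
    \<open>K\<close> times that of \<open>M\<close>, and the replacement of \<open>C\<close> by
    \<open>C0\<close>. It enters \<open>n\<close> times with a factor \<open>1 / n\<close>.\<close>
  define \<delta> where "\<delta> = d * K / (1 - q) + B * \<epsilon>"
  have \<delta>: "0 \<le> \<delta>"
    using d K q B \<epsilon> by (simp add: \<delta>_def)
  \<comment> \<open>Again the factor acting first is split off. On the range of \<open>E\<close> a
    step of \<open>T\<close> is a step of \<open>S\<close> plus \<open>1 / n\<close> times two
    errors: \<open>Y - E \<odot> Y\<close>, outside the range and damped by \<open>decay'\<close>,
    and \<open>Z\<close>, caused by replacing \<open>C0\<close> with \<open>C\<close>.\<close>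
  have compare: "op_norm X (op_pow X T m \<odot> (E \<odot> M) - op_pow X S m \<odot> (E \<odot> M))
      \<le> s ^ m * ((\<Sum>i<m. 2 * K * q ^ i + \<delta>) / n) * op_norm X M"
    if "m \<le> n" "M \<in> oprs X" for m M
    using that
  proof (induction m arbitrary: M)
    case 0
    then show ?case by simp
  next
    case (Suc m)
    define F where "F = (\<Sum>i<m. 2 * K * q ^ i + \<delta>) / n"
    have F: "0 \<le> F"
      unfolding F_def using q K \<delta> by (intro divide_nonneg_nonneg sum_nonneg) auto
    define Y where "Y = C0 \<odot> (E \<odot> M)"
    have Y: "Y \<in> oprs X" "op_norm X Y \<le> K * op_norm X M"
      using Suc.prems C Es C0_mult[of "E \<odot> M"] mult_left_mono[OF E_contr[of M] K] by (auto simp: Y_def)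
    define Z where "Z = (C - C0) \<odot> (E \<odot> M)"
    have Z: "Z \<in> oprs X" "op_norm X Z \<le> \<epsilon> * op_norm X M"
      using Suc.prems C Es CC0_mult[of "E \<odot> M"] mult_left_mono[OF E_contr[of M] \<epsilon>] by (auto simp: Z_def)
    have SE: "S \<odot> (E \<odot> M) = E \<odot> (S \<odot> M)"
      unfolding S by (simp add: mult_simps EEx)
    have "T \<odot> (E \<odot> M) = S \<odot> (E \<odot> M) + op_scale (of_real (1 / real n)) ((Y - E \<odot> Y) + Z)"
      unfolding T S Y_def Z_def
      by (simp add: mult_simps EEx NEx op_scale_add op_scale_diff)
    then have TE: "T \<odot> (E \<odot> M) = E \<odot> (S \<odot> M) + op_scale (of_real (1 / real n)) ((Y - E \<odot> Y) + Z)"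
      by (simp add: SE)
    have "op_pow X T (Suc m) \<odot> (E \<odot> M) - op_pow X S (Suc m) \<odot> (E \<odot> M)
        = (op_pow X T m \<odot> (E \<odot> (S \<odot> M)) - op_pow X S m \<odot> (E \<odot> (S \<odot> M)))
          + op_scale (of_real (1 / real n)) (op_pow X T m \<odot> (Y - E \<odot> Y) + op_pow X T m \<odot> Z)"
      unfolding pow_Suc2[OF T_oprs] pow_Suc2[OF S_oprs] mult_assoc TE SE
      by (simp add: mult_add_right mult_scale_right op_scale_add)
    then have "op_norm X (op_pow X T (Suc m) \<odot> (E \<odot> M) - op_pow X S (Suc m) \<odot> (E \<odot> M))
        \<le> op_norm X (op_pow X T m \<odot> (E \<odot> (S \<odot> M)) - op_pow X S m \<odot> (E \<odot> (S \<odot> M)))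
          + op_norm X (op_scale (of_real (1 / real n)) (op_pow X T m \<odot> (Y - E \<odot> Y) + op_pow X T m \<odot> Z))"
      by (simp only: norm_triangle)
    also have "\<dots> \<le> op_norm X (op_pow X T m \<odot> (E \<odot> (S \<odot> M)) - op_pow X S m \<odot> (E \<odot> (S \<odot> M)))
          + (op_norm X (op_pow X T m \<odot> (Y - E \<odot> Y)) + op_norm X (op_pow X T m \<odot> Z)) / n"
      unfolding norm_scale using norm_triangle[of "op_pow X T m \<odot> (Y - E \<odot> Y)" "op_pow X T m \<odot> Z"] n
      by (simp add: divide_right_mono norm_divide)
    also have "\<dots> \<le> s ^ m * F * (s * op_norm X M)
          + ((2 * q ^ m + d / (1 - q)) * (K * op_norm X M) + B * (\<epsilon> * op_norm X M)) / n"
    proof (intro add_mono divide_right_mono)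
      have SM: "S \<odot> M \<in> oprs X"
        using S_oprs Suc.prems by auto
      have "op_norm X (op_pow X T m \<odot> (E \<odot> (S \<odot> M)) - op_pow X S m \<odot> (E \<odot> (S \<odot> M)))
          \<le> s ^ m * F * op_norm X (S \<odot> M)"
        unfolding F_def using Suc.IH[OF _ SM] Suc.prems by simp
      also have "\<dots> \<le> s ^ m * F * (s * op_norm X M)"
        using S_contr Suc.prems s F by (intro mult_left_mono) auto
      finally show "op_norm X (op_pow X T m \<odot> (E \<odot> (S \<odot> M)) - op_pow X S m \<odot> (E \<odot> (S \<odot> M)))
          \<le> s ^ m * F * (s * op_norm X M)" .
      have "op_norm X (op_pow X T m \<odot> (Y - E \<odot> Y)) \<le> (2 * q ^ m + d / (1 - q)) * op_norm X Y"
        using Suc.prems Y by (intro decay') auto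
      also have "\<dots> \<le> (2 * q ^ m + d / (1 - q)) * (K * op_norm X M)"
        using Y q d by (intro mult_left_mono) auto
      finally show "op_norm X (op_pow X T m \<odot> (Y - E \<odot> Y)) \<le> (2 * q ^ m + d / (1 - q)) * (K * op_norm X M)" .
      have "op_norm X (op_pow X T m \<odot> Z) \<le> B * op_norm X Z"
        using Suc.prems Z by (intro T_pow) auto
      also have "\<dots> \<le> B * (\<epsilon> * op_norm X M)"
        using Z B by (intro mult_left_mono) auto
      finally show "op_norm X (op_pow X T m \<odot> Z) \<le> B * (\<epsilon> * op_norm X M)" .
    qed simp
    also have "\<dots> = s ^ Suc m * F * op_norm X M + 1 * ((2 * K * q ^ m + \<delta>) / n * op_norm X M)"
      using n q by (simp add: \<delta>_def field_simps)
    also have "\<dots> \<le> s ^ Suc m * F * op_norm X M + s ^ Suc m * ((2 * K * q ^ m + \<delta>) / n * op_norm X M)"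
      using s q K \<delta> by (intro add_left_mono mult_right_mono one_le_power) auto
    also have "\<dots> = s ^ Suc m * ((\<Sum>i<Suc m. 2 * K * q ^ i + \<delta>) / n) * op_norm X M"
      by (simp add: F_def algebra_simps add_divide_distrib)
    finally show ?case .
  qed
  have sum_le: "(\<Sum>i<n. 2 * K * q ^ i + \<delta>) / n \<le> 2 * K / n / (1 - q) + \<delta>"
  proof -
    have "(\<Sum>i<n. 2 * K * q ^ i + \<delta>) = 2 * K * (\<Sum>i<n. q ^ i) + n * \<delta>"
      by (simp add: sum.distrib sum_distrib_left)
    also have "\<dots> \<le> 2 * K * (1 / (1 - q)) + n * \<delta>"
      using geo[of n] K by (intro add_right_mono mult_left_mono) auto
    finally have "(\<Sum>i<n. 2 * K * q ^ i + \<delta>) / n \<le> (2 * K * (1 / (1 - q)) + n * \<delta>) / n"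
      by (rule divide_right_mono) simp
    also have "\<dots> = 2 * K / n / (1 - q) + \<delta>"
      using n by (simp add: add_divide_distrib mult.commute)
    finally show ?thesis .
  qed
  \<comment> \<open>Here \<open>0 < n\<close> matters: the zeroth power is \<open>one\<close>, which
    need not absorb \<open>E\<close>.\<close>
  have S_n: "op_pow X S n \<odot> E = op_pow X S n"
  proof -
    obtain k where k: "n = Suc k"
      using n by (auto simp: gr0_conv_Suc)
    have "S \<odot> E = S"
      unfolding S by (simp add: mult_simps Es)
    then show ?thesis
      unfolding k pow_Suc2[OF S_oprs] mult_assoc by simp
  qed
  \<comment> \<open>\<open>one\<close> is split along \<open>E\<close>; on the complement only
    \<open>T\<close> contributes, because \<open>S\<close> vanishes there.\<close>
  have "op_pow X T n - op_pow X S n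
      = op_pow X T n \<odot> (one - E \<odot> one) + (op_pow X T n \<odot> (E \<odot> one) - op_pow X S n \<odot> (E \<odot> one))"
    using Es T_oprs by (simp add: mult_diff_right S_n oprs_pow)
  then have "op_norm X (op_pow X T n - op_pow X S n)
      \<le> op_norm X (op_pow X T n \<odot> (one - E \<odot> one))
        + op_norm X (op_pow X T n \<odot> (E \<odot> one) - op_pow X S n \<odot> (E \<odot> one))"
    by (simp only: norm_triangle)
  also have "\<dots> \<le> (2 * q ^ n + d / (1 - q)) * op_norm X one
      + s ^ n * ((\<Sum>i<n. 2 * K * q ^ i + \<delta>) / n) * op_norm X one"
    by (intro add_mono decay' compare) auto
  also have "\<dots> \<le> (2 * q ^ n + d / (1 - q)) * op_norm X one + B * (2 * K / n / (1 - q) + \<delta>) * op_norm X one"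
    using sum_le sB[of n] s B q K \<delta>
    by (intro add_left_mono mult_right_mono mult_mono divide_nonneg_nonneg sum_nonneg) auto
  also have "\<dots> = (2 * q ^ n + 2 * B * K / n / (1 - q)
        + B * (2 * K / n / (1 - q) + (2 * B * K\<^sup>2 / n / (1 - q) + B * \<epsilon>))) * op_norm X one"
    by (simp add: d_def \<delta>_def power2_eq_square algebra_simps)
  finally show ?thesis .
qed

section \<open>Limits of powers and their positivity\<close>

lemma norm_tendsto_entry:
  assumes lim: "(\<lambda>n. op_norm X (A n - L)) \<longlonglongrightarrow> 0" and oprs: "\<And>n. A n \<in> oprs X" "L \<in> oprs X"
  shows "(\<lambda>n. A n x y) \<longlonglongrightarrow> L x y"
proof (cases "x \<in> X \<and> y \<in> X")
  case True
  then have "norm (A n x y - L x y) \<le> op_norm X (A n - L)" for n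
    using entry_le_norm[of x y "A n - L"] by (simp add: minus_apply)
  then have "\<forall>\<^sub>F n in sequentially. norm (A n x y - L x y) \<le> op_norm X (A n - L)"
    by simp
  then have "(\<lambda>n. A n x y - L x y) \<longlonglongrightarrow> 0"
    using lim by (rule Lim_null_comparison)
  then show ?thesis
    by (rule LIM_zero_cancel)
next
  case False
  then have "A n x y = 0" "L x y = 0" for n
    using oprs(1)[of n] oprs(2) unfolding oprs_def by blast+
  then show ?thesis by simp
qed

lemma psd_limit:
  assumes A: "\<And>n. op_psd X (A n)" and lim: "\<And>x y. (\<lambda>n. A n x y) \<longlonglongrightarrow> L x y"
  shows "op_psd X L"
  unfolding op_psd_def op_hermitian_def
proof (intro conjI allI)
  have "A n x y = 0" if "x \<notin> X \<or> y \<notin> X" for n x y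
    using A[of n] that unfolding op_psd_def op_hermitian_def oprs_def by blast
  then have "L x y = 0" if "x \<notin> X \<or> y \<notin> X" for x y
    using lim[of x y] that by (simp add: LIMSEQ_const_iff)
  then show "L \<in> oprs X"
    unfolding oprs_def by blast
  show "L y x = cnj (L x y)" for x y
  proof (rule LIMSEQ_unique)
    have "A n y x = cnj (A n x y)" for n
      using A[of n] unfolding op_psd_def op_hermitian_def by blast
    moreover have "(\<lambda>n. cnj (A n x y)) \<longlonglongrightarrow> cnj (L x y)"
      by (intro tendsto_cnj lim)
    ultimately show "(\<lambda>n. A n y x) \<longlonglongrightarrow> cnj (L x y)" by simp
  qed (rule lim)
  fix v
  have "(\<lambda>n. Re (quad_form X (A n) v)) \<longlonglongrightarrow> Re (quad_form X L v)"
    unfolding quad_form_def by (intro tendsto_intros lim)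
  moreover have "\<forall>n\<ge>0. 0 \<le> Re (quad_form X (A n) v)"
    using A unfolding op_psd_def by blast
  ultimately show "0 \<le> Re (quad_form X L v)"
    by (blast intro: LIMSEQ_le_const)
qed

lemma pow_adj: "A \<in> oprs X \<Longrightarrow> op_adj A = A \<Longrightarrow> op_adj (op_pow X A n) = op_pow X A n"
proof (induction n)
  case (Suc n)
  have "op_adj (op_pow X A (Suc n)) = op_pow X A n \<odot> A"
    using Suc by (simp add: adj_mult)
  also have "\<dots> = op_pow X A (Suc n)"
    using Suc.prems by (simp only: pow_Suc2)
  finally show ?case .
qed simp

lemma even_pow_psd: "op_hermitian X A \<Longrightarrow> op_psd X (op_pow X A (2 * n))"
  unfolding op_hermitian_iff mult_2
  by (metis pow_add pow_adj oprs_pow psd_gram)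

text \<open>\<open>S n\<close> is the compression by \<open>E\<close> of \<open>U n\<close>, which
  is \<open>one + D / n\<close> and commutes with \<open>E\<close>. So its \<open>n\<close>-th power
  is \<open>E\<close> times that of \<open>U n\<close>, and the latter tends to the exponential of
  \<open>D\<close>.\<close>

lemma compressed_power_limit:
  assumes E: "projection X E" and D: "op_hermitian X D" and ED: "E \<odot> D = D" "D \<odot> E = D"
  defines "S \<equiv> \<lambda>n. E + op_scale (of_real (1 / real n)) D"
  obtains L where "op_psd X L" "(\<lambda>n. op_norm X (op_pow X (S n) n - L)) \<longlonglongrightarrow> 0"
proof -
  note Es = projection_oprs[OF E] projection_adj[OF E] projection_mult[OF E]
  obtain \<Delta> R where R: "resolution X \<Delta> R" and D_eq: "D = fcalc \<Delta> R (\<lambda>l. l)"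
    by (rule spectral_theorem[OF D])
  interpret resolution X \<Delta> R by fact
  define U where "U n = fcalc \<Delta> R (\<lambda>l. 1 + l / real n)" for n :: nat
  have U: "U n = one + op_scale (of_real (1 / real n)) D" for n
    unfolding D_eq U_def fcalc_one[symmetric] fcalc_scale fcalc_add by simp
  have EU: "E \<odot> U n = S n" and UE: "U n \<odot> E = S n" for n
    unfolding S_def U using Es ED by (simp_all add: mult_simps)
  have pow_S: "op_pow X (S n) (Suc m) = E \<odot> op_pow X (U n) (Suc m)" for m n
  proof (induction m)
    case 0
    have "S n \<in> oprs X" "U n \<in> oprs X"
      unfolding EU[symmetric] using Es by (auto simp: U_def)
    then show ?case
      by (simp add: EU)
  next
    case (Suc m)
    have "op_pow X (S n) (Suc (Suc m)) = S n \<odot> (E \<odot> op_pow X (U n) (Suc m))"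
      using Suc by (simp only: op_pow.simps(2)[of _ _ "Suc m"])
    also have "\<dots> = (E \<odot> (U n \<odot> E)) \<odot> op_pow X (U n) (Suc m)"
      unfolding EU[symmetric] by (simp only: mult_assoc)
    also have "E \<odot> (U n \<odot> E) = E \<odot> U n"
      unfolding UE EU[symmetric] by (simp add: Es flip: mult_assoc)
    finally show ?case
      by (simp only: mult_assoc op_pow.simps(2)[of _ _ "Suc m"])
  qed
  define Z where "Z = fcalc \<Delta> R exp"
  define L where "L = E \<odot> Z"
  have "(\<lambda>n. op_norm X (fcalc \<Delta> R (\<lambda>l. (1 + l / real n) ^ n) - Z)) \<longlonglongrightarrow> 0"
    unfolding Z_def by (intro norm_fcalc_tendsto tendsto_exp_limit_sequentially)
  moreover have "\<forall>\<^sub>F n in sequentially. norm (op_norm X (op_pow X (S n) n - L))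
      \<le> op_norm X (fcalc \<Delta> R (\<lambda>l. (1 + l / real n) ^ n) - Z)"
    using eventually_gt_at_top[of 0]
  proof eventually_elim
    case (elim n)
    then obtain m where m: "n = Suc m"
      by (auto simp: gr0_conv_Suc)
    have "op_pow X (S n) n - L = E \<odot> (op_pow X (U n) n - Z)"
      unfolding m pow_S L_def mult_diff_right ..
    then show ?case
      using projection_contracts[OF E] unfolding U_def fcalc_pow by simp
  qed
  ultimately have lim: "(\<lambda>n. op_norm X (op_pow X (S n) n - L)) \<longlonglongrightarrow> 0"
    by (rule Lim_null_comparison[rotated])
  have S_herm: "op_hermitian X (S n)" for n
    unfolding S_def using E D by (intro hermitian_add hermitian_scale) (auto simp: projection_def)
  \<comment> \<open>Even powers of a Hermitian operator are Gram matrices whatever the signs of its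
    eigenvalues, so positivity of the limit is read off along even indices.\<close>
  have "op_psd X L"
  proof (rule psd_limit)
    show "op_psd X (op_pow X (S (2 * n)) (2 * n))" for n
      by (rule even_pow_psd[OF S_herm])
    fix x y
    have "(\<lambda>n. op_pow X (S n) n x y) \<longlonglongrightarrow> L x y"
      using lim S_herm Es by (intro norm_tendsto_entry oprs_pow) (auto simp: op_hermitian_iff L_def Z_def)
    from LIMSEQ_subseq_LIMSEQ[OF this, of "\<lambda>n. 2 * n"]
    show "(\<lambda>n. op_pow X (S (2 * n)) (2 * n) x y) \<longlonglongrightarrow> L x y"
      by (simp add: o_def strict_mono_def)
  qed
  with lim show thesis
    using that by blast
qed

text \<open>Multiplying the expansions of the two roots gives \<open>P \<odot> Q\<close> plus
  \<open>1 / n\<close> times \<open>C n\<close>, and the Friedrichs angle splits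
  \<open>P \<odot> Q\<close> into \<open>E + N\<close>. So the \<open>n\<close>-th power can be
  compared with that of \<open>E + D / n\<close>, where \<open>D\<close> compresses the limit
  \<open>C0\<close> of \<open>C n\<close>.\<close>

lemma trotter_limit:
  assumes A: "op_psd X A" and B: "op_psd X B"
  obtains L where "op_psd X L"
    "\<And>x y. (\<lambda>n. op_pow X (op_root X n A \<odot> op_root X n B) n x y) \<longlonglongrightarrow> L x y"
proof -
  obtain P h hn where P: "projection X P" and h: "op_hermitian X h" and hn: "\<And>n. hn n \<in> oprs X"
    and rootA: "\<And>n. 0 < n \<Longrightarrow> op_root X n A = P + op_scale (of_real (1 / real n)) (hn n)"
    and hn_lim: "(\<lambda>n. op_norm X (hn n - h)) \<longlonglongrightarrow> 0"
    using root_expansion[OF A] by metis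
  obtain Q k kn where Q: "projection X Q" and k: "op_hermitian X k" and kn: "\<And>n. kn n \<in> oprs X"
    and rootB: "\<And>n. 0 < n \<Longrightarrow> op_root X n B = Q + op_scale (of_real (1 / real n)) (kn n)"
    and kn_lim: "(\<lambda>n. op_norm X (kn n - k)) \<longlonglongrightarrow> 0"
    using root_expansion[OF B] by metis
  obtain E q where E: "projection X E" and PE: "P \<odot> E = E" and QE: "Q \<odot> E = E"
    and q: "0 \<le> q" "q < 1" "\<And>M. M \<in> oprs X \<Longrightarrow> op_norm X ((P \<odot> Q - E) \<odot> M) \<le> q * op_norm X M"
    using friedrichs_angle[OF P Q] by metis
  note Ps = projection_oprs[OF P] projection_adj[OF P] projection_mult[OF P]
  note Qs = projection_oprs[OF Q] projection_adj[OF Q] projection_mult[OF Q]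
  note Es = projection_oprs[OF E] projection_adj[OF E] projection_mult[OF E]
  have hs: "h \<in> oprs X" "op_adj h = h" and ks: "k \<in> oprs X" "op_adj k = k"
    using h k by (auto simp: op_hermitian_iff)
  have EP: "E \<odot> P = E" and EQ: "E \<odot> Q = E"
    using arg_cong[OF PE, of op_adj] arg_cong[OF QE, of op_adj] by (simp_all add: adj_mult Ps Qs Es)
  have EPx: "E \<odot> (P \<odot> M) = E \<odot> M" for M
    by (simp add: EP flip: mult_assoc)
  define T where "T n = op_root X n A \<odot> op_root X n B" for n
  define C where "C n = hn n \<odot> Q + P \<odot> kn n + op_scale (of_real (1 / real n)) (hn n \<odot> kn n)" for n
  define C0 where "C0 = h \<odot> Q + P \<odot> k"
  define N where "N = P \<odot> Q - E"
  define D where "D = E \<odot> C0 \<odot> E"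
  have oprs: "N \<in> oprs X" "C n \<in> oprs X" "C0 \<in> oprs X" for n
    unfolding N_def C_def C0_def using Ps Qs Es hn kn hs ks
    by (auto intro!: oprs_add oprs_diff oprs_mult oprs_scale)
  have T_eq: "T n = E + N + op_scale (of_real (1 / real n)) (C n)" if "0 < n" for n
    unfolding T_def rootA[OF that] rootB[OF that] C_def N_def
    by (simp add: mult_simps op_scale_add algebra_simps)
  have EN: "E \<odot> N = 0" "N \<odot> E = 0"
    unfolding N_def by (simp_all add: mult_simps EPx EQ PE QE Es)
  \<comment> \<open>\<open>C0\<close> need not be Hermitian; its compression is, since
    \<open>E\<close> absorbs \<open>P\<close> and \<open>Q\<close>.\<close>
  have "D = E \<odot> h \<odot> E + E \<odot> k \<odot> E"
    unfolding D_def C0_def by (simp add: mult_simps EPx QE)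
  then have D: "op_hermitian X D"
    using hs ks Es by (auto simp: op_hermitian_iff op_adj_add adj_mult mult_assoc)
  have ED: "E \<odot> D = D" "D \<odot> E = D"
    unfolding D_def by (simp_all add: mult_assoc Es) (simp add: Es flip: mult_assoc)
  obtain L where L: "op_psd X L"
    and S_lim: "(\<lambda>n. op_norm X (op_pow X (E + op_scale (of_real (1 / real n)) D) n - L)) \<longlonglongrightarrow> 0"
    by (rule compressed_power_limit[OF E D ED])
  define \<epsilon> where "\<epsilon> n = op_norm X (C n - C0)" for n
  have \<epsilon>: "\<epsilon> \<longlonglongrightarrow> 0"
  proof (rule Lim_null_comparison)
    define a where "a n = op_norm X (hn n - h)" for n
    define b where "b n = op_norm X (kn n - k)" for n
    have "\<epsilon> n \<le> a n * op_norm X Q + op_norm X P * b n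
        + 1 / real n * ((op_norm X h + a n) * (op_norm X k + b n))" for n
    proof -
      have "C n - C0 = (hn n - h) \<odot> Q + P \<odot> (kn n - k) + op_scale (of_real (1 / real n)) (hn n \<odot> kn n)"
        by (simp add: C_def C0_def mult_simps algebra_simps)
      then have "\<epsilon> n \<le> op_norm X ((hn n - h) \<odot> Q) + op_norm X (P \<odot> (kn n - k))
          + op_norm X (op_scale (of_real (1 / real n)) (hn n \<odot> kn n))"
        unfolding \<epsilon>_def using norm_triangle by (smt (verit))
      moreover have "op_norm X (hn n) \<le> op_norm X h + a n" "op_norm X (kn n) \<le> op_norm X k + b n"
        using norm_triangle[of h "hn n - h"] norm_triangle[of k "kn n - k"] by (simp_all add: a_def b_def)
      then have "op_norm X (hn n \<odot> kn n) \<le> (op_norm X h + a n) * (op_norm X k + b n)"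
        by (intro order_trans[OF norm_mult_le] mult_mono) (auto simp: a_def)
      then have "op_norm X (op_scale (of_real (1 / real n)) (hn n \<odot> kn n))
          \<le> 1 / real n * ((op_norm X h + a n) * (op_norm X k + b n))"
        unfolding norm_scale by (simp add: norm_divide divide_right_mono)
      ultimately show ?thesis
        using norm_mult_le[of "hn n - h" Q] norm_mult_le[of P "kn n - k"]
        unfolding a_def b_def by linarith
    qed
    then show "\<forall>\<^sub>F n in sequentially. norm (\<epsilon> n) \<le> a n * op_norm X Q + op_norm X P * b n
        + 1 / real n * ((op_norm X h + a n) * (op_norm X k + b n))"
      by (simp add: \<epsilon>_def)
    have "(\<lambda>n. a n * op_norm X Q + op_norm X P * b n
        + 1 / real n * ((op_norm X h + a n) * (op_norm X k + b n)))
      \<longlonglongrightarrow> 0 * op_norm X Q + op_norm X P * 0 + 0 * ((op_norm X h + 0) * (op_norm X k + 0))"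
      using hn_lim kn_lim lim_1_over_n[where 'a = real] unfolding a_def b_def by (intro tendsto_intros)
    then show "(\<lambda>n. a n * op_norm X Q + op_norm X P * b n
        + 1 / real n * ((op_norm X h + a n) * (op_norm X k + b n))) \<longlonglongrightarrow> 0"
      by simp
  qed
  obtain K1 where K1: "\<And>n. \<epsilon> n \<le> K1"
    using Bseq_def[of \<epsilon>] convergent_imp_Bseq[OF convergentI[OF \<epsilon>]] by (auto simp: abs_le_iff)
  define K where "K = op_norm X C0 + K1"
  have K: "op_norm X (C n) \<le> K" "op_norm X C0 \<le> K" for n
    using K1[of n] norm_triangle[of C0 "C n - C0"] norm_nonneg[of "C n - C0"]
    unfolding K_def \<epsilon>_def by (simp, linarith)
  define B' where "B' = exp K"
  define bound where "bound n = (2 * q ^ n + 2 * B' * K / real n / (1 - q)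
        + B' * (2 * K / real n / (1 - q) + (2 * B' * K\<^sup>2 / real n / (1 - q) + B' * \<epsilon> n))) * op_norm X one"
    for n
  have T_S: "op_norm X (op_pow X (T n) n - op_pow X (E + op_scale (of_real (1 / real n)) D) n) \<le> bound n"
    if "0 < n" for n
    unfolding bound_def B'_def
  proof (rule compressed_power_bound[OF E oprs(1) EN _ q(3)[folded N_def] q(1,2) oprs(2,3) K _ that T_eq[OF that]])
    fix M assume "M \<in> oprs X"
    have "(E + N) \<odot> M = P \<odot> (Q \<odot> M)"
      by (simp add: N_def mult_assoc)
    then show "op_norm X ((E + N) \<odot> M) \<le> op_norm X M"
      using projection_contracts[OF P] projection_contracts[OF Q] by (metis order_trans)
  qed (simp_all add: \<epsilon>_def D_def)
  have "bound \<longlonglongrightarrow> (2 * 0 + 0 / (1 - q) + B' * (0 / (1 - q) + (0 / (1 - q) + B' * 0))) * op_norm X one"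
    unfolding bound_def using q \<epsilon>
    by (intro tendsto_intros lim_const_over_n LIMSEQ_realpow_zero) auto
  then have bound: "bound \<longlonglongrightarrow> 0" by simp
  have "(\<lambda>n. op_norm X (op_pow X (T n) n - L)) \<longlonglongrightarrow> 0"
  proof (rule Lim_null_comparison)
    show "(\<lambda>n. bound n + op_norm X (op_pow X (E + op_scale (of_real (1 / real n)) D) n - L)) \<longlonglongrightarrow> 0"
      using tendsto_add[OF bound S_lim] by simp
    show "\<forall>\<^sub>F n in sequentially. norm (op_norm X (op_pow X (T n) n - L))
        \<le> bound n + op_norm X (op_pow X (E + op_scale (of_real (1 / real n)) D) n - L)"
      using eventually_gt_at_top[of 0]
    proof eventually_elim
      case (elim n)
      show ?case
        using T_S[OF elim]
          norm_triangle[of "op_pow X (T n) n - op_pow X (E + op_scale (of_real (1 / real n)) D) n"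
            "op_pow X (E + op_scale (of_real (1 / real n)) D) n - L"]
        by simp
    qed
  qed
  moreover have "op_pow X (T n) n \<in> oprs X" for n
    using oprs Es by (cases "n = 0") (auto simp: T_eq)
  moreover have "L \<in> oprs X"
    using L by (simp add: op_psd_def op_hermitian_def)
  ultimately have "(\<lambda>n. op_pow X (T n) n x y) \<longlonglongrightarrow> L x y" for x y
    by (rule norm_tendsto_entry)
  with L show thesis
    using that unfolding T_def by blast
qed

text \<open>The cases are those of \<open>star\<close>. The limit case keeps closed boxes positive
  semidefinite when a local operator is singular.\<close>

lemma star_psd:
  assumes A: "op_psd X A" and B: "op_psd X B"
  shows "op_psd X (star X A B)"
proof (cases "op_pd X A \<and> op_pd X B")
  case True
  then show ?thesis
    by (auto simp: star_def op_add_eq_plus intro!: pd_imp_psd exp_pd hermitian_add pd_log)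
next
  case False
  obtain L where L: "op_psd X L"
    "\<And>x y. (\<lambda>n. op_pow X (op_root X n A \<odot> op_root X n B) n x y) \<longlonglongrightarrow> L x y"
    using trotter_limit[OF A B] by blast
  have "star X A B = L"
    using False by (auto simp: star_def fun_eq_iff limI[OF L(2)])
  then show ?thesis
    using L(1) by simp
qed

end

section \<open>Perturbations of the identity\<close>

text \<open>Entrywise, so that no index set is involved; for finite \<open>X\<close> it is
  equivalent to a norm bound for operators in \<open>oprs X\<close>.\<close>

definition op_bigo :: "nat \<Rightarrow> (real \<Rightarrow> 'x opr) \<Rightarrow> bool" where
  "op_bigo k M \<longleftrightarrow> (\<forall>x y. (\<lambda>t. M t x y) \<in> O[at 0](\<lambda>t. of_real t ^ k))"

text \<open>The class of families that is stable under closing boxes. Hermiticity is demanded only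
  for small \<open>t\<close>, since the logarithms behind the star products are controlled only
  there; \<open>0 < c\<close> makes the members positive definite near 0.\<close>

definition near_id :: "'x set \<Rightarrow> real \<Rightarrow> (real \<Rightarrow> 'x opr) \<Rightarrow> bool" where
  "near_id X c A \<longleftrightarrow> 0 < c \<and> (\<forall>\<^sub>F t in at 0. op_hermitian X (A t)) \<and>
     op_bigo 1 (\<lambda>t. A t - op_scale (of_real c) (op_id X))"

lemma bigo_transform: "f \<in> O[F](h) \<Longrightarrow> \<forall>\<^sub>F x in F. f x = g x \<Longrightarrow> g \<in> O[F](h)"
  using landau_o.big.in_cong[of f g F h] by simp

lemma op_bigo_add: "op_bigo k M \<Longrightarrow> op_bigo k N \<Longrightarrow> op_bigo k (\<lambda>t. M t + N t)"
  by (simp add: op_bigo_def plus_fun_apply sum_in_bigo)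

lemma op_bigo_diff: "op_bigo k M \<Longrightarrow> op_bigo k N \<Longrightarrow> op_bigo k (\<lambda>t. M t - N t)"
  by (simp add: op_bigo_def minus_apply sum_in_bigo)

lemma op_bigo_scale: "op_bigo k M \<Longrightarrow> op_bigo k (\<lambda>t. op_scale c (M t))"
  by (simp add: op_bigo_def op_scale_def)

lemma op_bigo_zero: "op_bigo k (\<lambda>t. 0)"
  by (simp add: op_bigo_def zero_fun_apply)

lemma op_bigo_sum: "(\<And>i. i \<in> I \<Longrightarrow> op_bigo k (M i)) \<Longrightarrow> op_bigo k (\<lambda>t. \<Sum>i\<in>I. M i t)"
  by (simp add: op_bigo_def sum_opr_apply big_sum_in_bigo)

lemma op_bigo_const: "op_bigo 0 (\<lambda>t. A)"
  by (simp add: op_bigo_def)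

lemma op_bigo_mult: "op_bigo j M \<Longrightarrow> op_bigo k N \<Longrightarrow> op_bigo (j + k) (\<lambda>t. op_mult X (M t) (N t))"
  by (auto simp: op_bigo_def op_mult_def power_add intro!: big_sum_in_bigo landau_o.big.mult)

lemma op_bigo_mono:
  assumes "op_bigo j M" "k \<le> j"
  shows "op_bigo k M"
proof -
  have "(\<lambda>t::real. complex_of_real t ^ j) \<in> O[at 0](\<lambda>t. of_real t ^ k)"
  proof (rule bigoI)
    have "\<forall>\<^sub>F t::real in at 0. \<bar>t\<bar> < 1"
      using eventually_at_ball[of 1 "0::real" UNIV] by (simp add: dist_real_def)
    then show "\<forall>\<^sub>F t::real in at 0. norm (complex_of_real t ^ j) \<le> 1 * norm (complex_of_real t ^ k)"
      by eventually_elim (use assms(2) in \<open>simp add: norm_power power_decreasing\<close>)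
  qed
  then show ?thesis
    using assms(1) landau_o.big_trans unfolding op_bigo_def by blast
qed

lemma op_bigo_cong:
  assumes "\<forall>\<^sub>F t in at 0. M t = N t"
  shows "op_bigo k M \<longleftrightarrow> op_bigo k N"
proof -
  have "(\<lambda>t. M t x y) \<in> O[at 0](\<lambda>t. of_real t ^ k) \<longleftrightarrow> (\<lambda>t. N t x y) \<in> O[at 0](\<lambda>t. of_real t ^ k)" for x y
    by (rule landau_o.big.in_cong) (use assms in eventually_elim, simp)
  then show ?thesis
    by (simp add: op_bigo_def)
qed

lemma op_bigo_trace: "op_bigo k M \<Longrightarrow> (\<lambda>t. op_trace X (M t)) \<in> O[at 0](\<lambda>t. of_real t ^ k)"
  by (simp add: op_bigo_def op_trace_def big_sum_in_bigo)

context index_set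
begin

lemma op_bigo_normI:
  assumes "\<forall>\<^sub>F t in at 0. M t \<in> oprs X" "\<forall>\<^sub>F t in at 0. op_norm X (M t) \<le> C * \<bar>t\<bar> ^ k"
  shows "op_bigo k M"
  unfolding op_bigo_def
proof (intro allI bigoI)
  fix x y
  show "\<forall>\<^sub>F t in at 0. norm (M t x y) \<le> C * norm (complex_of_real t ^ k)"
    using assms
  proof eventually_elim
    case (elim t)
    have "norm (M t x y) \<le> op_norm X (M t)"
    proof (cases "x \<in> X \<and> y \<in> X")
      case False
      then have "M t x y = 0"
        using elim(1) unfolding oprs_def by blast
      then show ?thesis by simp
    qed (simp add: entry_le_norm)
    with elim(2) show ?case
      by (simp add: norm_power)
  qed
qed

lemma op_bigo_normE:
  assumes "op_bigo k M"
  obtains C where "0 < C" "\<forall>\<^sub>F t in at 0. op_norm X (M t) \<le> C * \<bar>t\<bar> ^ k"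
proof -
  have "(\<lambda>t. \<Sum>x\<in>X. \<Sum>y\<in>X. of_real (cmod (M t x y))) \<in> O[at 0](\<lambda>t. complex_of_real t ^ k)"
    using assms unfolding op_bigo_def
    by (intro big_sum_in_bigo) (auto simp: bigo_def)
  then obtain C where "0 < C" and C: "\<forall>\<^sub>F t in at 0. norm (\<Sum>x\<in>X. \<Sum>y\<in>X. complex_of_real (cmod (M t x y)))
      \<le> C * norm (complex_of_real t ^ k)"
    by (erule landau_o.bigE)
  from C have "\<forall>\<^sub>F t in at 0. op_norm X (M t) \<le> C * \<bar>t\<bar> ^ k"
  proof eventually_elim
    case (elim t)
    have "norm (\<Sum>x\<in>X. \<Sum>y\<in>X. complex_of_real (cmod (M t x y))) = (\<Sum>x\<in>X. \<Sum>y\<in>X. cmod (M t x y))"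
      unfolding of_real_sum[symmetric] norm_of_real by (simp add: sum_nonneg)
    with elim norm_le_sum[of "M t"] show ?case
      by (simp add: norm_power)
  qed
  with \<open>0 < C\<close> show thesis by (rule that)
qed

lemma op_bigo_1_small:
  assumes "op_bigo 1 M" "0 < \<epsilon>"
  shows "\<forall>\<^sub>F t in at 0. op_norm X (M t) \<le> \<epsilon>"
proof -
  obtain C where C: "0 < C" "\<forall>\<^sub>F t in at 0. op_norm X (M t) \<le> C * \<bar>t\<bar> ^ 1"
    by (rule op_bigo_normE[OF assms(1)])
  have "\<forall>\<^sub>F t::real in at 0. \<bar>t\<bar> < \<epsilon> / C"
    using eventually_at_ball[of "\<epsilon> / C" "0::real" UNIV] C assms by (simp add: dist_real_def)
  with C(2) show ?thesis
  proof eventually_elim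
    case (elim t)
    then have "C * \<bar>t\<bar> \<le> \<epsilon>"
      using C(1) by (simp add: field_simps)
    with elim show ?case by simp
  qed
qed

text \<open>For \<open>n = 0\<close> this would bound the norm of \<open>one\<close>, the square
  root of the dimension, by 1.\<close>

lemma norm_pow_le: "0 < n \<Longrightarrow> op_norm X (op_pow X A n) \<le> op_norm X A ^ n" if "A \<in> oprs X"
proof (induction n rule: nat_induct_non_zero)
  case (Suc n)
  have "op_norm X (op_pow X A (Suc n)) \<le> op_norm X A * op_norm X (op_pow X A n)"
    using norm_mult_le by simp
  also have "\<dots> \<le> op_norm X A * op_norm X A ^ n"
    using Suc by (intro mult_left_mono) auto
  finally show ?case by simp
qed (simp add: that)

end

section \<open>Taylor expansion of exponentials and size of logarithms\<close>

context resolution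
begin

lemma norm_fcalc_mono:
  assumes "\<And>l. l \<in> \<Lambda> \<Longrightarrow> \<bar>f l\<bar> \<le> \<bar>g l\<bar>"
  shows "op_norm X (fcalc \<Lambda> P f) \<le> op_norm X (fcalc \<Lambda> P g)"
proof (rule power2_le_imp_le)
  have "(op_norm X (fcalc \<Lambda> P f \<odot> one))\<^sup>2 \<le> (op_norm X (fcalc \<Lambda> P g \<odot> one))\<^sup>2"
    unfolding norm_fcalc_mult_square
    using assms by (intro sum_mono mult_right_mono) (auto simp: abs_le_square_iff[symmetric])
  then show "(op_norm X (fcalc \<Lambda> P f))\<^sup>2 \<le> (op_norm X (fcalc \<Lambda> P g))\<^sup>2"
    by simp
qed simp

lemma abs_spectrum_le_norm: "l \<in> \<Lambda> \<Longrightarrow> \<bar>f l\<bar> \<le> op_norm X (fcalc \<Lambda> P f)"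
proof -
  assume l: "l \<in> \<Lambda>"
  have "\<bar>f l\<bar> * op_norm X (P l) \<le> op_norm X (fcalc \<Lambda> P f) * op_norm X (P l)"
    using norm_mult_le[of "fcalc \<Lambda> P f" "P l"] l by (simp add: fcalc_mult_proj norm_scale)
  moreover have "op_norm X (P l) \<noteq> 0"
    using l by (simp add: norm_eq_0 proj_nonzero)
  then have "0 < op_norm X (P l)"
    using norm_nonneg[of "P l"] by linarith
  ultimately show ?thesis
    by (simp add: mult_le_cancel_right)
qed

end

text \<open>Lagrange remainder; \<open>3\<close> bounds \<open>exp t\<close> for
  \<open>\<bar>t\<bar> \<le> 1\<close>, and the factorial in the denominator is dropped.\<close>

lemma exp_taylor_bound:
  fixes x :: real
  assumes "\<bar>x\<bar> \<le> 1"
  shows "\<bar>exp x - (\<Sum>k<n. x ^ k / fact k)\<bar> \<le> 3 * \<bar>x\<bar> ^ n"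
proof -
  obtain t where t: "\<bar>t\<bar> \<le> \<bar>x\<bar>" and e: "exp x = (\<Sum>k<n. x ^ k / fact k) + exp t / fact n * x ^ n"
    using Maclaurin_exp_le[of x n] by blast
  have "exp t \<le> exp 1"
    using t assms by simp
  then have "exp t \<le> 3"
    using exp_le by linarith
  then have "exp t / fact n \<le> 3 / 1"
    by (intro frac_le) (auto simp: fact_ge_1)
  then have "exp t / fact n * \<bar>x\<bar> ^ n \<le> 3 * \<bar>x\<bar> ^ n"
    by (intro mult_right_mono) auto
  then show ?thesis
    by (simp add: e abs_mult power_abs)
qed

context index_set
begin

text \<open>The spectrum of \<open>L\<close> lies in \<open>[-1, 1]\<close>, so the scalar remainder
  estimate applies to each eigenvalue.\<close>

lemma exp_taylor_norm:
  assumes L: "op_hermitian X L" "op_norm X L \<le> 1" and n: "0 < n"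
  shows "op_norm X (op_exp X L - (\<Sum>k<n. op_scale (of_real (1 / fact k)) (op_pow X L k))) \<le> 3 * op_norm X L ^ n"
proof -
  obtain \<Lambda> P where P: "resolution X \<Lambda> P" and L_eq: "L = fcalc \<Lambda> P (\<lambda>l. l)"
    by (rule spectral_theorem[OF L(1)])
  interpret resolution X \<Lambda> P by fact
  have sum_fcalc: "(\<Sum>k<n. fcalc \<Lambda> P (f k)) = fcalc \<Lambda> P (\<lambda>l. \<Sum>k<n. f k l)" for f
  proof (induction n)
    case 0
    show ?case by (simp add: fcalc_const)
  qed (simp add: fcalc_add)
  have remainder: "op_exp X L - (\<Sum>k<n. op_scale (of_real (1 / fact k)) (op_pow X L k))
      = fcalc \<Lambda> P (\<lambda>l. exp l - (\<Sum>k<n. l ^ k / fact k))"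
    unfolding L_eq fcalc_pow fcalc_scale sum_fcalc op_exp_fcalc fcalc_diff by simp
  have "op_norm X (fcalc \<Lambda> P (\<lambda>l. exp l - (\<Sum>k<n. l ^ k / fact k)))
      \<le> op_norm X (fcalc \<Lambda> P (\<lambda>l. 3 * l ^ n))"
  proof (rule norm_fcalc_mono)
    fix l assume "l \<in> \<Lambda>"
    then have "\<bar>l\<bar> \<le> 1"
      using abs_spectrum_le_norm[of l "\<lambda>l. l"] L(2) by (simp add: L_eq)
    then show "\<bar>exp l - (\<Sum>k<n. l ^ k / fact k)\<bar> \<le> \<bar>3 * l ^ n\<bar>"
      using exp_taylor_bound[of l n] by (simp add: abs_mult power_abs)
  qed
  also have "\<dots> = 3 * op_norm X (op_pow X L n)"
    unfolding fcalc_scale[symmetric] by (simp add: L_eq fcalc_pow norm_scale)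
  also have "\<dots> \<le> 3 * op_norm X L ^ n"
    using norm_pow_le[OF _ n, of L] L(1) by (simp add: op_hermitian_iff)
  finally show ?thesis
    unfolding remainder .
qed

lemma exp_taylor_bigo:
  assumes "\<forall>\<^sub>F t in at 0. op_hermitian X (L t)" "op_bigo 1 L" "0 < n"
  shows "op_bigo n (\<lambda>t. op_exp X (L t) - (\<Sum>k<n. op_scale (of_real (1 / fact k)) (op_pow X (L t) k)))"
proof -
  obtain C where C: "0 < C" "\<forall>\<^sub>F t in at 0. op_norm X (L t) \<le> C * \<bar>t\<bar> ^ 1"
    by (rule op_bigo_normE[OF assms(2)])
  show ?thesis
  proof (rule op_bigo_normI)
    show "\<forall>\<^sub>F t in at 0. op_exp X (L t) - (\<Sum>k<n. op_scale (of_real (1 / fact k)) (op_pow X (L t) k)) \<in> oprs X"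
      using assms(1)
    proof eventually_elim
      case (elim t)
      then show ?case
        using exp_pd[OF elim]
        by (intro oprs_diff oprs_sum oprs_scale oprs_pow) (auto simp: op_pd_def op_hermitian_def)
    qed
    show "\<forall>\<^sub>F t in at 0. op_norm X (op_exp X (L t) - (\<Sum>k<n. op_scale (of_real (1 / fact k)) (op_pow X (L t) k)))
        \<le> (3 * C ^ n) * \<bar>t\<bar> ^ n"
      using assms(1) C(2) op_bigo_1_small[OF assms(2), of 1, simplified]
    proof eventually_elim
      case (elim t)
      have "3 * op_norm X (L t) ^ n \<le> 3 * (C * \<bar>t\<bar>) ^ n"
        using elim by (simp add: power_mono)
      then show ?case
        using exp_taylor_norm[OF elim(1) elim(3) assms(3)] by (simp add: power_mult_distrib)
    qed
  qed
qed

lemma near_id_exp: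
  assumes "\<forall>\<^sub>F t in at 0. op_hermitian X (L t)" "op_bigo 1 L" "0 < c"
  shows "near_id X c (\<lambda>t. op_scale (of_real c) (op_exp X (L t)))"
  unfolding near_id_def
proof (intro conjI)
  show "\<forall>\<^sub>F t in at 0. op_hermitian X (op_scale (of_real c) (op_exp X (L t)))"
    using assms(1) by eventually_elim (rule hermitian_scale, use exp_pd in \<open>simp add: op_pd_def\<close>)
  have "op_bigo 1 (\<lambda>t. op_scale (of_real c) (op_exp X (L t) - one))"
    using op_bigo_scale[OF exp_taylor_bigo[OF assms(1,2), of 1]] by simp
  then show "op_bigo 1 (\<lambda>t. op_scale (of_real c) (op_exp X (L t)) - op_scale (of_real c) one)"
    by (simp add: op_scale_diff)
qed fact

text \<open>Here \<open>A t\<close> is \<open>c\<close> times \<open>one + M t\<close>, and for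
  small \<open>t\<close> the spectrum of \<open>M t\<close> lies in \<open>[-1/2, 1/2]\<close>.
  There \<open>\<bar>ln (1 + x)\<bar> \<le> 2 * \<bar>x\<bar>\<close>, so the logarithm inherits the
  order of \<open>M\<close>. The summand \<open>ln c\<close> is kept apart because it need not be
  small.\<close>

lemma near_id_log:
  assumes A: "near_id X c A"
  obtains L where "op_bigo 1 L"
    "\<forall>\<^sub>F t in at 0. op_hermitian X (L t) \<and> op_pd X (A t) \<and>
       op_log X (A t) = op_scale (of_real (ln c)) one + L t \<and>
       A t = op_scale (of_real c) (op_exp X (L t))"
proof -
  have c: "0 < c" and herm: "\<forall>\<^sub>F t in at 0. op_hermitian X (A t)"
    and bigo: "op_bigo 1 (\<lambda>t. A t - op_scale (of_real c) one)"
    using A by (auto simp: near_id_def)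
  define M where "M t = op_scale (of_real (1 / c)) (A t - op_scale (of_real c) one)" for t
  define L where "L t = op_log X (A t) - op_scale (of_real (ln c)) one" for t
  have M_bigo: "op_bigo 1 M"
    unfolding M_def by (rule op_bigo_scale[OF bigo])
  have key: "op_hermitian X (L t) \<and> op_pd X (A t) \<and>
       op_log X (A t) = op_scale (of_real (ln c)) one + L t \<and>
       A t = op_scale (of_real c) (op_exp X (L t)) \<and> op_norm X (L t) \<le> 2 * op_norm X (M t)"
    if At: "op_hermitian X (A t)" and small: "op_norm X (M t) \<le> 1 / 2" for t
  proof -
    have "op_hermitian X (M t)"
      using At by (auto simp: M_def op_hermitian_iff op_adj_scale op_adj_diff)
    then obtain \<Lambda> P where P: "resolution X \<Lambda> P" and M_eq: "M t = fcalc \<Lambda> P (\<lambda>l. l)"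
      by (rule spectral_theorem)
    interpret resolution X \<Lambda> P by fact
    have l: "\<bar>l\<bar> \<le> 1 / 2" if "l \<in> \<Lambda>" for l
      using abs_spectrum_le_norm[of l "\<lambda>l. l"] that small by (simp add: M_eq)
    then have pos: "0 < 1 + l" if "l \<in> \<Lambda>" for l
      using that by fastforce
    have "A t = op_scale (of_real c) (one + M t)"
      using c by (simp add: M_def op_scale_add)
    also have "\<dots> = fcalc \<Lambda> P (\<lambda>l. c * (1 + l))"
      unfolding M_eq fcalc_one[symmetric] fcalc_add fcalc_scale ..
    finally have A_eq: "A t = fcalc \<Lambda> P (\<lambda>l. c * (1 + l))" .
    have pd: "op_pd X (A t)"
      unfolding A_eq using c pos by (intro fcalc_pd) simp
    have "op_log X (A t) = fcalc \<Lambda> P (\<lambda>l. ln (c * (1 + l)))"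
      unfolding A_eq using c pos by (intro op_log_fcalc) simp
    also have "\<dots> = fcalc \<Lambda> P (\<lambda>l. ln c + ln (1 + l))"
      using c pos by (intro fcalc_cong) (simp add: ln_mult_pos)
    also have "\<dots> = op_scale (of_real (ln c)) one + fcalc \<Lambda> P (\<lambda>l. ln (1 + l))"
      by (simp add: fcalc_const flip: fcalc_add)
    finally have log: "op_log X (A t) = op_scale (of_real (ln c)) one + fcalc \<Lambda> P (\<lambda>l. ln (1 + l))" .
    then have L: "L t = fcalc \<Lambda> P (\<lambda>l. ln (1 + l))"
      by (simp add: L_def)
    have "op_norm X (L t) \<le> op_norm X (fcalc \<Lambda> P (\<lambda>l. 2 * l))"
      unfolding L
    proof (rule norm_fcalc_mono)
      fix x assume x: "x \<in> \<Lambda>"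
      have "\<bar>ln (1 + x) - x\<bar> \<le> 2 * x\<^sup>2"
        using l[OF x] by (rule abs_ln_one_plus_x_minus_x_bound)
      moreover have "\<bar>x\<bar> * \<bar>x\<bar> \<le> (1 / 2) * \<bar>x\<bar>"
        using l[OF x] by (intro mult_right_mono) auto
      then have "2 * x\<^sup>2 \<le> \<bar>x\<bar>"
        by (simp add: power2_eq_square flip: abs_mult)
      ultimately show "\<bar>ln (1 + x)\<bar> \<le> \<bar>2 * x\<bar>"
        by linarith
    qed
    also have "\<dots> = 2 * op_norm X (M t)"
      unfolding fcalc_scale[symmetric] by (simp add: M_eq norm_scale)
    finally have norm: "op_norm X (L t) \<le> 2 * op_norm X (M t)" .
    have "A t = op_exp X (op_log X (A t))"
      using pd_log[OF pd] by simp
    also have "\<dots> = op_scale (of_real c) (op_exp X (L t))"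
      unfolding log L using c by (simp add: exp_add_scalar fcalc_hermitian)
    finally show ?thesis
      using pd norm log L by (simp add: fcalc_hermitian)
  qed
  have ev: "\<forall>\<^sub>F t in at 0. op_hermitian X (L t) \<and> op_pd X (A t) \<and>
       op_log X (A t) = op_scale (of_real (ln c)) one + L t \<and>
       A t = op_scale (of_real c) (op_exp X (L t)) \<and> op_norm X (L t) \<le> 2 * op_norm X (M t)"
    using herm op_bigo_1_small[OF M_bigo, of "1 / 2", simplified]
    by eventually_elim (rule key, auto)
  obtain C where C: "0 < C" "\<forall>\<^sub>F t in at 0. op_norm X (M t) \<le> C * \<bar>t\<bar> ^ 1"
    by (rule op_bigo_normE[OF M_bigo])
  have "op_bigo 1 L"
  proof (rule op_bigo_normI)
    show "\<forall>\<^sub>F t in at 0. L t \<in> oprs X"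
      using ev by eventually_elim (auto simp: op_hermitian_iff)
    show "\<forall>\<^sub>F t in at 0. op_norm X (L t) \<le> (2 * C) * \<bar>t\<bar> ^ 1"
      using ev C(2) by eventually_elim auto
  qed
  moreover have "\<forall>\<^sub>F t in at 0. op_hermitian X (L t) \<and> op_pd X (A t) \<and>
       op_log X (A t) = op_scale (of_real (ln c)) one + L t \<and>
       A t = op_scale (of_real c) (op_exp X (L t))"
    using ev by eventually_elim auto
  ultimately show thesis by (rule that)
qed

lemma near_id_pd: "near_id X c A \<Longrightarrow> \<forall>\<^sub>F t in at 0. op_pd X (A t)"
  by (erule near_id_log, erule eventually_mono) auto

text \<open>Up to third order the traces of \<open>exp (L + K)\<close> and \<open>exp L exp K\<close> agree by the
  cyclicity of the trace; only at fourth order the trace of \<open>LKLK\<close> differs from that of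
  \<open>LLKK\<close>.\<close>

lemma golden_thompson_exp:
  assumes L: "\<forall>\<^sub>F t in at 0. op_hermitian X (L t)" "op_bigo 1 L"
    and K: "\<forall>\<^sub>F t in at 0. op_hermitian X (K t)" "op_bigo 1 K"
  shows "(\<lambda>t. op_trace X (op_exp X (L t + K t)) - op_trace X (op_exp X (L t) \<odot> op_exp X (K t)))
    \<in> O[at 0](\<lambda>t. of_real t ^ 4)"
proof -
  \<comment> \<open>Taylor polynomial of degree 3; all terms of higher degree belong to the
    error.\<close>
  define p where "p L = (\<Sum>k<4. op_scale (of_real (1 / fact k)) (op_pow X L k))" for L
  define R where "R L = op_exp X L - p L" for L
  have R: "op_bigo 4 (\<lambda>t. R (L t))" "op_bigo 4 (\<lambda>t. R (K t))"
    unfolding R_def p_def by (rule exp_taylor_bigo[OF L], simp) (rule exp_taylor_bigo[OF K], simp)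
  have LK: "\<forall>\<^sub>F t in at 0. op_hermitian X (L t + K t)"
    using L(1) K(1) by eventually_elim (rule hermitian_add)
  have R_LK: "op_bigo 4 (\<lambda>t. R (L t + K t))"
    unfolding R_def p_def using L K by (intro exp_taylor_bigo LK op_bigo_add) auto
  have LLL: "op_bigo j (\<lambda>t. op_pow X (L t) j)" "op_bigo j (\<lambda>t. op_pow X (K t) j)" for j
    by (induction j) (use op_bigo_mult[OF L(2)] op_bigo_mult[OF K(2)] op_bigo_const in \<open>auto\<close>)
  have pL: "op_bigo 0 (\<lambda>t. p (L t))"
    unfolding p_def by (intro op_bigo_sum op_bigo_scale op_bigo_mono[OF LLL(1)]) auto
  have eK: "op_bigo 0 (\<lambda>t. op_exp X (K t))"
  proof -
    have "op_bigo 0 (\<lambda>t. R (K t) + p (K t))"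
      unfolding p_def by (intro op_bigo_add op_bigo_mono[OF R(2)] op_bigo_sum op_bigo_scale op_bigo_mono[OF LLL(2)]) auto
    then show ?thesis by (simp add: R_def)
  qed
  have e1: "op_bigo 4 (\<lambda>t. R (L t) \<odot> op_exp X (K t))"
    using op_bigo_mult[OF R(1) eK] by simp
  have e2: "op_bigo 4 (\<lambda>t. p (L t) \<odot> R (K t))"
    using op_bigo_mult[OF pL R(2)] by simp
  \<comment> \<open>The terms of total degree at least 4 in \<open>p L \<odot> p K\<close>, which
    the target polynomial \<open>p (L + K)\<close> does not contain.\<close>
  define Q where "Q L K = (\<Sum>i<4. \<Sum>j<4. if i + j < 4 then 0
      else op_scale (of_real (1 / (fact i * fact j))) (op_pow X L i \<odot> op_pow X K j))" for L K
  have e3: "op_bigo 4 (\<lambda>t. Q (L t) (K t))"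
    unfolding Q_def
  proof (intro op_bigo_sum)
    fix i j :: nat
    show "op_bigo 4 (\<lambda>t. if i + j < 4 then 0
      else op_scale (of_real (1 / (fact i * fact j))) (op_pow X (L t) i \<odot> op_pow X (K t) j))"
      using op_bigo_mono[OF op_bigo_mult[OF LLL(1)[of i] LLL(2)[of j]], of 4]
      by (cases "i + j < 4") (auto intro: op_bigo_zero op_bigo_scale)
  qed
  have trace_p: "op_trace X (p (A + B)) = op_trace X (p A \<odot> p B) - op_trace X (Q A B)"
    if A: "A \<in> oprs X" and B: "B \<in> oprs X" for A B
  proof -
    \<comment> \<open>Cyclic shifts bring all mixed words of degree 2 and 3 into the order with
      \<open>A\<close> before \<open>B\<close>; they could not do so for
      \<open>ABAB\<close>.\<close>
    have t: "op_trace X (B \<odot> A) = op_trace X (A \<odot> B)"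
      "op_trace X (A \<odot> (B \<odot> A)) = op_trace X (A \<odot> (A \<odot> B))"
      "op_trace X (B \<odot> (A \<odot> A)) = op_trace X (A \<odot> (A \<odot> B))"
      "op_trace X (B \<odot> (A \<odot> B)) = op_trace X (A \<odot> (B \<odot> B))"
      "op_trace X (B \<odot> (B \<odot> A)) = op_trace X (A \<odot> (B \<odot> B))"
      using trace_mult_commute[of B A] trace_mult_commute[of "A \<odot> B" A] trace_mult_commute[of B "A \<odot> A"]
        trace_mult_commute[of B "A \<odot> B"] trace_mult_commute[of "B \<odot> B" A]
      by (simp_all add: mult_assoc)
    show ?thesis
      unfolding p_def Q_def
      using A B by (simp add: numeral_eq_Suc oprs_add oprs_mult mult_simps trace_add trace_scale op_scale_add t)
  qed
  \<comment> \<open>The full error: the remainder of the joint exponential, minus \<open>Q\<close>,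
    minus what the product of the exponentials has beyond the product of their Taylor
    polynomials.\<close>
  have "op_bigo 4 (\<lambda>t. R (L t + K t) - Q (L t) (K t) - (R (L t) \<odot> op_exp X (K t) + p (L t) \<odot> R (K t)))"
    by (intro op_bigo_diff op_bigo_add R_LK e1 e2 e3)
  then have "(\<lambda>t. op_trace X (R (L t + K t) - Q (L t) (K t) - (R (L t) \<odot> op_exp X (K t) + p (L t) \<odot> R (K t))))
      \<in> O[at 0](\<lambda>t. of_real t ^ 4)"
    by (rule op_bigo_trace)
  moreover have "\<forall>\<^sub>F t in at 0. op_trace X (R (L t + K t) - Q (L t) (K t) - (R (L t) \<odot> op_exp X (K t) + p (L t) \<odot> R (K t)))
      = op_trace X (op_exp X (L t + K t)) - op_trace X (op_exp X (L t) \<odot> op_exp X (K t))"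
    using L(1) K(1)
  proof eventually_elim
    case (elim t)
    have "op_trace X (op_exp X (L t + K t)) = op_trace X (R (L t + K t)) + op_trace X (p (L t + K t))"
      by (simp add: R_def flip: trace_add)
    moreover have "op_exp X (L t) \<odot> op_exp X (K t) = p (L t) \<odot> p (K t)
        + (R (L t) \<odot> op_exp X (K t) + p (L t) \<odot> R (K t))"
      by (simp add: R_def mult_simps)
    then have "op_trace X (op_exp X (L t) \<odot> op_exp X (K t)) = op_trace X (p (L t) \<odot> p (K t))
        + op_trace X (R (L t) \<odot> op_exp X (K t) + p (L t) \<odot> R (K t))"
      by (simp only: trace_add)
    ultimately show ?case
      using trace_p[of "L t" "K t"] elim by (simp add: trace_diff op_hermitian_iff)
  qed
  ultimately show ?thesis
    by (rule bigo_transform)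
qed

end

section \<open>Trace estimate and star products of several families\<close>

context index_set
begin

text \<open>The logarithms contain the constants \<open>ln c\<close> and \<open>ln c'\<close>, which
  need not be small. Being multiples of the identity, they leave both traces as the common factor
  \<open>c * c'\<close>, and the rest falls under \<open>golden_thompson_exp\<close>.\<close>

lemma golden_thompson:
  assumes A: "near_id X c A" and B: "near_id X c' B"
  shows "(\<lambda>t. op_trace X (op_exp X (op_log X (A t) + op_log X (B t))) - op_trace X (A t \<odot> B t))
    \<in> O[at 0](\<lambda>t. of_real t ^ 4)"
proof -
  have c: "0 < c" "0 < c'"
    using A B by (auto simp: near_id_def)
  obtain L where L: "op_bigo 1 L" and evL: "\<forall>\<^sub>F t in at 0. op_hermitian X (L t) \<and> op_pd X (A t) \<and>
       op_log X (A t) = op_scale (of_real (ln c)) one + L t \<and>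
       A t = op_scale (of_real c) (op_exp X (L t))"
    by (rule near_id_log[OF A])
  obtain K where K: "op_bigo 1 K" and evK: "\<forall>\<^sub>F t in at 0. op_hermitian X (K t) \<and> op_pd X (B t) \<and>
       op_log X (B t) = op_scale (of_real (ln c')) one + K t \<and>
       B t = op_scale (of_real c') (op_exp X (K t))"
    by (rule near_id_log[OF B])
  have "(\<lambda>t. of_real (c * c') * (op_trace X (op_exp X (L t + K t)) - op_trace X (op_exp X (L t) \<odot> op_exp X (K t))))
    \<in> O[at 0](\<lambda>t. of_real t ^ 4)"
    using c evL evK
    by (subst landau_o.big.cmult_in_iff) (auto intro!: golden_thompson_exp L K elim: eventually_mono)
  moreover have "\<forall>\<^sub>F t in at 0.
      of_real (c * c') * (op_trace X (op_exp X (L t + K t)) - op_trace X (op_exp X (L t) \<odot> op_exp X (K t)))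
      = op_trace X (op_exp X (op_log X (A t) + op_log X (B t))) - op_trace X (A t \<odot> B t)"
    using evL evK
  proof eventually_elim
    case (elim t)
    have "op_log X (A t) + op_log X (B t) = op_scale (of_real (ln (c * c'))) one + (L t + K t)"
    proof -
      have logs: "op_log X (A t) = op_scale (of_real (ln c)) one + L t"
        "op_log X (B t) = op_scale (of_real (ln c')) one + K t"
        using elim by blast+
      show ?thesis
        unfolding logs using c by (simp add: ln_mult_pos op_scale_add_scalar algebra_simps)
    qed
    then have "op_exp X (op_log X (A t) + op_log X (B t)) = op_scale (of_real (c * c')) (op_exp X (L t + K t))"
      using exp_add_scalar[of "L t + K t" "ln (c * c')"] elim c by (simp add: hermitian_add)
    moreover have "A t \<odot> B t = op_scale (of_real (c * c')) (op_exp X (L t) \<odot> op_exp X (K t))"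
      using elim by (simp add: mult_scale_left mult_scale_right)
    ultimately show ?case
      by (simp add: trace_scale right_diff_distrib)
  qed
  ultimately show ?thesis
    by (rule bigo_transform)
qed

lemma star_prod_foldr:
  assumes "finite F"
  obtains as where "distinct as" "set as = F" "star_prod X \<rho> F = foldr (\<lambda>a. star X (\<rho> a)) as one"
proof -
  have "\<exists>as. distinct as \<and> set as = F"
    using finite_distinct_list[OF assms] by blast
  from someI_ex[OF this] show thesis
    by (intro that[of "SOME as. distinct as \<and> set as = F"]) (auto simp: star_prod_def)
qed

lemma one_psd: "op_psd X one"
  using psd_gram[of one] by simp

lemma star_prod_psd:
  assumes "finite F" "\<And>a. a \<in> F \<Longrightarrow> op_psd X (\<rho> a)"
  shows "op_psd X (star_prod X \<rho> F)"
proof -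
  obtain as where as: "set as = F" "star_prod X \<rho> F = foldr (\<lambda>a. star X (\<rho> a)) as one"
    using star_prod_foldr[OF assms(1)] by metis
  have "op_psd X (foldr (\<lambda>a. star X (\<rho> a)) bs one)" if "set bs \<subseteq> F" for bs
    using that by (induction bs) (simp_all add: one_psd star_psd assms(2))
  then show ?thesis
    using as by simp
qed

text \<open>Each step of the fold stays in the exponential branch of \<open>star\<close> and merely
  adds a logarithm. The resulting sum over \<open>F\<close> no longer depends on the chosen
  enumeration.\<close>

lemma star_prod_exp:
  assumes "finite F" "\<And>a. a \<in> F \<Longrightarrow> op_pd X (\<rho> a)"
  shows "star_prod X \<rho> F = op_exp X (\<Sum>a\<in>F. op_log X (\<rho> a))"
proof -
  obtain as where as: "distinct as" "set as = F" "star_prod X \<rho> F = foldr (\<lambda>a. star X (\<rho> a)) as one"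
    using star_prod_foldr[OF assms(1)] by metis
  have "foldr (\<lambda>a. star X (\<rho> a)) bs one = op_exp X (\<Sum>a\<in>set bs. op_log X (\<rho> a))"
    if "set bs \<subseteq> F" "distinct bs" for bs
    using that
  proof (induction bs)
    case Nil
    then show ?case by (simp add: exp_zero)
  next
    case (Cons a bs)
    have pd: "op_pd X (\<rho> b)" if "b \<in> set (a # bs)" for b
      using Cons.prems that assms(2) by blast
    have "foldr (\<lambda>a. star X (\<rho> a)) (a # bs) one
        = star X (op_exp X (op_log X (\<rho> a))) (op_exp X (\<Sum>b\<in>set bs. op_log X (\<rho> b)))"
      using Cons pd_log(2)[OF pd[of a]] by simp
    also have "\<dots> = op_exp X (op_log X (\<rho> a) + (\<Sum>b\<in>set bs. op_log X (\<rho> b)))"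
      using pd by (intro star_exp hermitian_sum pd_log(1)) auto
    finally show ?case
      using Cons.prems by simp
  qed
  then show ?thesis
    using as by simp
qed

lemma hermitian_sum_log:
  "(\<And>a. a \<in> F \<Longrightarrow> op_pd X (\<rho> a)) \<Longrightarrow> op_hermitian X (\<Sum>a\<in>F. op_log X (\<rho> a))"
  by (intro hermitian_sum pd_log(1))

lemma near_id_transform:
  assumes "near_id X c A" and eq: "\<forall>\<^sub>F t in at 0. A t = B t"
  shows "near_id X c B"
proof -
  have "(\<forall>\<^sub>F t in at 0. op_hermitian X (A t)) \<longleftrightarrow> (\<forall>\<^sub>F t in at 0. op_hermitian X (B t))"
    by (rule eventually_cong[OF eq]) simp
  moreover have "op_bigo 1 (\<lambda>t. A t - op_scale (of_real c) one) \<longleftrightarrow> op_bigo 1 (\<lambda>t. B t - op_scale (of_real c) one)"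
    by (rule op_bigo_cong) (use eq in eventually_elim, simp)
  ultimately show ?thesis
    using assms(1) by (simp add: near_id_def)
qed

text \<open>Logarithms add: the summands \<open>ln (c a)\<close> give the logarithm of
  \<open>prod c F\<close>, and the O(t) parts an exponent that is again O(t).\<close>

lemma near_id_star_prod:
  assumes F: "finite F" and A: "\<And>a. a \<in> F \<Longrightarrow> near_id X (c a) (A a)"
  shows "near_id X (prod c F) (\<lambda>t. star_prod X (\<lambda>a. A a t) F)"
proof -
  have "\<forall>a\<in>F. \<exists>L. op_bigo 1 L \<and> (\<forall>\<^sub>F t in at 0. op_hermitian X (L t) \<and> op_pd X (A a t) \<and>
       op_log X (A a t) = op_scale (of_real (ln (c a))) one + L t \<and>
       A a t = op_scale (of_real (c a)) (op_exp X (L t)))"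
  proof
    fix a assume "a \<in> F"
    then have "near_id X (c a) (A a)"
      by (rule A)
    then show "\<exists>L. op_bigo 1 L \<and> (\<forall>\<^sub>F t in at 0. op_hermitian X (L t) \<and> op_pd X (A a t) \<and>
       op_log X (A a t) = op_scale (of_real (ln (c a))) one + L t \<and>
       A a t = op_scale (of_real (c a)) (op_exp X (L t)))"
      by (rule near_id_log) blast
  qed
  from bchoice[OF this] obtain L where *:
    "\<forall>a\<in>F. op_bigo 1 (L a) \<and> (\<forall>\<^sub>F t in at 0. op_hermitian X (L a t) \<and> op_pd X (A a t) \<and>
       op_log X (A a t) = op_scale (of_real (ln (c a))) one + L a t \<and>
       A a t = op_scale (of_real (c a)) (op_exp X (L a t)))"
    by (rule exE)
  have L: "op_bigo 1 (L a)" if "a \<in> F" for a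
    using bspec[OF * that] by (rule conjunct1)
  have ev: "\<forall>\<^sub>F t in at 0. op_hermitian X (L a t) \<and> op_pd X (A a t) \<and>
       op_log X (A a t) = op_scale (of_real (ln (c a))) one + L a t \<and>
       A a t = op_scale (of_real (c a)) (op_exp X (L a t))" if "a \<in> F" for a
    using bspec[OF * that] by (rule conjunct2)
  have c: "0 < c a" if "a \<in> F" for a
    using A[OF that] by (simp add: near_id_def)
  have ev': "\<forall>\<^sub>F t in at 0. \<forall>a\<in>F. op_hermitian X (L a t) \<and> op_pd X (A a t) \<and>
       op_log X (A a t) = op_scale (of_real (ln (c a))) one + L a t \<and>
       A a t = op_scale (of_real (c a)) (op_exp X (L a t))"
    using F ev by (simp add: eventually_ball_finite)
  then have "\<forall>\<^sub>F t in at 0. op_hermitian X (\<Sum>a\<in>F. L a t)"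
    by eventually_elim (auto intro: hermitian_sum)
  then have "near_id X (prod c F) (\<lambda>t. op_scale (of_real (prod c F)) (op_exp X (\<Sum>a\<in>F. L a t)))"
    using L c by (intro near_id_exp op_bigo_sum prod_pos) auto
  moreover have "\<forall>\<^sub>F t in at 0. op_scale (of_real (prod c F)) (op_exp X (\<Sum>a\<in>F. L a t))
      = star_prod X (\<lambda>a. A a t) F"
    using ev'
  proof eventually_elim
    case (elim t)
    have "star_prod X (\<lambda>a. A a t) F = op_exp X (\<Sum>a\<in>F. op_log X (A a t))"
      using F elim by (intro star_prod_exp) auto
    also have "(\<Sum>a\<in>F. op_log X (A a t)) = (\<Sum>a\<in>F. op_scale (of_real (ln (c a))) one + L a t)"
      using elim by (intro sum.cong refl) blast
    also have "\<dots> = (\<Sum>a\<in>F. op_scale (of_real (ln (c a))) one) + (\<Sum>a\<in>F. L a t)"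
      by (rule sum.distrib)
    also have "(\<Sum>a\<in>F. op_scale (of_real (ln (c a))) one) = op_scale (of_real (ln (prod c F))) one"
    proof -
      have "c a \<noteq> 0" if "a \<in> F" for a
        using c[OF that] by simp
      then show ?thesis
        using F by (simp add: ln_prod flip: opr.scale_sum_left)
    qed
    also have "op_exp X (\<dots> + (\<Sum>a\<in>F. L a t)) = op_scale (of_real (prod c F)) (op_exp X (\<Sum>a\<in>F. L a t))"
      using elim c by (subst exp_add_scalar) (auto intro!: hermitian_sum simp: prod_pos)
    finally show ?case by simp
  qed
  ultimately show ?thesis
    by (rule near_id_transform)
qed

end

section \<open>Tensor products and partial traces\<close>

lemma finite_configs [simp]: "finite S \<Longrightarrow> finite (configs d S)"
  by (simp add: configs_def finite_PiE)

lemma configs_restrict: "x \<in> configs d T \<Longrightarrow> S \<subseteq> T \<Longrightarrow> restrict x S \<in> configs d S"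
  by (auto simp: configs_def)

lemma configs_restrict_self: "x \<in> configs d S \<Longrightarrow> restrict x S = x"
  by (auto simp: configs_def PiE_def extensional_restrict)

lemma configs_eqI:
  assumes "x \<in> configs d T" "y \<in> configs d T" "\<And>i. i \<in> T \<Longrightarrow> x i = y i"
  shows "x = y"
  using assms unfolding configs_def by (intro extensionalityI[of _ T]) (auto simp: PiE_def)

lemma configs_override:
  "x \<in> configs d (T - W) \<Longrightarrow> w \<in> configs d W \<Longrightarrow> W \<subseteq> T \<Longrightarrow> override_on x w W \<in> configs d T"
  by (auto simp: configs_def PiE_def Pi_def extensional_def override_on_def)

lemma restrict_override_outer: "x \<in> configs d (T - W) \<Longrightarrow> restrict (override_on x w W) (T - W) = x"
  by (auto simp: configs_def PiE_def extensional_def override_on_def fun_eq_iff)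

lemma restrict_override_inner: "w \<in> configs d W \<Longrightarrow> restrict (override_on x w W) W = w"
  by (auto simp: configs_def PiE_def extensional_def override_on_def fun_eq_iff)

lemma override_restrict:
  "u \<in> configs d T \<Longrightarrow> W \<subseteq> T \<Longrightarrow> override_on (restrict u (T - W)) (restrict u W) W = u"
  by (auto simp: configs_def PiE_def extensional_def override_on_def fun_eq_iff)

text \<open>A configuration on \<open>T\<close> is a pair of configurations on \<open>T - W\<close>
  and \<open>W\<close>, joined by \<open>override_on\<close>: the product basis of the tensor
  product.\<close>

lemma sum_configs_split:
  assumes "W \<subseteq> T"
  shows "(\<Sum>u\<in>configs d T. f u) = (\<Sum>x\<in>configs d (T - W). \<Sum>w\<in>configs d W. f (override_on x w W))"
proof -
  have "(\<Sum>u\<in>configs d T. f u) = (\<Sum>(x, w)\<in>configs d (T - W) \<times> configs d W. f (override_on x w W))"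
    by (rule sum.reindex_bij_witness[of _ "\<lambda>(x, w). override_on x w W" "\<lambda>u. (restrict u (T - W), restrict u W)"])
      (use assms in \<open>auto simp: override_restrict configs_override restrict_override_outer
          restrict_override_inner intro: configs_restrict\<close>)
  then show ?thesis
    by (simp add: sum.cartesian_product)
qed

section \<open>Tensoring with the identity\<close>

lemma embed_op_oprs [simp, intro]: "embed_op d S T A \<in> oprs (configs d T)"
  by (auto simp: embed_op_def oprs_def)

lemma embed_op_diff: "embed_op d S T (A - B) = embed_op d S T A - embed_op d S T B"
  by (auto simp: embed_op_def fun_eq_iff fun_apply_simps)

lemma embed_op_scale: "embed_op d S T (op_scale c A) = op_scale c (embed_op d S T A)"
  by (auto simp: embed_op_def fun_eq_iff op_scale_def)

lemma embed_op_sum: "embed_op d S T (sum f I) = (\<Sum>i\<in>I. embed_op d S T (f i))"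
  by (auto simp: embed_op_def fun_eq_iff sum_opr_apply intro!: sum.neutral)

lemma embed_op_adj: "op_adj (embed_op d S T A) = embed_op d S T (op_adj A)"
  by (auto simp: embed_op_def op_adj_def fun_eq_iff)

lemma embed_op_hermitian:
  "op_hermitian (configs d S) A \<Longrightarrow> op_hermitian (configs d T) (embed_op d S T A)"
  by (auto simp: op_hermitian_iff embed_op_adj)

lemma embed_op_id:
  assumes "S \<subseteq> T"
  shows "embed_op d S T (op_id (configs d S)) = op_id (configs d T)"
proof (intro ext)
  fix x y
  have "x = y" if "x \<in> configs d T" "y \<in> configs d T" "\<forall>i\<in>T - S. x i = y i" "restrict x S = restrict y S"
  proof (rule configs_eqI[OF that(1,2)])
    fix i assume "i \<in> T"
    then show "x i = y i"
      using that(3) fun_cong[OF that(4), of i] by (cases "i \<in> S") auto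
  qed
  then show "embed_op d S T (op_id (configs d S)) x y = op_id (configs d T) x y"
    using assms configs_restrict[of x d T S] by (auto simp: embed_op_def op_id_def)
qed

lemma embed_op_mult:
  assumes T: "finite T" and "S \<subseteq> T"
  shows "op_mult (configs d T) (embed_op d S T A) (embed_op d S T B)
    = embed_op d S T (op_mult (configs d S) A B)"
proof (intro ext)
  fix x y
  show "op_mult (configs d T) (embed_op d S T A) (embed_op d S T B) x y
      = embed_op d S T (op_mult (configs d S) A B) x y"
  proof (cases "x \<in> configs d T \<and> y \<in> configs d T \<and> (\<forall>i\<in>T - S. x i = y i)")
    case False
    then have zero: "embed_op d S T A x z * embed_op d S T B z y = 0" for z
      by (auto simp: embed_op_def)
    have "op_mult (configs d T) (embed_op d S T A) (embed_op d S T B) x y = 0"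
      unfolding op_mult_def by (intro sum.neutral ballI) (rule zero)
    moreover have "embed_op d S T (op_mult (configs d S) A B) x y = 0"
      using False by (auto simp: embed_op_def)
    ultimately show ?thesis by simp
  next
    case True
    \<comment> \<open>The identity on \<open>T - S\<close> forces an intermediate configuration to
      agree with \<open>x\<close> there, so the sum over \<open>T - S\<close> reduces to the single
      term \<open>x'\<close>.\<close>
    define x' where "x' = restrict x (T - S)"
    have x': "x' \<in> configs d (T - S)"
      unfolding x'_def using True by (intro configs_restrict) auto
    have TS: "T - (T - S) = S"
      using \<open>S \<subseteq> T\<close> by auto
    have "op_mult (configs d T) (embed_op d S T A) (embed_op d S T B) x y
        = (\<Sum>w\<in>configs d S. \<Sum>z\<in>configs d (T - S).
            embed_op d S T A x (override_on w z (T - S)) * embed_op d S T B (override_on w z (T - S)) y)"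
      unfolding op_mult_def by (subst sum_configs_split[of "T - S" T]) (auto simp: TS)
    also have "\<dots> = (\<Sum>w\<in>configs d S. \<Sum>z\<in>configs d (T - S).
        if z = x' then A (restrict x S) w * B w (restrict y S) else 0)"
    proof (intro sum.cong refl)
      fix w z assume w: "w \<in> configs d S" and z: "z \<in> configs d (T - S)"
      define u where "u = override_on w z (T - S)"
      have u: "u \<in> configs d T"
        unfolding u_def using w z TS by (intro configs_override) auto
      have uS: "restrict u S = w"
        using restrict_override_outer[of w d T "T - S" z] w by (simp add: TS u_def)
      show "embed_op d S T A x u * embed_op d S T B u y
          = (if z = x' then A (restrict x S) w * B w (restrict y S) else 0)"
      proof (cases "z = x'")
        case z_eq: True
        then have "\<forall>i\<in>T - S. x i = u i" "\<forall>i\<in>T - S. u i = y i"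
          using True by (auto simp: u_def x'_def override_on_def)
        then show ?thesis
          using z_eq True u uS by (simp add: embed_op_def)
      next
        case False
        then have "\<not> (\<forall>i\<in>T - S. x i = u i)"
          using configs_eqI[OF z x'] by (auto simp: u_def x'_def override_on_def)
        then show ?thesis
          using False by (auto simp: embed_op_def)
      qed
    qed
    also have "\<dots> = embed_op d S T (op_mult (configs d S) A B) x y"
      using True x' T by (simp add: embed_op_def op_mult_def)
    finally show ?thesis .
  qed
qed

lemma embed_op_pow:
  assumes "finite T" "S \<subseteq> T"
  shows "op_pow (configs d T) (embed_op d S T A) n = embed_op d S T (op_pow (configs d S) A n)"
  by (induction n) (simp_all add: assms embed_op_id embed_op_mult)

lemma embed_op_exp:
  assumes "finite T" "S \<subseteq> T"
  shows "op_exp (configs d T) (embed_op d S T A) = embed_op d S T (op_exp (configs d S) A)"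
proof (intro ext)
  fix x y
  define b where "b \<longleftrightarrow> x \<in> configs d T \<and> y \<in> configs d T \<and> (\<forall>i\<in>T - S. x i = y i)"
  show "op_exp (configs d T) (embed_op d S T A) x y = embed_op d S T (op_exp (configs d S) A) x y"
    unfolding op_exp_def embed_op_pow[OF assms] unfolding embed_op_def b_def[symmetric]
    by (cases b) simp_all
qed

lemma embed_op_trans:
  assumes "S \<subseteq> T" "T \<subseteq> U"
  shows "embed_op d T U (embed_op d S T A) = embed_op d S U A"
proof (intro ext)
  fix x y :: "'a \<Rightarrow> nat"
  have r: "restrict (restrict z T) S = restrict z S" for z :: "'a \<Rightarrow> nat"
    using assms by (auto simp: restrict_def fun_eq_iff)
  have iff: "(\<forall>i\<in>U - S. x i = y i) \<longleftrightarrow> (\<forall>i\<in>U - T. x i = y i) \<and> (\<forall>i\<in>T - S. x i = y i)"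
    using assms by auto
  have iff': "(\<forall>i\<in>T - S. restrict x T i = restrict y T i) \<longleftrightarrow> (\<forall>i\<in>T - S. x i = y i)"
    by auto
  show "embed_op d T U (embed_op d S T A) x y = embed_op d S U A x y"
    unfolding embed_op_def r iff iff' using assms by (auto simp: configs_restrict)
qed

lemma embed_op_self: "A \<in> oprs (configs d S) \<Longrightarrow> embed_op d S S A = A"
  by (auto simp: embed_op_def fun_eq_iff oprs_def configs_restrict_self)

text \<open>Writing \<open>A\<close> as a Gram matrix reduces the claim to multiplicativity of the
  embedding, with no quadratic forms on the larger space.\<close>

lemma embed_op_psd:
  assumes ST: "finite T" "S \<subseteq> T" and A: "op_psd (configs d S) A"
  shows "op_psd (configs d T) (embed_op d S T A)"
proof -
  have S: "finite S"
    using ST finite_subset by blast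
  interpret S: index_set "configs d S"
    by unfold_locales (simp add: S)
  interpret T: index_set "configs d T"
    by unfold_locales (simp add: ST)
  obtain \<Lambda> P where P: "resolution (configs d S) \<Lambda> P" and A_eq: "A = fcalc \<Lambda> P (\<lambda>l. l)"
    using S.spectral_theorem[of A] A unfolding op_psd_def by blast
  interpret resolution "configs d S" \<Lambda> P by fact
  define B where "B = fcalc \<Lambda> P (\<lambda>l. sqrt l)"
  have "A = S.mult (op_adj B) B"
    unfolding A_eq B_def using A psd_fcalc_nonneg[of "\<lambda>l. l"] by (intro fcalc_gram) (simp add: A_eq)
  then have "embed_op d S T A = T.mult (op_adj (embed_op d S T B)) (embed_op d S T B)"
    by (simp add: embed_op_mult[OF ST] embed_op_adj)
  then show ?thesis
    by (simp add: T.psd_gram)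
qed

text \<open>Embedding commutes with \<open>op_exp\<close> and preserves Hermitian operators, so the
  embedded logarithm is a Hermitian logarithm, and that is unique.\<close>

lemma embed_op_log:
  assumes ST: "finite T" "S \<subseteq> T" and A: "op_pd (configs d S) A"
  shows "op_pd (configs d T) (embed_op d S T A)"
    and "op_log (configs d T) (embed_op d S T A) = embed_op d S T (op_log (configs d S) A)"
proof -
  have S: "finite S"
    using ST finite_subset by blast
  interpret S: index_set "configs d S"
    by unfold_locales (simp add: S)
  interpret T: index_set "configs d T"
    by unfold_locales (simp add: ST)
  note L = S.pd_log[OF A]
  have herm: "op_hermitian (configs d T) (embed_op d S T (op_log (configs d S) A))"
    using L(1) by (rule embed_op_hermitian)
  have eq: "embed_op d S T A = op_exp (configs d T) (embed_op d S T (op_log (configs d S) A))"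
    by (simp add: embed_op_exp[OF ST] L(2))
  show "op_pd (configs d T) (embed_op d S T A)"
    unfolding eq by (rule T.exp_pd[OF herm])
  show "op_log (configs d T) (embed_op d S T A) = embed_op d S T (op_log (configs d S) A)"
    unfolding eq by (rule T.log_exp[OF herm])
qed

lemma op_bigo_embed: "op_bigo k M \<Longrightarrow> op_bigo k (\<lambda>t. embed_op d S T (M t))"
  unfolding op_bigo_def
proof (intro allI)
  fix x y
  assume M: "\<forall>x y. (\<lambda>t. M t x y) \<in> O[at 0](\<lambda>t. of_real t ^ k)"
  define b where "b \<longleftrightarrow> x \<in> configs d T \<and> y \<in> configs d T \<and> (\<forall>i\<in>T - S. x i = y i)"
  show "(\<lambda>t. embed_op d S T (M t) x y) \<in> O[at 0](\<lambda>t. of_real t ^ k)"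
    unfolding embed_op_def b_def[symmetric] using M by (cases b) simp_all
qed

lemma near_id_embed:
  assumes "S \<subseteq> T" "near_id (configs d S) c A"
  shows "near_id (configs d T) c (\<lambda>t. embed_op d S T (A t))"
  unfolding near_id_def
proof (intro conjI)
  show "0 < c"
    using assms(2) by (simp add: near_id_def)
  have "\<forall>\<^sub>F t in at 0. op_hermitian (configs d S) (A t)"
    using assms(2) by (simp add: near_id_def)
  then show "\<forall>\<^sub>F t in at 0. op_hermitian (configs d T) (embed_op d S T (A t))"
    by eventually_elim (rule embed_op_hermitian)
  have "op_bigo 1 (\<lambda>t. A t - op_scale (of_real c) (op_id (configs d S)))"
    using assms(2) by (simp add: near_id_def)
  from op_bigo_embed[OF this, of d S T]
  show "op_bigo 1 (\<lambda>t. embed_op d S T (A t) - op_scale (of_real c) (op_id (configs d T)))"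
    by (simp add: embed_op_diff embed_op_scale embed_op_id[OF assms(1)])
qed

section \<open>The partial trace\<close>

lemma partial_trace_oprs [simp, intro]: "partial_trace d S W A \<in> oprs (configs d (S - W))"
  by (auto simp: partial_trace_def oprs_def)

lemma partial_trace_diff:
  "partial_trace d S W (A - B) = partial_trace d S W A - partial_trace d S W B"
  by (auto simp: partial_trace_def fun_eq_iff minus_apply sum_subtractf)

lemma partial_trace_scale: "partial_trace d S W (op_scale c A) = op_scale c (partial_trace d S W A)"
  by (auto simp: partial_trace_def fun_eq_iff op_scale_def sum_distrib_left)

lemma partial_trace_adj: "op_adj (partial_trace d S W A) = partial_trace d S W (op_adj A)"
  by (auto simp: partial_trace_def op_adj_def fun_eq_iff)

lemma partial_trace_hermitian:
  "op_hermitian (configs d S) A \<Longrightarrow> op_hermitian (configs d (S - W)) (partial_trace d S W A)"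
  by (simp add: op_hermitian_iff partial_trace_adj)

text \<open>The source of the dimension factor that a closing step adds to the constant of a
  family.\<close>

lemma partial_trace_id:
  assumes "W \<subseteq> S"
  shows "partial_trace d S W (op_id (configs d S))
    = op_scale (of_nat (card (configs d W))) (op_id (configs d (S - W)))"
proof (intro ext)
  fix x y
  have "x = y" if "x \<in> configs d (S - W)" "y \<in> configs d (S - W)" "override_on x w W = override_on y w W" for w
    using that by (metis restrict_override_outer)
  then show "partial_trace d S W (op_id (configs d S)) x y
      = op_scale (of_nat (card (configs d W))) (op_id (configs d (S - W))) x y"
    using configs_override[of x d S W] assms
    by (cases "x = y") (auto simp: partial_trace_def op_id_def op_scale_def intro!: sum.neutral)
qed

lemma op_bigo_partial_trace: "op_bigo k M \<Longrightarrow> op_bigo k (\<lambda>t. partial_trace d S W (M t))"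
  unfolding op_bigo_def
proof (intro allI)
  fix x y
  assume M: "\<forall>x y. (\<lambda>t. M t x y) \<in> O[at 0](\<lambda>t. of_real t ^ k)"
  define b where "b \<longleftrightarrow> x \<in> configs d (S - W) \<and> y \<in> configs d (S - W)"
  show "(\<lambda>t. partial_trace d S W (M t) x y) \<in> O[at 0](\<lambda>t. of_real t ^ k)"
    unfolding partial_trace_def b_def[symmetric] using M by (cases b) (simp_all add: big_sum_in_bigo)
qed

lemma card_configs_pos: "finite W \<Longrightarrow> (\<And>i. i \<in> W \<Longrightarrow> 0 < d i) \<Longrightarrow> 0 < card (configs d W)"
  by (simp add: configs_def card_PiE prod_pos)

lemma near_id_partial_trace:
  assumes W: "finite W" "W \<subseteq> S" "\<And>i. i \<in> W \<Longrightarrow> 0 < d i" and A: "near_id (configs d S) c A"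
  shows "near_id (configs d (S - W)) (c * card (configs d W)) (\<lambda>t. partial_trace d S W (A t))"
  unfolding near_id_def
proof (intro conjI)
  show "0 < c * card (configs d W)"
    using A card_configs_pos[OF W(1,3)] by (simp add: near_id_def)
  have "\<forall>\<^sub>F t in at 0. op_hermitian (configs d S) (A t)"
    using A by (simp add: near_id_def)
  then show "\<forall>\<^sub>F t in at 0. op_hermitian (configs d (S - W)) (partial_trace d S W (A t))"
    by eventually_elim (rule partial_trace_hermitian)
  have "op_bigo 1 (\<lambda>t. A t - op_scale (of_real c) (op_id (configs d S)))"
    using A by (simp add: near_id_def)
  from op_bigo_partial_trace[OF this, of d S W]
  show "op_bigo 1 (\<lambda>t. partial_trace d S W (A t) - op_scale (of_real (c * card (configs d W))) (op_id (configs d (S - W))))"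
    by (simp add: partial_trace_diff partial_trace_scale partial_trace_id[OF W(2)])
qed

text \<open>\<open>u w\<close> is the product vector of \<open>v\<close> with the basis vector
  \<open>w\<close> of the traced space. Summing the quadratic form of \<open>A\<close> at these
  vectors over \<open>w\<close> gives that of the partial trace at \<open>v\<close>.\<close>

lemma partial_trace_psd:
  assumes W: "W \<subseteq> S" "finite S" and A: "op_psd (configs d S) A"
  shows "op_psd (configs d (S - W)) (partial_trace d S W A)"
  unfolding op_psd_def
proof (intro conjI allI)
  show "op_hermitian (configs d (S - W)) (partial_trace d S W A)"
    using A by (intro partial_trace_hermitian) (simp add: op_psd_def)
  fix v :: "('a \<Rightarrow> nat) \<Rightarrow> complex"
  define u where "u w x = (if restrict x W = w then v (restrict x (S - W)) else 0)" for w and x :: "'a \<Rightarrow> nat"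
  have finW: "finite (configs d W)"
    using W by (intro finite_configs) (rule finite_subset)
  have "quad_form (configs d S) A (u w)
      = (\<Sum>x\<in>configs d (S - W). \<Sum>y\<in>configs d (S - W). cnj (v x) * A (override_on x w W) (override_on y w W) * v y)"
    if w: "w \<in> configs d W" for w
  proof -
    have u: "u w (override_on x w' W) = (if w' = w then v x else 0)"
      if "x \<in> configs d (S - W)" "w' \<in> configs d W" for x w'
      using that by (simp add: u_def restrict_override_inner restrict_override_outer)
    have "quad_form (configs d S) A (u w)
      = (\<Sum>x\<in>configs d (S - W). \<Sum>w1\<in>configs d W. \<Sum>y\<in>configs d (S - W). \<Sum>w2\<in>configs d W.
          cnj (if w1 = w then v x else 0) * A (override_on x w1 W) (override_on y w2 W) * (if w2 = w then v y else 0))"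
      unfolding quad_form_def sum_configs_split[OF W(1)] by (intro sum.cong refl) (simp add: u)
    also have "\<dots> = (\<Sum>x\<in>configs d (S - W). \<Sum>w1\<in>configs d W. \<Sum>y\<in>configs d (S - W). \<Sum>w2\<in>configs d W.
          if w2 = w then (if w1 = w then cnj (v x) * A (override_on x w W) (override_on y w W) * v y else 0) else 0)"
      by (intro sum.cong refl) auto
    also have "\<dots> = (\<Sum>x\<in>configs d (S - W). \<Sum>w1\<in>configs d W.
          if w1 = w then (\<Sum>y\<in>configs d (S - W). cnj (v x) * A (override_on x w W) (override_on y w W) * v y) else 0)"
      using finW w by (intro sum.cong refl) auto
    also have "\<dots> = (\<Sum>x\<in>configs d (S - W). \<Sum>y\<in>configs d (S - W). cnj (v x) * A (override_on x w W) (override_on y w W) * v y)"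
      using finW w by simp
    finally show ?thesis .
  qed
  then have "(\<Sum>w\<in>configs d W. quad_form (configs d S) A (u w))
      = (\<Sum>x\<in>configs d (S - W). \<Sum>y\<in>configs d (S - W). \<Sum>w\<in>configs d W.
          cnj (v x) * A (override_on x w W) (override_on y w W) * v y)"
    by (simp add: sum.swap[of _ _ "configs d W"])
  also have "\<dots> = quad_form (configs d (S - W)) (partial_trace d S W A) v"
    unfolding quad_form_def
    by (intro sum.cong refl) (simp add: partial_trace_def sum_distrib_left sum_distrib_right)
  finally have "Re (quad_form (configs d (S - W)) (partial_trace d S W A) v)
      = (\<Sum>w\<in>configs d W. Re (quad_form (configs d S) A (u w)))"
    by (simp flip: Re_sum)
  also have "\<dots> \<ge> 0"
    using A unfolding op_psd_def by (intro sum_nonneg) blast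
  finally show "0 \<le> Re (quad_form (configs d (S - W)) (partial_trace d S W A) v)" .
qed

text \<open>As \<open>W\<close> lies in \<open>S\<close>, the trace never meets the identity factor,
  which sits on \<open>T - S\<close> on both sides.\<close>

lemma partial_trace_embed:
  assumes "W \<subseteq> S" "S \<subseteq> T"
  shows "partial_trace d T W (embed_op d S T A) = embed_op d (S - W) (T - W) (partial_trace d S W A)"
proof (intro ext)
  fix x y
  show "partial_trace d T W (embed_op d S T A) x y = embed_op d (S - W) (T - W) (partial_trace d S W A) x y"
  proof (cases "x \<in> configs d (T - W) \<and> y \<in> configs d (T - W)")
    case False
    then show ?thesis by (auto simp: partial_trace_def embed_op_def)
  next
    case True
    have r: "restrict (override_on z w W) S = override_on (restrict z (S - W)) w W"
      if "z \<in> configs d (T - W)" "w \<in> configs d W" for z w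
    proof
      fix i
      show "restrict (override_on z w W) S i = override_on (restrict z (S - W)) w W i"
        using assms(1) by (cases "i \<in> W") (auto simp: override_on_def)
    qed
    have restr: "restrict x (S - W) \<in> configs d (S - W)" "restrict y (S - W) \<in> configs d (S - W)"
      using True assms by (auto intro: configs_restrict)
    define b where "b \<longleftrightarrow> (\<forall>i\<in>(T - W) - (S - W). x i = y i)"
    have agree: "(\<forall>i\<in>T - S. override_on x w W i = override_on y w W i) \<longleftrightarrow> b" for w
      unfolding b_def using assms by (auto simp: override_on_def)
    have over: "override_on z w W \<in> configs d T" if "z \<in> configs d (T - W)" "w \<in> configs d W" for z w
      using that assms by (intro configs_override) auto
    have entry: "embed_op d S T A (override_on x w W) (override_on y w W)
        = (if b then A (override_on (restrict x (S - W)) w W) (override_on (restrict y (S - W)) w W) else 0)"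
      if "w \<in> configs d W" for w
      using True that unfolding embed_op_def agree by (simp add: over r)
    show ?thesis
      using True restr
      unfolding partial_trace_def embed_op_def[of d "S - W"] b_def[symmetric]
      by (simp add: entry)
  qed
qed

text \<open>The identity factor on \<open>W\<close> equates the two \<open>W\<close>-components of
  the indices of \<open>Y\<close>, which is the partial trace. Thus \<open>embed_op\<close> is
  adjoint to \<open>partial_trace\<close> for the trace pairing, and closing a box leaves the trace
  of the product unchanged.\<close>

lemma trace_mult_embed:
  assumes "W \<subseteq> T" "finite T"
  shows "op_trace (configs d T) (op_mult (configs d T) Y (embed_op d (T - W) T B))
    = op_trace (configs d (T - W)) (op_mult (configs d (T - W)) (partial_trace d T W Y) B)"
proof -
  have finW: "finite (configs d W)"
    using assms by (intro finite_configs) (rule finite_subset)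
  have TW: "T - (T - W) = W"
    using assms by auto
  have "op_trace (configs d T) (op_mult (configs d T) Y (embed_op d (T - W) T B))
      = (\<Sum>x\<in>configs d (T - W). \<Sum>w\<in>configs d W. \<Sum>z\<in>configs d (T - W). \<Sum>w'\<in>configs d W.
          Y (override_on x w W) (override_on z w' W) * embed_op d (T - W) T B (override_on z w' W) (override_on x w W))"
    unfolding op_trace_def op_mult_def sum_configs_split[OF assms(1)] ..
  also have "\<dots> = (\<Sum>x\<in>configs d (T - W). \<Sum>w\<in>configs d W. \<Sum>z\<in>configs d (T - W). \<Sum>w'\<in>configs d W.
          if w' = w then Y (override_on x w W) (override_on z w W) * B z x else 0)"
  proof (intro sum.cong refl)
    fix x w z w'
    assume *: "x \<in> configs d (T - W)" "w \<in> configs d W" "z \<in> configs d (T - W)" "w' \<in> configs d W"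
    have "(\<forall>i\<in>W. override_on z w' W i = override_on x w W i) \<longleftrightarrow> w' = w"
      using configs_eqI[OF *(4,2)] by auto
    then show "Y (override_on x w W) (override_on z w' W) * embed_op d (T - W) T B (override_on z w' W) (override_on x w W)
        = (if w' = w then Y (override_on x w W) (override_on z w W) * B z x else 0)"
      using * assms(1) by (auto simp: embed_op_def TW configs_override restrict_override_outer)
  qed
  also have "\<dots> = (\<Sum>x\<in>configs d (T - W). \<Sum>w\<in>configs d W. \<Sum>z\<in>configs d (T - W).
          Y (override_on x w W) (override_on z w W) * B z x)"
    using finW by (intro sum.cong refl) auto
  also have "\<dots> = (\<Sum>x\<in>configs d (T - W). \<Sum>z\<in>configs d (T - W). \<Sum>w\<in>configs d W.
          Y (override_on x w W) (override_on z w W) * B z x)"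
    by (intro sum.cong refl sum.swap)
  also have "\<dots> = op_trace (configs d (T - W)) (op_mult (configs d (T - W)) (partial_trace d T W Y) B)"
    unfolding op_trace_def op_mult_def
    by (intro sum.cong refl) (simp add: partial_trace_def sum_distrib_right)
  finally show ?thesis .
qed

section \<open>Closing boxes of quantum factor graphs\<close>

lemma qfg_update_simps [simp]:
  "fac_nbrs (G\<lparr>local_op := \<rho>\<rparr>) = fac_nbrs G"
  "var_nbrs (G\<lparr>local_op := \<rho>\<rparr>) = var_nbrs G"
  "space_of (G\<lparr>local_op := \<rho>\<rparr>) = space_of G"
  "box_scope (G\<lparr>local_op := \<rho>\<rparr>) = box_scope G"
  "is_box (G\<lparr>local_op := \<rho>\<rparr>) = is_box G"
  by (simp_all add: fac_nbrs_def var_nbrs_def space_of_def box_scope_def is_box_def fun_eq_iff)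

lemma fac_nbrs_subset: "quantum_factor_graph G \<Longrightarrow> fac_nbrs G a \<subseteq> variables G"
  by (auto simp: quantum_factor_graph_def fac_nbrs_def)

lemma box_scope_subset: "quantum_factor_graph G \<Longrightarrow> is_box G W F' \<Longrightarrow> box_scope G W F' \<subseteq> variables G"
  unfolding box_scope_def by (intro Un_least UN_least fac_nbrs_subset) (simp_all add: is_box_def)

text \<open>The box condition at work: operators outside the box act trivially on the traced
  spaces.\<close>

lemma fac_nbrs_outside_box: "is_box G W F' \<Longrightarrow> a \<notin> F' \<Longrightarrow> fac_nbrs G a \<inter> W = {}"
  by (auto simp: is_box_def fac_nbrs_def var_nbrs_def)

lemma close_box_simps [simp]:
  "variables (close_box G W F' b) = variables G - W"
  "factors (close_box G W F' b) = insert b (factors G - F')"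
  "hdim (close_box G W F' b) = hdim G"
  "space_of (close_box G W F' b) = space_of G"
  by (simp_all add: close_box_def space_of_def fun_eq_iff)

lemma local_op_close_box:
  "local_op (close_box G W F' b) b = partial_trace (hdim G) (box_scope G W F') W (joint_op G (box_scope G W F') F')"
  "a \<noteq> b \<Longrightarrow> local_op (close_box G W F' b) a = local_op G a"
  by (simp_all add: close_box_def)

lemma fac_nbrs_close_box:
  assumes "quantum_factor_graph G" "is_box G W F'" "b \<notin> factors G - F'"
  shows "fac_nbrs (close_box G W F' b) b = box_scope G W F' - W"
    and "a \<in> factors G - F' \<Longrightarrow> fac_nbrs (close_box G W F' b) a = fac_nbrs G a"
  using assms
  by (auto simp: close_box_def fac_nbrs_def quantum_factor_graph_def is_box_def var_nbrs_def)

text \<open>Separates the graph, common to all parameter values, from the operators, so that a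
  family remains a family on one graph after closing.\<close>

lemma close_box_update:
  "close_box (G\<lparr>local_op := \<rho>\<rparr>) W F' b = (close_box G W F' b)\<lparr>local_op := \<rho>(b :=
     partial_trace (hdim G) (box_scope G W F') W (joint_op (G\<lparr>local_op := \<rho>\<rparr>) (box_scope G W F') F'))\<rparr>"
  by (simp add: close_box_def)

lemma joint_op_psd:
  assumes "finite S" "finite F'"
    and F': "\<And>a. a \<in> F' \<Longrightarrow> fac_nbrs G a \<subseteq> S \<and> op_psd (space_of G (fac_nbrs G a)) (local_op G a)"
  shows "op_psd (space_of G S) (joint_op G S F')"
proof -
  interpret index_set "space_of G S"
    by unfold_locales (simp add: space_of_def assms(1))
  show ?thesis
    unfolding joint_op_def using assms F'
    by (intro star_prod_psd) (auto simp: space_of_def intro: embed_op_psd)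
qed

text \<open>Star products and partial traces preserve positive semidefiniteness, also for singular
  operators, so closing steps can be iterated.\<close>

lemma close_box_qfg:
  assumes G: "quantum_factor_graph G" and box: "is_box G W F'" and b: "b \<notin> factors G - F'"
  shows "quantum_factor_graph (close_box G W F' b)"
  unfolding quantum_factor_graph_def
proof (intro conjI ballI)
  show "finite (variables (close_box G W F' b))" "finite (factors (close_box G W F' b))"
    using G by (auto simp: quantum_factor_graph_def)
  show "0 < hdim (close_box G W F' b) i" if "i \<in> variables (close_box G W F' b)" for i
    using G that by (auto simp: quantum_factor_graph_def)
  show "edges (close_box G W F' b) \<subseteq> variables (close_box G W F' b) \<times> factors (close_box G W F' b)"
    using G box_scope_subset[OF G box] by (auto simp: close_box_def quantum_factor_graph_def)
  have psd: "op_psd (space_of G (fac_nbrs G a)) (local_op G a)" if "a \<in> factors G" for a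
    using G that by (simp add: quantum_factor_graph_def)
  have fin: "finite (box_scope G W F')" "finite F'"
    using G box box_scope_subset[OF G box]
    by (auto simp: quantum_factor_graph_def is_box_def intro: finite_subset)
  fix a assume a: "a \<in> factors (close_box G W F' b)"
  show "op_psd (space_of (close_box G W F' b) (fac_nbrs (close_box G W F' b) a)) (local_op (close_box G W F' b) a)"
  proof (cases "a = b")
    case True
    have "op_psd (space_of G (box_scope G W F')) (joint_op G (box_scope G W F') F')"
      using fin box psd by (intro joint_op_psd) (auto simp: box_scope_def is_box_def)
    then show ?thesis
      using fin unfolding True local_op_close_box(1) fac_nbrs_close_box(1)[OF G box b] close_box_simps space_of_def
      by (intro partial_trace_psd) (auto simp: box_scope_def)
  next
    case False
    then show ?thesis
      using a psd[of a] fac_nbrs_close_box(2)[OF G box b, of a] by (simp add: local_op_close_box(2))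
  qed
qed

lemma configs_empty: "configs d {} = {\<lambda>_. undefined}"
  by (simp add: configs_def)

text \<open>The empty set of vertices has a single configuration, the constant function
  \<open>undefined\<close>, so an operator over it is one number.\<close>

lemma is_constant_single_factor:
  assumes "quantum_factor_graph G" "variables G = {}" "factors G = {a}"
  shows "is_constant G (local_op G a (\<lambda>_. undefined) (\<lambda>_. undefined))"
proof -
  have "fac_nbrs G a = {}"
    using fac_nbrs_subset[OF assms(1)] assms(2) by blast
  then have "op_psd (configs (hdim G) {}) (local_op G a)"
    using assms by (auto simp: quantum_factor_graph_def space_of_def)
  then have "local_op G a \<in> oprs {\<lambda>_. undefined}"
    unfolding op_psd_def op_hermitian_def configs_empty by blast
  then have "local_op G a = op_scale (local_op G a (\<lambda>_. undefined) (\<lambda>_. undefined)) (op_id (space_of G {}))"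
    unfolding op_scale_def op_id_def space_of_def configs_empty oprs_def
    by (intro ext) (auto simp del: fun_eq_iff)
  with assms show ?thesis
    by (simp add: is_constant_def)
qed

text \<open>Closing a box that contains all factors is always possible.\<close>

lemma shrinks_to_exists:
  assumes "quantum_factor_graph G" "variables G \<noteq> {}"
  shows "\<exists>s z. shrinks_to G s z"
  using assms
proof (induction "card (variables G)" arbitrary: G rule: less_induct)
  case less
  then obtain i where i: "i \<in> variables G"
    by blast
  \<comment> \<open>Any name will do, as no factor vertex remains outside the box.\<close>
  define b :: 'b where "b = undefined"
  define G' where "G' = close_box G {i} (factors G) b"
  have box: "is_box G {i} (factors G)"
    using i less.prems by (auto simp: is_box_def var_nbrs_def quantum_factor_graph_def)
  have b: "b \<notin> factors G - factors G"
    by simp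
  have G': "quantum_factor_graph G'"
    unfolding G'_def by (rule close_box_qfg[OF less.prems(1) box b])
  \<comment> \<open>After one closing step \<open>b\<close> is the only factor vertex, so the graph
    is a constant once the variables are used up. Starting with a variable guarantees that this step
    takes place.\<close>
  have "\<exists>s z. shrinks_to G' s z"
  proof (cases "variables G' = {}")
    case True
    have "is_constant G' (local_op G' b (\<lambda>_. undefined) (\<lambda>_. undefined))"
      by (rule is_constant_single_factor[OF G' True]) (simp add: G'_def)
    then show ?thesis
      by (blast intro: shrinks_done)
  next
    case False
    have "finite (variables G)"
      using less.prems by (simp add: quantum_factor_graph_def)
    then have "card (variables G') < card (variables G)"
      unfolding G'_def close_box_simps using i by (rule card_Diff1_less)
    then show ?thesis
      using less.hyps G' False by blast
  qed
  then show ?case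
    using shrinks_close[OF less.prems(1) box b] unfolding G'_def by blast
qed

section \<open>Logarithms of global operators before and after closing a box\<close>

lemma joint_op_log:
  assumes "finite S" "finite F'"
    and F': "\<And>a. a \<in> F' \<Longrightarrow> fac_nbrs G a \<subseteq> S \<and> op_pd (space_of G (fac_nbrs G a)) (local_op G a)"
  shows "op_pd (space_of G S) (joint_op G S F')"
    and "op_log (space_of G S) (joint_op G S F')
      = (\<Sum>a\<in>F'. embed_op (hdim G) (fac_nbrs G a) S (op_log (space_of G (fac_nbrs G a)) (local_op G a)))"
proof -
  interpret index_set "space_of G S"
    by unfold_locales (simp add: space_of_def assms(1))
  define \<rho> where "\<rho> a = embed_op (hdim G) (fac_nbrs G a) S (local_op G a)" for a
  have pd: "op_pd (space_of G S) (\<rho> a)"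
    and log: "op_log (space_of G S) (\<rho> a) = embed_op (hdim G) (fac_nbrs G a) S (op_log (space_of G (fac_nbrs G a)) (local_op G a))"
    if "a \<in> F'" for a
    using embed_op_log[OF assms(1), of "fac_nbrs G a" "hdim G" "local_op G a"] F'[OF that]
    by (simp_all add: space_of_def \<rho>_def)
  have eq: "joint_op G S F' = op_exp (space_of G S) (\<Sum>a\<in>F'. op_log (space_of G S) (\<rho> a))"
    unfolding joint_op_def \<rho>_def[symmetric] by (rule star_prod_exp[OF assms(2) pd])
  have herm: "op_hermitian (space_of G S) (\<Sum>a\<in>F'. op_log (space_of G S) (\<rho> a))"
    by (rule hermitian_sum_log[OF pd])
  show "op_pd (space_of G S) (joint_op G S F')"
    unfolding eq by (rule exp_pd[OF herm])
  show "op_log (space_of G S) (joint_op G S F')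
      = (\<Sum>a\<in>F'. embed_op (hdim G) (fac_nbrs G a) S (op_log (space_of G (fac_nbrs G a)) (local_op G a)))"
    unfolding eq log_exp[OF herm] by (intro sum.cong refl) (rule log)
qed

context
  fixes G :: "('v, 'f) qfg" and W F' b
  assumes G: "quantum_factor_graph G" and box: "is_box G W F'" and b: "b \<notin> factors G - F'"
    and pd: "\<And>a. a \<in> factors G \<Longrightarrow> op_pd (space_of G (fac_nbrs G a)) (local_op G a)"
begin

lemma box_finite: "finite (variables G)" "finite (factors G)" "finite F'" "finite W"
    "finite (box_scope G W F')" "F' \<subseteq> factors G" "W \<subseteq> variables G" "W \<subseteq> box_scope G W F'"
    "box_scope G W F' \<subseteq> variables G"
proof -
  show fin: "finite (variables G)" "finite (factors G)"
    using G by (auto simp: quantum_factor_graph_def)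
  show "F' \<subseteq> factors G" "W \<subseteq> variables G" "W \<subseteq> box_scope G W F'"
    using box by (auto simp: is_box_def box_scope_def)
  with fin show "finite F'" "finite W"
    by (auto intro: finite_subset)
  show "box_scope G W F' \<subseteq> variables G"
    by (rule box_scope_subset[OF G box])
  with fin show "finite (box_scope G W F')"
    by (auto intro: finite_subset)
qed

lemma box_nbrs: "a \<in> F' \<Longrightarrow> fac_nbrs G a \<subseteq> box_scope G W F'"
    "a \<in> factors G - F' \<Longrightarrow> fac_nbrs G a \<subseteq> variables G - W"
  using fac_nbrs_outside_box[OF box, of a] fac_nbrs_subset[OF G, of a] by (auto simp: box_scope_def)

text \<open>For positive definite operators the global logarithm is a sum over the factors.
  Splitting it at the border of the box exhibits the global operator as the exponential of a sum of
  two logarithms, the form that the trace estimate treats.\<close>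

lemma box_logs:
  defines "R \<equiv> joint_op G (box_scope G W F') F'" and "S \<equiv> joint_op G (variables G - W) (factors G - F')"
  shows "op_pd (space_of G (variables G)) (embed_op (hdim G) (box_scope G W F') (variables G) R)"
    and "op_pd (space_of G (variables G - W)) S"
    and "op_pd (space_of G (variables G)) (embed_op (hdim G) (variables G - W) (variables G) S)"
    and "op_log (space_of G (variables G - W)) S
      = (\<Sum>a\<in>factors G - F'. embed_op (hdim G) (fac_nbrs G a) (variables G - W) (op_log (space_of G (fac_nbrs G a)) (local_op G a)))"
    and "global_op G = op_exp (space_of G (variables G))
      (op_log (space_of G (variables G)) (embed_op (hdim G) (box_scope G W F') (variables G) R)
       + op_log (space_of G (variables G)) (embed_op (hdim G) (variables G - W) (variables G) S))"
proof -
  interpret index_set "space_of G (variables G)"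
    by unfold_locales (simp add: space_of_def box_finite)
  define l where "l a = op_log (space_of G (fac_nbrs G a)) (local_op G a)" for a
  have all: "fac_nbrs G a \<subseteq> variables G \<and> op_pd (space_of G (fac_nbrs G a)) (local_op G a)"
    if "a \<in> factors G" for a
    using that fac_nbrs_subset[OF G] pd by blast
  have inside: "fac_nbrs G a \<subseteq> box_scope G W F' \<and> op_pd (space_of G (fac_nbrs G a)) (local_op G a)"
    if "a \<in> F'" for a
    using box_nbrs(1)[OF that] all[of a] box_finite(6) that by blast
  have outside: "fac_nbrs G a \<subseteq> variables G - W \<and> op_pd (space_of G (fac_nbrs G a)) (local_op G a)"
    if "a \<in> factors G - F'" for a
    using box_nbrs(2)[OF that] all[of a] that by blast
  have R: "op_pd (space_of G (box_scope G W F')) R"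
    "op_log (space_of G (box_scope G W F')) R = (\<Sum>a\<in>F'. embed_op (hdim G) (fac_nbrs G a) (box_scope G W F') (l a))"
    unfolding R_def l_def by (rule joint_op_log[OF box_finite(5,3) inside], assumption)+
  have S: "op_pd (space_of G (variables G - W)) S"
    "op_log (space_of G (variables G - W)) S = (\<Sum>a\<in>factors G - F'. embed_op (hdim G) (fac_nbrs G a) (variables G - W) (l a))"
    unfolding S_def l_def
    by (rule joint_op_log[OF finite_Diff[OF box_finite(1)] finite_Diff[OF box_finite(2)] outside], assumption)+
  show "op_pd (space_of G (variables G - W)) S"
    and "op_log (space_of G (variables G - W)) S
      = (\<Sum>a\<in>factors G - F'. embed_op (hdim G) (fac_nbrs G a) (variables G - W) (op_log (space_of G (fac_nbrs G a)) (local_op G a)))"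
    using S by (simp_all add: l_def)
  note eR = embed_op_log[OF box_finite(1,9) R(1)[unfolded space_of_def], folded space_of_def]
  note eS = embed_op_log[OF box_finite(1) Diff_subset S(1)[unfolded space_of_def], folded space_of_def]
  show "op_pd (space_of G (variables G)) (embed_op (hdim G) (box_scope G W F') (variables G) R)"
    by (rule eR(1))
  show "op_pd (space_of G (variables G)) (embed_op (hdim G) (variables G - W) (variables G) S)"
    by (rule eS(1))
  have "global_op G = op_exp (space_of G (variables G)) (\<Sum>a\<in>factors G. embed_op (hdim G) (fac_nbrs G a) (variables G) (l a))"
  proof -
    have g: "op_pd (space_of G (variables G)) (global_op G)"
      "op_log (space_of G (variables G)) (global_op G) = (\<Sum>a\<in>factors G. embed_op (hdim G) (fac_nbrs G a) (variables G) (l a))"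
      unfolding global_op_def l_def by (rule joint_op_log[OF box_finite(1,2) all], assumption)+
    show ?thesis
      using pd_log(2)[OF g(1)] by (simp add: g(2))
  qed
  also have "(\<Sum>a\<in>factors G. embed_op (hdim G) (fac_nbrs G a) (variables G) (l a))
      = (\<Sum>a\<in>F'. embed_op (hdim G) (fac_nbrs G a) (variables G) (l a))
        + (\<Sum>a\<in>factors G - F'. embed_op (hdim G) (fac_nbrs G a) (variables G) (l a))"
    using sum.subset_diff[OF box_finite(6,2)] by (simp add: add.commute)
  also have "(\<Sum>a\<in>F'. embed_op (hdim G) (fac_nbrs G a) (variables G) (l a))
      = op_log (space_of G (variables G)) (embed_op (hdim G) (box_scope G W F') (variables G) R)"
    unfolding eR(2) R(2) embed_op_sum
    by (intro sum.cong refl embed_op_trans[symmetric] box_nbrs box_finite)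
  also have "(\<Sum>a\<in>factors G - F'. embed_op (hdim G) (fac_nbrs G a) (variables G) (l a))
      = op_log (space_of G (variables G)) (embed_op (hdim G) (variables G - W) (variables G) S)"
    unfolding eS(2) S(2) embed_op_sum
    by (intro sum.cong refl embed_op_trans[symmetric] box_nbrs Diff_subset)
  finally show "global_op G = op_exp (space_of G (variables G))
      (op_log (space_of G (variables G)) (embed_op (hdim G) (box_scope G W F') (variables G) R)
       + op_log (space_of G (variables G)) (embed_op (hdim G) (variables G - W) (variables G) S))" .
qed

text \<open>Only the inner summand changes, from the embedded star product of the box to its partial
  trace \<open>T\<close>; the outer logarithm is the same sum, now on
  \<open>variables G - W\<close>.\<close>

lemma global_op_close_box:
  defines "T \<equiv> partial_trace (hdim G) (box_scope G W F') W (joint_op G (box_scope G W F') F')"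
    and "S \<equiv> joint_op G (variables G - W) (factors G - F')"
  assumes T: "op_pd (space_of G (box_scope G W F' - W)) T"
  shows "global_op (close_box G W F' b) = op_exp (space_of G (variables G - W))
      (op_log (space_of G (variables G - W)) (embed_op (hdim G) (box_scope G W F' - W) (variables G - W) T)
       + op_log (space_of G (variables G - W)) S)"
proof -
  define G' where "G' = close_box G W F' b"
  interpret index_set "space_of G (variables G - W)"
    by unfold_locales (simp add: space_of_def box_finite)
  note nbrs = fac_nbrs_close_box[OF G box b, folded G'_def]
  have "a \<noteq> b" if "a \<in> factors G - F'" for a
    using that b by blast
  then have ops: "local_op G' b = T" "\<And>a. a \<in> factors G - F' \<Longrightarrow> local_op G' a = local_op G a"
    by (simp_all add: G'_def T_def local_op_close_box)
  have simps: "variables G' = variables G - W" "factors G' = insert b (factors G - F')"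
    "hdim G' = hdim G" "space_of G' = space_of G"
    by (simp_all add: G'_def)
  have asm: "fac_nbrs G' a \<subseteq> variables G' \<and> op_pd (space_of G' (fac_nbrs G' a)) (local_op G' a)"
    if "a \<in> factors G'" for a
  proof (cases "a = b")
    case True
    then show ?thesis
      using T box_finite(9) by (auto simp: nbrs ops simps)
  next
    case False
    then have "a \<in> factors G - F'"
      using that by (simp add: simps)
    then show ?thesis
      using pd[of a] box_nbrs(2)[of a] by (simp add: nbrs ops simps)
  qed
  have fin: "finite (variables G')" "finite (factors G')"
    using box_finite by (simp_all add: simps)
  have g: "op_pd (space_of G' (variables G')) (global_op G')"
    "op_log (space_of G' (variables G')) (global_op G')
      = (\<Sum>a\<in>factors G'. embed_op (hdim G') (fac_nbrs G' a) (variables G') (op_log (space_of G' (fac_nbrs G' a)) (local_op G' a)))"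
    unfolding global_op_def by (rule joint_op_log[OF fin asm], assumption)+
  have "global_op G' = op_exp (space_of G (variables G - W)) (op_log (space_of G' (variables G')) (global_op G'))"
    using pd_log(2)[of "global_op G'"] g(1) by (simp add: simps)
  also have "op_log (space_of G' (variables G')) (global_op G')
      = embed_op (hdim G) (box_scope G W F' - W) (variables G - W) (op_log (space_of G (box_scope G W F' - W)) T)
        + (\<Sum>a\<in>factors G - F'. embed_op (hdim G) (fac_nbrs G a) (variables G - W) (op_log (space_of G (fac_nbrs G a)) (local_op G a)))"
    unfolding g(2) unfolding simps using b box_finite
    by (subst sum.insert) (auto simp: nbrs ops intro!: arg_cong2[of _ _ _ _ "(+)"] sum.cong)
  also have "embed_op (hdim G) (box_scope G W F' - W) (variables G - W) (op_log (space_of G (box_scope G W F' - W)) T)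
      = op_log (space_of G (variables G - W)) (embed_op (hdim G) (box_scope G W F' - W) (variables G - W) T)"
    using T box_finite(1,9) unfolding space_of_def by (intro embed_op_log(2)[symmetric]) auto
  also have "(\<Sum>a\<in>factors G - F'. embed_op (hdim G) (fac_nbrs G a) (variables G - W) (op_log (space_of G (fac_nbrs G a)) (local_op G a)))
      = op_log (space_of G (variables G - W)) S"
    unfolding S_def by (rule box_logs(4)[symmetric])
  finally show ?thesis
    by (simp add: G'_def)
qed

end

section \<open>Families of factor graphs near the identity\<close>

lemma near_id_joint_op:
  assumes "finite S" "finite F'"
    and F': "\<And>a. a \<in> F' \<Longrightarrow> fac_nbrs G a \<subseteq> S \<and> near_id (space_of G (fac_nbrs G a)) (c a) (\<lambda>t. \<rho> t a)"
  shows "near_id (space_of G S) (prod c F') (\<lambda>t. joint_op (G\<lparr>local_op := \<rho> t\<rparr>) S F')"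
proof -
  interpret index_set "space_of G S"
    by unfold_locales (simp add: space_of_def assms(1))
  show ?thesis
    unfolding joint_op_def qfg_update_simps
  proof (simp, rule near_id_star_prod[OF assms(2)])
    show "near_id (space_of G S) (c a) (\<lambda>t. embed_op (hdim G) (fac_nbrs G a) S (\<rho> t a))" if "a \<in> F'" for a
      using F'[OF that] unfolding space_of_def by (auto intro: near_id_embed)
  qed
qed

lemma near_id_pd_configs:
  "finite S \<Longrightarrow> near_id (configs d S) c A \<Longrightarrow> \<forall>\<^sub>F t in at 0. op_pd (configs d S) (A t)"
  by (rule index_set.near_id_pd) (simp_all add: index_set_def)

lemma near_id_family_pd:
  assumes G: "quantum_factor_graph G"
    and \<rho>: "\<And>a. a \<in> factors G \<Longrightarrow> near_id (space_of G (fac_nbrs G a)) (c a) (\<lambda>t. \<rho> t a)"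
  shows "\<forall>\<^sub>F t in at 0. quantum_factor_graph (G\<lparr>local_op := \<rho> t\<rparr>) \<and>
    (\<forall>a\<in>factors G. op_pd (space_of G (fac_nbrs G a)) (\<rho> t a))"
proof -
  have fin: "finite (variables G)" "finite (factors G)"
    using G by (auto simp: quantum_factor_graph_def)
  have fin': "finite (fac_nbrs G a)" for a
    using fin fac_nbrs_subset[OF G] by (blast intro: finite_subset)
  have "\<forall>\<^sub>F t in at 0. \<forall>a\<in>factors G. op_pd (space_of G (fac_nbrs G a)) (\<rho> t a)"
    using fin \<rho> unfolding space_of_def
    by (auto simp: eventually_ball_finite_distrib intro!: near_id_pd_configs fin')
  then show ?thesis
  proof eventually_elim
    case (elim t)
    have "op_psd (space_of G (fac_nbrs G a)) (\<rho> t a)" if "a \<in> factors G" for a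
      using elim that fin' by (intro index_set.pd_imp_psd) (auto simp: index_set_def space_of_def)
    then show ?case
      using G elim by (simp add: quantum_factor_graph_def)
  qed
qed

text \<open>With \<open>R\<close> the star product inside the box and \<open>S\<close> the one outside, the fourth-order
  Golden-Thompson estimate reduces the claim to \<open>tr (R S) = tr (tr\<^sub>W R S)\<close>.\<close>

lemma close_box_partition_sum:
  assumes G: "quantum_factor_graph G" and box: "is_box G W F'" and b: "b \<notin> factors G - F'"
    and \<rho>: "\<And>a. a \<in> factors G \<Longrightarrow> near_id (space_of G (fac_nbrs G a)) (c a) (\<lambda>t. \<rho> t a)"
  shows "(\<lambda>t. partition_sum (close_box (G\<lparr>local_op := \<rho> t\<rparr>) W F' b) - partition_sum (G\<lparr>local_op := \<rho> t\<rparr>))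
    \<in> O[at 0](\<lambda>t. of_real t ^ 4)"
    and "near_id (space_of G (box_scope G W F' - W)) (prod c F' * card (configs (hdim G) W))
      (\<lambda>t. partial_trace (hdim G) (box_scope G W F') W (joint_op (G\<lparr>local_op := \<rho> t\<rparr>) (box_scope G W F') F'))"
proof -
  define d where "d = hdim G"
  define V where "V = variables G"
  define B where "B = box_scope G W F'"
  define R where "R t = joint_op (G\<lparr>local_op := \<rho> t\<rparr>) B F'" for t
  define S where "S t = joint_op (G\<lparr>local_op := \<rho> t\<rparr>) (V - W) (factors G - F')" for t
  define T where "T t = partial_trace d B W (R t)" for t
  have fin: "finite V" "finite (factors G)" and F': "F' \<subseteq> factors G" and WV: "W \<subseteq> V"
    using G box by (auto simp: quantum_factor_graph_def is_box_def V_def)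
  have WB: "W \<subseteq> B"
    by (auto simp: B_def box_scope_def)
  have BV: "B \<subseteq> V"
    unfolding B_def V_def by (rule box_scope_subset[OF G box])
  have fin': "finite F'" "finite W" "finite B"
    using fin F' WV BV by (auto intro: finite_subset)
  have dpos: "0 < d i" if "i \<in> W" for i
    using G that WV by (auto simp: quantum_factor_graph_def d_def V_def)
  interpret XV: index_set "configs d V"
    by unfold_locales (simp add: fin)
  interpret XW: index_set "configs d (V - W)"
    by unfold_locales (simp add: fin)
  have nearR: "near_id (configs d B) (prod c F') R"
    using near_id_joint_op[OF fin'(3,1), of G c \<rho>] \<rho> F'
    unfolding R_def space_of_def d_def by (auto simp: B_def box_scope_def)
  have nearS: "near_id (configs d (V - W)) (prod c (factors G - F')) S"
    using near_id_joint_op[of "V - W" "factors G - F'" G c \<rho>] \<rho> fin fac_nbrs_subset[OF G]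
      fac_nbrs_outside_box[OF box]
    unfolding S_def space_of_def d_def V_def by fastforce
  have nearT: "near_id (configs d (B - W)) (prod c F' * card (configs d W)) T"
    unfolding T_def by (rule near_id_partial_trace[OF fin'(2) WB dpos nearR])
  then show "near_id (space_of G (box_scope G W F' - W)) (prod c F' * card (configs (hdim G) W))
      (\<lambda>t. partial_trace (hdim G) (box_scope G W F') W (joint_op (G\<lparr>local_op := \<rho> t\<rparr>) (box_scope G W F') F'))"
    unfolding T_def R_def d_def B_def space_of_def .
  have sub: "B - W \<subseteq> V - W"
    using BV by auto
  note eR = near_id_embed[OF BV nearR]
  note eS = near_id_embed[OF Diff_subset nearS]
  note eT = near_id_embed[OF sub nearT]
  \<comment> \<open>The same estimate on two spaces: before closing with \<open>R\<close> and
    \<open>S\<close>, after closing with \<open>T\<close> and \<open>S\<close>. The product traces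
    agree by \<open>tr\<close> and cancel when the two estimates are subtracted.\<close>
  note o1 = XV.golden_thompson[OF eR eS]
  note o2 = XW.golden_thompson[OF eT nearS]
  have tr: "op_trace (configs d V) (op_mult (configs d V) (embed_op d B V (R t)) (embed_op d (V - W) V (S t)))
      = op_trace (configs d (V - W)) (op_mult (configs d (V - W)) (embed_op d (B - W) (V - W) (T t)) (S t))" for t
    unfolding trace_mult_embed[OF WV fin(1)] partial_trace_embed[OF WB BV] T_def ..
  have pdT: "\<forall>\<^sub>F t in at 0. op_pd (configs d (B - W)) (T t)"
    using fin'(3) nearT by (intro near_id_pd_configs) auto
  have pd: "\<forall>\<^sub>F t in at 0. quantum_factor_graph (G\<lparr>local_op := \<rho> t\<rparr>) \<and>
    (\<forall>a\<in>factors G. op_pd (space_of G (fac_nbrs G a)) (\<rho> t a))"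
    by (rule near_id_family_pd[OF G \<rho>])
  from sum_in_bigo(2)[OF o2 o1]
  show "(\<lambda>t. partition_sum (close_box (G\<lparr>local_op := \<rho> t\<rparr>) W F' b) - partition_sum (G\<lparr>local_op := \<rho> t\<rparr>))
    \<in> O[at 0](\<lambda>t. of_real t ^ 4)"
  proof (rule bigo_transform)
    show "\<forall>\<^sub>F t in at 0.
      op_trace (configs d (V - W)) (op_exp (configs d (V - W)) (op_log (configs d (V - W)) (embed_op d (B - W) (V - W) (T t)) + op_log (configs d (V - W)) (S t)))
      - op_trace (configs d (V - W)) (op_mult (configs d (V - W)) (embed_op d (B - W) (V - W) (T t)) (S t))
      - (op_trace (configs d V) (op_exp (configs d V) (op_log (configs d V) (embed_op d B V (R t)) + op_log (configs d V) (embed_op d (V - W) V (S t))))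
      - op_trace (configs d V) (op_mult (configs d V) (embed_op d B V (R t)) (embed_op d (V - W) V (S t))))
      = partition_sum (close_box (G\<lparr>local_op := \<rho> t\<rparr>) W F' b) - partition_sum (G\<lparr>local_op := \<rho> t\<rparr>)"
      using pd pdT
    proof eventually_elim
      case (elim t)
      define Gt where "Gt = G\<lparr>local_op := \<rho> t\<rparr>"
      have Gt: "quantum_factor_graph Gt" "is_box Gt W F'" "b \<notin> factors Gt - F'"
        "\<And>a. a \<in> factors Gt \<Longrightarrow> op_pd (space_of Gt (fac_nbrs Gt a)) (local_op Gt a)"
        using elim box b by (simp_all add: Gt_def)
      have simps: "variables Gt = V" "factors Gt = factors G" "hdim Gt = d" "space_of Gt = configs d"
        "box_scope Gt W F' = B" "joint_op Gt B F' = R t" "joint_op Gt (V - W) (factors G - F') = S t"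
        by (simp_all add: Gt_def V_def B_def d_def R_def S_def space_of_def fun_eq_iff)
      have "global_op Gt = op_exp (configs d V) (op_log (configs d V) (embed_op d B V (R t)) + op_log (configs d V) (embed_op d (V - W) V (S t)))"
        using box_logs(5)[OF Gt] by (simp add: simps)
      moreover have "global_op (close_box Gt W F' b) = op_exp (configs d (V - W)) (op_log (configs d (V - W)) (embed_op d (B - W) (V - W) (T t)) + op_log (configs d (V - W)) (S t))"
        using global_op_close_box[OF Gt] elim by (simp add: simps T_def)
      ultimately show ?case
        by (simp add: partition_sum_def tr simps flip: Gt_def)
    qed
  qed
qed

text \<open>The derivation for one choice of operators supplies an admissible sequence of boxes,
  which is replayed for the family. \<open>c\<close> and \<open>\<rho>\<close> are generalised
  because the operator of a closed box is again close to a multiple of the identity, but with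
  another constant. The errors of the finitely many steps add up.\<close>

lemma shrinks_to_near_id:
  assumes "shrinks_to G s z"
    and "\<And>a. a \<in> factors G \<Longrightarrow> near_id (space_of G (fac_nbrs G a)) (c a) (\<lambda>t. \<rho> t a)"
  shows "\<exists>Zhat. (\<forall>\<^sub>F t in at 0. shrinks_to (G\<lparr>local_op := \<rho> t\<rparr>) s (Zhat t)) \<and>
    (\<lambda>t. Zhat t - partition_sum (G\<lparr>local_op := \<rho> t\<rparr>)) \<in> O[at 0](\<lambda>t. of_real t ^ 4)"
  using assms
proof (induction arbitrary: c \<rho> rule: shrinks_to.induct)
  case (shrinks_done G z)
  then obtain a where G: "quantum_factor_graph G" "variables G = {}" "factors G = {a}"
    by (auto simp: is_constant_def)
  have nbrs: "fac_nbrs G a = {}"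
    using fac_nbrs_subset[OF G(1)] G(2) by blast
  define Zhat where "Zhat t = \<rho> t a (\<lambda>_. undefined) (\<lambda>_. undefined)" for t
  have pd: "\<forall>\<^sub>F t in at 0. quantum_factor_graph (G\<lparr>local_op := \<rho> t\<rparr>) \<and>
    (\<forall>a\<in>factors G. op_pd (space_of G (fac_nbrs G a)) (\<rho> t a))"
    by (rule near_id_family_pd[OF G(1) shrinks_done.prems])
  have "\<forall>\<^sub>F t in at 0. shrinks_to (G\<lparr>local_op := \<rho> t\<rparr>) [] (Zhat t)"
    using pd
  proof eventually_elim
    case (elim t)
    then show ?case
      using is_constant_single_factor[of "G\<lparr>local_op := \<rho> t\<rparr>" a] G
      by (auto simp: Zhat_def intro: shrinks_to.shrinks_done)
  qed
  \<comment> \<open>Without variables there is no error: a single number is recovered from its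
    logarithm at every \<open>t\<close> where it is positive.\<close>
  moreover have "\<forall>\<^sub>F t in at 0. 0 = Zhat t - partition_sum (G\<lparr>local_op := \<rho> t\<rparr>)"
    using pd
  proof eventually_elim
    case (elim t)
    interpret index_set "configs (hdim G) {}"
      by unfold_locales simp
    have \<rho>: "op_pd (configs (hdim G) {}) (\<rho> t a)"
      using elim G nbrs by (simp add: space_of_def)
    then have "embed_op (hdim G) {} {} (\<rho> t a) = \<rho> t a"
      by (intro embed_op_self) (simp add: op_pd_def op_hermitian_def)
    then have "global_op (G\<lparr>local_op := \<rho> t\<rparr>) = star_prod (configs (hdim G) {}) (\<lambda>a. embed_op (hdim G) (fac_nbrs G a) {} (\<rho> t a)) {a}"
      by (simp add: global_op_def joint_op_def G space_of_def)
    also have "\<dots> = op_exp (configs (hdim G) {}) (op_log (configs (hdim G) {}) (\<rho> t a))"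
      using \<rho> \<open>embed_op (hdim G) {} {} (\<rho> t a) = \<rho> t a\<close> by (subst star_prod_exp) (simp_all add: nbrs)
    also have "\<dots> = \<rho> t a"
      by (rule pd_log(2)[OF \<rho>])
    finally show ?case
      by (simp add: partition_sum_def G op_trace_def space_of_def configs_empty Zhat_def)
  qed
  then have "(\<lambda>t. Zhat t - partition_sum (G\<lparr>local_op := \<rho> t\<rparr>)) \<in> O[at 0](\<lambda>t. of_real t ^ 4)"
    by (rule bigo_transform[rotated]) simp
  ultimately show ?case by blast
next
  case (shrinks_close G i F' b s z)
  define G' where "G' = close_box G {i} F' b"
  define \<rho>' where "\<rho>' t = (\<rho> t)(b := partial_trace (hdim G) (box_scope G {i} F') {i}
    (joint_op (G\<lparr>local_op := \<rho> t\<rparr>) (box_scope G {i} F') F'))" for t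
  \<comment> \<open>Constants multiply under star products, and tracing out \<open>i\<close>
    contributes the dimension of its space.\<close>
  define c' where "c' = c(b := prod c F' * card (configs (hdim G) {i}))"
  have close: "close_box (G\<lparr>local_op := \<rho> t\<rparr>) {i} F' b = G'\<lparr>local_op := \<rho>' t\<rparr>" for t
    unfolding G'_def \<rho>'_def by (rule close_box_update)
  note box = shrinks_close.hyps(1-3)
  note nbrs = fac_nbrs_close_box[OF box, folded G'_def]
  have "near_id (space_of G' (fac_nbrs G' a)) (c' a) (\<lambda>t. \<rho>' t a)" if "a \<in> factors G'" for a
  proof (cases "a = b")
    case True
    show ?thesis
      unfolding True nbrs c'_def \<rho>'_def
      using close_box_partition_sum(2)[of G "{i}" F' b c \<rho>, OF box shrinks_close.prems] by (simp add: G'_def)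
  next
    case False
    then have "a \<in> factors G - F'"
      using that by (simp add: G'_def)
    then show ?thesis
      using False shrinks_close.prems[of a] by (simp add: nbrs c'_def \<rho>'_def) (simp add: G'_def)
  qed
  from shrinks_close.IH[folded G'_def, of c' \<rho>', OF this]
  obtain Zhat where Z: "\<forall>\<^sub>F t in at 0. shrinks_to (G'\<lparr>local_op := \<rho>' t\<rparr>) s (Zhat t)"
    "(\<lambda>t. Zhat t - partition_sum (G'\<lparr>local_op := \<rho>' t\<rparr>)) \<in> O[at 0](\<lambda>t. of_real t ^ 4)"
    by blast
  have pd: "\<forall>\<^sub>F t in at 0. quantum_factor_graph (G\<lparr>local_op := \<rho> t\<rparr>) \<and>
    (\<forall>a\<in>factors G. op_pd (space_of G (fac_nbrs G a)) (\<rho> t a))"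
    by (rule near_id_family_pd[OF box(1) shrinks_close.prems])
  have "\<forall>\<^sub>F t in at 0. shrinks_to (G\<lparr>local_op := \<rho> t\<rparr>) ((i, F', b) # s) (Zhat t)"
    using Z(1) pd by eventually_elim (use box in \<open>auto intro!: shrinks_to.shrinks_close simp: close\<close>)
  moreover have "(\<lambda>t. Zhat t - partition_sum (G\<lparr>local_op := \<rho> t\<rparr>)) \<in> O[at 0](\<lambda>t. of_real t ^ 4)"
  proof -
    have "(\<lambda>t. partition_sum (close_box (G\<lparr>local_op := \<rho> t\<rparr>) {i} F' b) - partition_sum (G\<lparr>local_op := \<rho> t\<rparr>))
        \<in> O[at 0](\<lambda>t. of_real t ^ 4)"
      by (rule close_box_partition_sum(1)[OF box shrinks_close.prems])
    from sum_in_bigo(1)[OF Z(2) this] show ?thesis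
      by (simp add: close)
  qed
  ultimately show ?case by blast
qed

text \<open>The deviation from the multiple of the identity is exactly \<open>t * c * H\<close>;
  through this the operators of the theorem enter the general class.\<close>

lemma near_id_linear:
  assumes "0 < c" "op_hermitian X H"
  shows "near_id X c (\<lambda>t. op_scale (of_real c) (op_add (op_id X) (op_scale (of_real t) H)))"
  unfolding near_id_def
proof (intro conjI)
  show "\<forall>\<^sub>F t in at 0. op_hermitian X (op_scale (of_real c) (op_add (op_id X) (op_scale (of_real t) H)))"
    using assms(2) by (intro always_eventually allI)
      (auto simp: op_hermitian_iff op_add_eq_plus op_adj_scale op_adj_add intro!: oprs_scale oprs_add)
  have "op_scale (of_real c) (op_add (op_id X) (op_scale (of_real t) H)) - op_scale (of_real c) (op_id X)
      = (\<lambda>x y. of_real t * (of_real c * H x y))" for t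
    by (simp add: op_add_eq_plus op_scale_add) (simp add: op_scale_def mult_ac)
  then show "op_bigo 1 (\<lambda>t. op_scale (of_real c) (op_add (op_id X) (op_scale (of_real t) H))
      - op_scale (of_real c) (op_id X))"
    by (simp add: op_bigo_def)
qed fact

theorem theorem3p12:
  fixes G :: "('v, 'f) qfg"
  assumes "quantum_factor_graph G"
    and "acyclic_qfg G"
    and "variables G \<noteq> {}"
  shows "(\<exists>s Zhat. shrinks_to G s Zhat) \<and>
    (\<forall>s Zhat0 (c :: 'f \<Rightarrow> real) (H :: 'f \<Rightarrow> ('v \<Rightarrow> nat) opr).
       shrinks_to G s Zhat0 \<longrightarrow>
       (\<forall>a\<in>factors G. 0 < c a \<and> op_hermitian (space_of G (fac_nbrs G a)) (H a)) \<longrightarrow>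
       (\<exists>Zhat :: real \<Rightarrow> complex.
          (\<forall>\<^sub>F t in at 0. shrinks_to (near_identity_qfg G c H t) s (Zhat t)) \<and>
          (\<lambda>t. Zhat t - partition_sum (near_identity_qfg G c H t))
            \<in> O[at 0](\<lambda>t. complex_of_real t ^ 4)))"
proof (intro conjI allI impI)
  show "\<exists>s Zhat. shrinks_to G s Zhat"
    by (rule shrinks_to_exists[OF assms(1,3)])
next
  fix s Zhat0 and c :: "'f \<Rightarrow> real" and H :: "'f \<Rightarrow> ('v \<Rightarrow> nat) opr"
  assume s: "shrinks_to G s Zhat0"
    and H: "\<forall>a\<in>factors G. 0 < c a \<and> op_hermitian (space_of G (fac_nbrs G a)) (H a)"
  show "\<exists>Zhat :: real \<Rightarrow> complex.
          (\<forall>\<^sub>F t in at 0. shrinks_to (near_identity_qfg G c H t) s (Zhat t)) \<and>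
          (\<lambda>t. Zhat t - partition_sum (near_identity_qfg G c H t))
            \<in> O[at 0](\<lambda>t. complex_of_real t ^ 4)"
    unfolding near_identity_qfg_def
    using s by (rule shrinks_to_near_id) (use H in \<open>auto intro: near_id_linear\<close>)
qed

end
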